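(* Let $G$ be a compact Abelian group, $X,Y$ Banach spaces, $0<s\le1$ and $1/r=1/s-1$ (so $r=\infty$ if $s=1$). If $T\in\Pi_s(X,Y)$, i.e. $T\in L(X,Y)$ is $s$-absolutely summing, then $T$ possesses the property $(\mathfrak l_r)$.
   Context: All Banach spaces are complex. $\Gamma$ is the dual group of $G$, $m$ the normalized Haar measure, $M(G)=C(G)^*$ the space of finite regular Borel complex measures, $C(G,X)$ the space of continuous $X$-valued functions on $G$ with the sup norm. For $\overline f\in C(G,X)$ the convolution operator $\star\overline f: M(G)\to C(G,X)$ is $(\star\overline f)(\mu)(t)=\int_G\overline f(t-u)\,d\mu(u)\in X$, and the Fourier coefficients are $\widehat{\overline f}(\gamma)=\int_G\overline{\gamma(t)}\,\overline f(t)\,dm(t)\in X$, $\gamma\in\Gamma$ (the bar in $\overline f$ is only notation for a vector-valued function). For a Hilbert space $H$ and $0<r<\infty$, $S_r(H)$ is the Schatten class of compact operators whose singular numbers lie in $l_r$; $S_\infty(H)$ is understood as $L(H)$, all bounded operators. Property $(\mathfrak l_r)$ (where $0<s\le 1$, $1/r=1/s-1$): $T\in L(X,Y)$ possesses $(\mathfrak l_r)$ if for every $\overline f\in C(G,X)$ such that $\star\overline f=BUA$ with a Hilbert space $H$, $U\in S_r(H)$ and bounded operators $A: M(G)\to H$, $B: H\to C(G,X)$, the family $(T\widehat{\overline f}(\gamma))_{\gamma\in\Gamma}$ is absolutely $s$-summable, i.e. $\sum_\gamma\|T\widehat{\overline f}(\gamma)\|^s<\infty$. For $0<s<\infty$,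 $T\in\Pi_s(X,Y)$ means there is $C>0$ with $\sum_{n=1}^N\|Tx_n\|^s\le C^s\sup_{\|x'\|\le1}\sum_{n=1}^N|\langle x_n,x'\rangle|^s$ for all finite sequences in $X$. *)

theory Defs
  imports "HOL-Analysis.Analysis"
begin

section \<open>Complex normed and Hilbert spaces\<close>

class complex_normed_vector = real_normed_vector +
  fixes scaleC :: "complex \<Rightarrow> 'a \<Rightarrow> 'a"  (infixr "*\<^sub>C" 75)
  assumes scaleC_add_right: "a *\<^sub>C (x + y) = a *\<^sub>C x + a *\<^sub>C y"
    and scaleC_add_left: "(a + b) *\<^sub>C x = a *\<^sub>C x + b *\<^sub>C x"
    and scaleC_scaleC: "a *\<^sub>C (b *\<^sub>C x) = (a * b) *\<^sub>C x"
    and scaleR_scaleC: "r *\<^sub>R x = complex_of_real r *\<^sub>C x"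
    and norm_scaleC: "norm (a *\<^sub>C x) = cmod a * norm x"

class complex_banach = complex_normed_vector + complete_space

subclass (in complex_banach) banach ..

text \<open>The inner product is linear in the first and conjugate linear in the second argument.\<close>

class complex_hilbert = complex_banach +
  fixes cinner :: "'a \<Rightarrow> 'a \<Rightarrow> complex"
  assumes cinner_commute: "cinner x y = cnj (cinner y x)"
    and cinner_add_left: "cinner (x + y) z = cinner x z + cinner y z"
    and cinner_scaleC_left: "cinner (c *\<^sub>C x) y = c * cinner x y"
    and cinner_self: "cinner x x = complex_of_real ((norm x)\<^sup>2)"

lemma scaleC_one [simp]: "1 *\<^sub>C x = (x::'a::complex_normed_vector)"
  using scaleR_scaleC[of 1 x] by simp

lemma vector_space_scaleC: "vector_space (scaleC :: complex \<Rightarrow> 'a::complex_normed_vector \<Rightarrow> 'a)"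
  by standard (simp_all add: scaleC_add_right scaleC_add_left scaleC_scaleC)

lemma scaleC_zero_right [simp]: "c *\<^sub>C 0 = (0::'a::complex_normed_vector)"
  using norm_scaleC[of c "0::'a"] by simp

lemma scaleC_zero_left [simp]: "0 *\<^sub>C x = (0::'a::complex_normed_vector)"
  using norm_scaleC[of 0 x] by simp

lemma scaleC_diff_right: "c *\<^sub>C (x - y) = c *\<^sub>C x - c *\<^sub>C (y::'a::complex_normed_vector)"
  using scaleC_add_right[of c "x - y" y] by (simp add: algebra_simps)

lemma bounded_linear_scaleC: "bounded_linear (\<lambda>x::'a::complex_normed_vector. c *\<^sub>C x)"
  by (rule bounded_linear_intro[of _ "cmod c"])
    (simp_all add: scaleC_add_right scaleR_scaleC scaleC_scaleC norm_scaleC mult.commute)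

lemma scaleC_sum_left:
  "sum f A *\<^sub>C x = (\<Sum>i\<in>A. f i *\<^sub>C (x::'a::complex_normed_vector))"
  by (induction A rule: infinite_finite_induct) (simp_all add: scaleC_add_left)

instantiation complex :: complex_banach
begin
definition scaleC_complex :: "complex \<Rightarrow> complex \<Rightarrow> complex" where
  "scaleC_complex c z = c * z"
instance
  by standard (simp_all add: scaleC_complex_def algebra_simps norm_mult scaleR_conv_of_real)
end

definition bounded_clinear :: "('a::complex_normed_vector \<Rightarrow> 'b::complex_normed_vector) \<Rightarrow> bool" where
  "bounded_clinear T \<longleftrightarrow> bounded_linear T \<and> (\<forall>c x. T (c *\<^sub>C x) = c *\<^sub>C T x)"

text \<open>For compact \<open>G\<close> the library type \<open>'g \<Rightarrow>\<^sub>C 'x\<close> of bounded continuous functions with the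
  supremum norm is \<open>C(G, X)\<close>.\<close>

lemma scaleC_bcontfun:
  fixes f :: "'a::topological_space \<Rightarrow>\<^sub>C 'b::complex_normed_vector"
  shows "(\<lambda>x. c *\<^sub>C apply_bcontfun f x) \<in> bcontfun"
  using bounded_linear.continuous_on[OF bounded_linear_scaleC continuous_on_apply_bcontfun]
  by (rule bcontfun_normI[where b = "cmod c * norm f"])
    (auto simp: norm_scaleC intro!: mult_left_mono norm_bounded)

instantiation bcontfun :: (topological_space, complex_normed_vector) complex_normed_vector
begin
definition scaleC_bcontfun :: "complex \<Rightarrow> ('a \<Rightarrow>\<^sub>C 'b) \<Rightarrow> 'a \<Rightarrow>\<^sub>C 'b" where
  "scaleC_bcontfun c f = Bcontfun (\<lambda>x. c *\<^sub>C apply_bcontfun f x)"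

lemma apply_bcontfun_scaleC [simp]: "apply_bcontfun (c *\<^sub>C f) x = c *\<^sub>C apply_bcontfun f x"
  for f :: "'a \<Rightarrow>\<^sub>C 'b"
  by (simp add: scaleC_bcontfun_def Bcontfun_inverse scaleC_bcontfun)

instance
proof
  fix a b :: complex and r :: real and f g :: "'a \<Rightarrow>\<^sub>C 'b"
  show "a *\<^sub>C (f + g) = a *\<^sub>C f + a *\<^sub>C g" "(a + b) *\<^sub>C f = a *\<^sub>C f + b *\<^sub>C f"
    "a *\<^sub>C b *\<^sub>C f = (a * b) *\<^sub>C f" "r *\<^sub>R f = complex_of_real r *\<^sub>C f"
    by (auto intro!: bcontfun_eqI
        simp: scaleC_add_right scaleC_add_left scaleC_scaleC scaleR_scaleC)
  have le: "norm (c *\<^sub>C h) \<le> cmod c * norm h" for c and h :: "'a \<Rightarrow>\<^sub>C 'b"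
    by (rule norm_bound) (auto simp: norm_scaleC intro!: mult_left_mono norm_bounded)
  show "norm (a *\<^sub>C f) = cmod a * norm f"
  proof (cases "a = 0")
    case True
    then show ?thesis using le[of 0 f] by simp
  next
    case False
    have "f = inverse a *\<^sub>C (a *\<^sub>C f)"
      using False by (auto intro!: bcontfun_eqI simp: scaleC_scaleC)
    then have "norm f \<le> cmod (inverse a) * norm (a *\<^sub>C f)"
      using le[of "inverse a" "a *\<^sub>C f"] by simp
    then have "cmod a * norm f \<le> norm (a *\<^sub>C f)"
      using False by (simp add: norm_inverse norm_divide field_simps)
    then show ?thesis using le[of a f] by simp
  qed
qed
end

section \<open>The space of finite regular complex Borel measures\<close>

definition borel_families :: "'g::topological_space set \<Rightarrow> 'g set set set" where
  "borel_families E = {P. finite P \<and> disjoint P \<and> (\<forall>F\<in>P. F \<in> sets borel \<and> F \<subseteq> E)}"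

definition variation :: "('g::topological_space set \<Rightarrow> complex) \<Rightarrow> 'g set \<Rightarrow> real" where
  "variation \<mu> E = (SUP P\<in>borel_families E. \<Sum>F\<in>P. cmod (\<mu> F))"

text \<open>Set functions are normalized to vanish outside the Borel sets.  Boundedness of the variation
  is automatic for countably additive \<open>\<mu>\<close>; listing it makes the total variation norm below
  immediately meaningful.\<close>

definition regular_complex_measures :: "('g::topological_space set \<Rightarrow> complex) set" where
  "regular_complex_measures = {\<mu>.
     (\<forall>E. E \<notin> sets borel \<longrightarrow> \<mu> E = 0) \<and>
     (\<forall>A :: nat \<Rightarrow> 'g set. range A \<subseteq> sets borel \<longrightarrow> disjoint_family A \<longrightarrow>
        (\<lambda>i. \<mu> (A i)) sums \<mu> (\<Union>i. A i)) \<and>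
     bdd_above ((\<lambda>P. \<Sum>F\<in>P. cmod (\<mu> F)) ` borel_families UNIV) \<and>
     (\<forall>E\<in>sets borel. \<forall>e>0. \<exists>K U. compact K \<and> open U \<and> K \<subseteq> E \<and> E \<subseteq> U \<and>
        variation \<mu> (U - K) < e)}"

lemma borel_families_empty [simp]: "{} \<in> borel_families E"
  by (simp add: borel_families_def)

lemma borel_families_mono: "E \<subseteq> E' \<Longrightarrow> borel_families E \<subseteq> borel_families E'"
  by (auto simp: borel_families_def)

lemma variation_least:
  "(\<And>P. P \<in> borel_families E \<Longrightarrow> (\<Sum>F\<in>P. cmod (\<mu> F)) \<le> b) \<Longrightarrow> variation \<mu> E \<le> b"
  unfolding variation_def by (rule cSUP_least) (auto intro: borel_families_empty)

lemma variation_upper: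
  assumes "bdd_above ((\<lambda>P. \<Sum>F\<in>P. cmod (\<mu> F)) ` borel_families UNIV)" "P \<in> borel_families E"
  shows "(\<Sum>F\<in>P. cmod (\<mu> F)) \<le> variation \<mu> E"
  unfolding variation_def
  by (rule cSUP_upper[OF assms(2)])
    (rule bdd_above_mono[OF assms(1) image_mono[OF borel_families_mono]], simp)

lemma variation_mono:
  assumes "bdd_above ((\<lambda>P. \<Sum>F\<in>P. cmod (\<mu> F)) ` borel_families UNIV)" "E \<subseteq> E'"
  shows "variation \<mu> E \<le> variation \<mu> E'"
  by (rule variation_least, rule variation_upper[OF assms(1)])
    (use borel_families_mono[OF assms(2)] in auto)

lemma variation_nonneg:
  assumes "bdd_above ((\<lambda>P. \<Sum>F\<in>P. cmod (\<mu> F)) ` borel_families UNIV)"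
  shows "0 \<le> variation \<mu> E"
  using variation_upper[OF assms borel_families_empty, of E] by simp

lemma variation_add:
  assumes "bdd_above ((\<lambda>P. \<Sum>F\<in>P. cmod (\<mu> F)) ` borel_families UNIV)"
    and "bdd_above ((\<lambda>P. \<Sum>F\<in>P. cmod (\<nu> F)) ` borel_families UNIV)"
  shows "variation (\<lambda>E. \<mu> E + \<nu> E) E \<le> variation \<mu> E + variation \<nu> E"
proof (rule variation_least)
  fix P assume P: "P \<in> borel_families E"
  have "(\<Sum>F\<in>P. cmod (\<mu> F + \<nu> F)) \<le> (\<Sum>F\<in>P. cmod (\<mu> F)) + (\<Sum>F\<in>P. cmod (\<nu> F))"
    by (auto simp flip: sum.distrib intro!: sum_mono norm_triangle_ineq)
  also have "\<dots> \<le> variation \<mu> E + variation \<nu> E"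
    by (intro add_mono variation_upper assms P)
  finally show "(\<Sum>F\<in>P. cmod (\<mu> F + \<nu> F)) \<le> variation \<mu> E + variation \<nu> E" .
qed

lemma variation_mult:
  assumes "bdd_above ((\<lambda>P. \<Sum>F\<in>P. cmod (\<mu> F)) ` borel_families UNIV)"
  shows "variation (\<lambda>E. c * \<mu> E) E \<le> cmod c * variation \<mu> E"
proof (rule variation_least)
  fix P assume "P \<in> borel_families E"
  then have "cmod c * (\<Sum>F\<in>P. cmod (\<mu> F)) \<le> cmod c * variation \<mu> E"
    by (intro mult_left_mono variation_upper assms) auto
  then show "(\<Sum>F\<in>P. cmod (c * \<mu> F)) \<le> cmod c * variation \<mu> E"
    by (simp add: norm_mult sum_distrib_left)
qed

lemma regular_complex_measures_add:
  assumes "\<mu> \<in> regular_complex_measures" "\<nu> \<in> regular_complex_measures"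
  shows "(\<lambda>E. \<mu> E + \<nu> E) \<in> regular_complex_measures"
proof -
  let ?b = "\<lambda>\<mu>. bdd_above ((\<lambda>P. \<Sum>F\<in>P. cmod (\<mu> F)) ` borel_families UNIV)"
  have b: "?b \<mu>" "?b \<nu>"
    using assms by (auto simp: regular_complex_measures_def)
  have b': "?b (\<lambda>E. \<mu> E + \<nu> E)"
  proof (rule bdd_aboveI2)
    fix P :: "'a set set" assume P: "P \<in> borel_families UNIV"
    have "(\<Sum>F\<in>P. cmod (\<mu> F + \<nu> F)) \<le> (\<Sum>F\<in>P. cmod (\<mu> F)) + (\<Sum>F\<in>P. cmod (\<nu> F))"
      by (auto simp flip: sum.distrib intro!: sum_mono norm_triangle_ineq)
    also have "\<dots> \<le> variation \<mu> UNIV + variation \<nu> UNIV"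
      by (intro add_mono variation_upper b P)
    finally show "(\<Sum>F\<in>P. cmod (\<mu> F + \<nu> F)) \<le> variation \<mu> UNIV + variation \<nu> UNIV" .
  qed
  have "\<exists>K U. compact K \<and> open U \<and> K \<subseteq> E \<and> E \<subseteq> U \<and> variation (\<lambda>E. \<mu> E + \<nu> E) (U - K) < e"
    if E: "E \<in> sets borel" and e: "e > 0" for E e
  proof -
    have reg: "\<exists>K U. compact K \<and> open U \<and> K \<subseteq> E \<and> E \<subseteq> U \<and> variation \<kappa> (U - K) < e / 2"
      if "\<kappa> \<in> regular_complex_measures" for \<kappa>
      using that E e half_gt_zero[OF e] unfolding regular_complex_measures_def by blast
    obtain K U where 1: "compact K" "open U" "K \<subseteq> E" "E \<subseteq> U" "variation \<mu> (U - K) < e / 2"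
      using reg[OF assms(1)] by blast
    obtain K' U' where 2: "compact K'" "open U'" "K' \<subseteq> E" "E \<subseteq> U'" "variation \<nu> (U' - K') < e / 2"
      using reg[OF assms(2)] by blast
    let ?D = "(U \<inter> U') - (K \<union> K')"
    have "variation (\<lambda>E. \<mu> E + \<nu> E) ?D \<le> variation \<mu> ?D + variation \<nu> ?D"
      by (rule variation_add[OF b])
    also have "\<dots> \<le> variation \<mu> (U - K) + variation \<nu> (U' - K')"
      by (intro add_mono variation_mono b) auto
    also have "\<dots> < e" using 1 2 by simp
    finally show ?thesis
      using 1 2 by (intro exI[of _ "K \<union> K'"] exI[of _ "U \<inter> U'"]) auto
  qed
  then show ?thesis
    using assms b' unfolding regular_complex_measures_def by (auto intro: sums_add)
qed

lemma regular_complex_measures_mult: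
  assumes "\<mu> \<in> regular_complex_measures"
  shows "(\<lambda>E. c * \<mu> E) \<in> regular_complex_measures"
proof -
  let ?b = "\<lambda>\<mu>. bdd_above ((\<lambda>P. \<Sum>F\<in>P. cmod (\<mu> F)) ` borel_families UNIV)"
  have b: "?b \<mu>"
    using assms by (auto simp: regular_complex_measures_def)
  have b': "?b (\<lambda>E. c * \<mu> E)"
  proof (rule bdd_aboveI2)
    fix P :: "'a set set" assume "P \<in> borel_families UNIV"
    then have "cmod c * (\<Sum>F\<in>P. cmod (\<mu> F)) \<le> cmod c * variation \<mu> UNIV"
      by (intro mult_left_mono variation_upper b) auto
    then show "(\<Sum>F\<in>P. cmod (c * \<mu> F)) \<le> cmod c * variation \<mu> UNIV"
      by (simp add: norm_mult sum_distrib_left)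
  qed
  have "\<exists>K U. compact K \<and> open U \<and> K \<subseteq> E \<and> E \<subseteq> U \<and> variation (\<lambda>E. c * \<mu> E) (U - K) < e"
    if E: "E \<in> sets borel" and e: "e > 0" for E e
  proof -
    have d: "e / (cmod c + 1) > 0"
      using e norm_ge_zero[of c] by (intro divide_pos_pos) linarith+
    then obtain K U where 1: "compact K" "open U" "K \<subseteq> E" "E \<subseteq> U"
      "variation \<mu> (U - K) < e / (cmod c + 1)"
      using assms E unfolding regular_complex_measures_def by blast
    have "variation (\<lambda>E. c * \<mu> E) (U - K) \<le> cmod c * variation \<mu> (U - K)"
      by (rule variation_mult[OF b])
    also have "\<dots> \<le> (cmod c + 1) * variation \<mu> (U - K)"
      using variation_nonneg[OF b] by (intro mult_right_mono) auto
    also have "\<dots> < (cmod c + 1) * (e / (cmod c + 1))"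
      using 1(5) norm_ge_zero[of c] by (intro mult_strict_left_mono) linarith+
    also have "\<dots> = e"
      using norm_ge_zero[of c] by (simp add: field_simps add_nonneg_eq_0_iff)
    finally show ?thesis using 1 by blast
  qed
  then show ?thesis
    using assms b' unfolding regular_complex_measures_def by (auto intro: sums_mult)
qed

lemma variation_zero: "variation (\<lambda>E. 0) E = 0"
proof -
  have "borel_families E \<noteq> {}" using borel_families_empty by blast
  then show ?thesis by (simp add: variation_def)
qed

lemma regular_complex_measures_zero: "(\<lambda>E. 0) \<in> regular_complex_measures"
proof -
  have "variation (\<lambda>E. 0) E = 0" for E :: "'a set"
    by (rule variation_zero)
  then have "\<exists>K U. compact K \<and> open U \<and> K \<subseteq> E \<and> E \<subseteq> U \<and> variation (\<lambda>E. 0) (U - K) < e"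
    if "e > 0" for E :: "'a set" and e
    using that by (intro exI[of _ "{}"] exI[of _ UNIV]) simp
  then show ?thesis
    by (auto simp: regular_complex_measures_def bdd_above_def)
qed

typedef (overloaded) 'g cmeasure = "regular_complex_measures :: ('g::topological_space set \<Rightarrow> complex) set"
  morphisms cmeas Abs_cmeasure
  using regular_complex_measures_zero by blast

lemma bdd_above_cmeas: "bdd_above ((\<lambda>P. \<Sum>F\<in>P. cmod (cmeas \<mu> F)) ` borel_families UNIV)"
  using cmeas[of \<mu>] by (simp add: regular_complex_measures_def)

lemma cmeasure_eqI: "(\<And>E. E \<in> sets borel \<Longrightarrow> cmeas \<mu> E = cmeas \<nu> E) \<Longrightarrow> \<mu> = \<nu>"
  using cmeas[of \<mu>] cmeas[of \<nu>] unfolding regular_complex_measures_def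
  by (intro cmeas_inject[THEN iffD1] ext) (metis (mono_tags, lifting) mem_Collect_eq)

instantiation cmeasure :: (topological_space) complex_normed_vector
begin

definition zero_cmeasure :: "'a cmeasure" where
  "zero_cmeasure = Abs_cmeasure (\<lambda>E. 0)"
definition plus_cmeasure :: "'a cmeasure \<Rightarrow> 'a cmeasure \<Rightarrow> 'a cmeasure" where
  "plus_cmeasure \<mu> \<nu> = Abs_cmeasure (\<lambda>E. cmeas \<mu> E + cmeas \<nu> E)"
definition scaleC_cmeasure :: "complex \<Rightarrow> 'a cmeasure \<Rightarrow> 'a cmeasure" where
  "scaleC_cmeasure c \<mu> = Abs_cmeasure (\<lambda>E. c * cmeas \<mu> E)"
definition scaleR_cmeasure :: "real \<Rightarrow> 'a cmeasure \<Rightarrow> 'a cmeasure" where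
  "scaleR_cmeasure r \<mu> = complex_of_real r *\<^sub>C \<mu>"
definition uminus_cmeasure :: "'a cmeasure \<Rightarrow> 'a cmeasure" where
  "uminus_cmeasure \<mu> = (- 1) *\<^sub>C \<mu>"
definition minus_cmeasure :: "'a cmeasure \<Rightarrow> 'a cmeasure \<Rightarrow> 'a cmeasure" where
  "minus_cmeasure \<mu> \<nu> = \<mu> + (- 1) *\<^sub>C \<nu>"
definition norm_cmeasure :: "'a cmeasure \<Rightarrow> real" where
  "norm_cmeasure \<mu> = variation (cmeas \<mu>) UNIV"
definition dist_cmeasure :: "'a cmeasure \<Rightarrow> 'a cmeasure \<Rightarrow> real" where
  "dist_cmeasure \<mu> \<nu> = norm (\<mu> - \<nu>)"
definition sgn_cmeasure :: "'a cmeasure \<Rightarrow> 'a cmeasure" where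
  "sgn_cmeasure \<mu> = inverse (norm \<mu>) *\<^sub>R \<mu>"
definition uniformity_cmeasure :: "('a cmeasure \<times> 'a cmeasure) filter" where
  "uniformity_cmeasure = (INF e\<in>{0<..}. principal {(\<mu>, \<nu>). dist \<mu> \<nu> < e})"
definition open_cmeasure :: "'a cmeasure set \<Rightarrow> bool" where
  "open_cmeasure S = (\<forall>\<mu>\<in>S. \<forall>\<^sub>F (\<mu>', \<nu>) in uniformity. \<mu>' = \<mu> \<longrightarrow> \<nu> \<in> S)"

lemma cmeas_zero [simp]: "cmeas (0::'a cmeasure) E = 0"
  by (simp add: zero_cmeasure_def Abs_cmeasure_inverse regular_complex_measures_zero)

lemma cmeas_add [simp]: "cmeas (\<mu> + \<nu>) E = cmeas \<mu> E + cmeas \<nu> E" for \<mu> \<nu> :: "'a cmeasure"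
  by (simp add: plus_cmeasure_def Abs_cmeasure_inverse regular_complex_measures_add cmeas)

lemma cmeas_scaleC [simp]: "cmeas (c *\<^sub>C \<mu>) E = c * cmeas \<mu> E" for \<mu> :: "'a cmeasure"
  by (simp add: scaleC_cmeasure_def Abs_cmeasure_inverse regular_complex_measures_mult cmeas)

lemma cmeas_scaleR [simp]: "cmeas (r *\<^sub>R \<mu>) E = complex_of_real r * cmeas \<mu> E" for \<mu> :: "'a cmeasure"
  by (simp add: scaleR_cmeasure_def)

lemma cmeas_uminus [simp]: "cmeas (- \<mu>) E = - cmeas \<mu> E" for \<mu> :: "'a cmeasure"
  by (simp add: uminus_cmeasure_def)

lemma cmeas_diff [simp]: "cmeas (\<mu> - \<nu>) E = cmeas \<mu> E - cmeas \<nu> E" for \<mu> \<nu> :: "'a cmeasure"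
  by (simp add: minus_cmeasure_def)

instance
proof
  fix \<mu> \<nu> \<kappa> :: "'a cmeasure" and a b :: complex and r q :: real
  show "\<mu> + \<nu> + \<kappa> = \<mu> + (\<nu> + \<kappa>)" "\<mu> + \<nu> = \<nu> + \<mu>" "0 + \<mu> = \<mu>" "- \<mu> + \<mu> = 0" "\<mu> - \<nu> = \<mu> + - \<nu>"
    "r *\<^sub>R (\<mu> + \<nu>) = r *\<^sub>R \<mu> + r *\<^sub>R \<nu>" "(r + q) *\<^sub>R \<mu> = r *\<^sub>R \<mu> + q *\<^sub>R \<mu>"
    "r *\<^sub>R q *\<^sub>R \<mu> = (r * q) *\<^sub>R \<mu>" "1 *\<^sub>R \<mu> = \<mu>"
    "a *\<^sub>C (\<mu> + \<nu>) = a *\<^sub>C \<mu> + a *\<^sub>C \<nu>" "(a + b) *\<^sub>C \<mu> = a *\<^sub>C \<mu> + b *\<^sub>C \<mu>"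
    "a *\<^sub>C b *\<^sub>C \<mu> = (a * b) *\<^sub>C \<mu>" "r *\<^sub>R \<mu> = complex_of_real r *\<^sub>C \<mu>"
    by (auto intro!: cmeasure_eqI simp: algebra_simps)
  show "dist \<mu> \<nu> = norm (\<mu> - \<nu>)" by (rule dist_cmeasure_def)
  show "sgn \<mu> = inverse (norm \<mu>) *\<^sub>R \<mu>" by (rule sgn_cmeasure_def)
  show "(uniformity :: ('a cmeasure \<times> 'a cmeasure) filter) =
      (INF e\<in>{0<..}. principal {(\<mu>, \<nu>). dist \<mu> \<nu> < e})"
    by (rule uniformity_cmeasure_def)
  show "open S = (\<forall>\<mu>\<in>S. \<forall>\<^sub>F (\<mu>', \<nu>) in uniformity. \<mu>' = \<mu> \<longrightarrow> \<nu> \<in> S)" for S :: "'a cmeasure set"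
    by (rule open_cmeasure_def)
  have cmeas_le: "cmod (cmeas \<mu> E) \<le> norm \<mu>" if "E \<in> sets borel" for E
    using variation_upper[OF bdd_above_cmeas, of "{E}" UNIV \<mu>] that
    by (simp add: norm_cmeasure_def borel_families_def)
  have norm0: "norm (0::'a cmeasure) = 0"
    unfolding norm_cmeasure_def cmeas_zero[abs_def] by (rule variation_zero)
  show "norm \<mu> = 0 \<longleftrightarrow> \<mu> = 0"
    using cmeas_le norm0 by (auto intro!: cmeasure_eqI)
  show "norm (\<mu> + \<nu>) \<le> norm \<mu> + norm \<nu>"
    using variation_add[OF bdd_above_cmeas bdd_above_cmeas, of \<mu> \<nu> UNIV]
    unfolding norm_cmeasure_def cmeas_add[abs_def] .
  have le: "norm (c *\<^sub>C \<kappa>) \<le> cmod c * norm \<kappa>" for c and \<kappa> :: "'a cmeasure"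
    using variation_mult[OF bdd_above_cmeas, of c \<kappa> UNIV]
    unfolding norm_cmeasure_def cmeas_scaleC[abs_def] .
  show norm_eq: "norm (a *\<^sub>C \<mu>) = cmod a * norm \<mu>" for a
  proof (cases "a = 0")
    case True
    then have "a *\<^sub>C \<mu> = 0" by (auto intro!: cmeasure_eqI)
    then show ?thesis using True norm0 by simp
  next
    case False
    have "\<mu> = inverse a *\<^sub>C (a *\<^sub>C \<mu>)"
      using False by (auto intro!: cmeasure_eqI)
    then have "norm \<mu> \<le> cmod (inverse a) * norm (a *\<^sub>C \<mu>)"
      using le[of "inverse a" "a *\<^sub>C \<mu>"] by simp
    then have "cmod a * norm \<mu> \<le> norm (a *\<^sub>C \<mu>)"
      using False by (simp add: norm_inverse norm_divide field_simps)
    then show ?thesis using le[of a \<mu>] by simp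
  qed
  show "norm (r *\<^sub>R \<mu>) = \<bar>r\<bar> * norm \<mu>"
    by (simp add: scaleR_cmeasure_def norm_eq)
qed

end

section \<open>Integration of vector-valued functions\<close>

text \<open>The library's Bochner integral is restricted to second countable target spaces, whereas \<open>X\<close>
  may be non-separable, and it has no version for complex measures.  The functions to be integrated
  here are continuous on a compact space, hence uniform limits of simple functions, and the integral
  is the limit of the integrals of such simple functions.\<close>

definition simple_cintegral ::
  "('g::topological_space set \<Rightarrow> complex) \<Rightarrow> ('g \<Rightarrow> 'x::complex_normed_vector) \<Rightarrow> 'x" where
  "simple_cintegral \<mu> S = (\<Sum>y\<in>range S. \<mu> (S -` {y}) *\<^sub>C y)"

definition has_cintegral ::
  "('g::topological_space set \<Rightarrow> complex) \<Rightarrow> ('g \<Rightarrow> 'x::complex_normed_vector) \<Rightarrow> 'x \<Rightarrow> bool" where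
  "has_cintegral \<mu> f x \<longleftrightarrow>
     (\<exists>S. (\<forall>n. simple_function borel (S n)) \<and> uniform_limit UNIV S f sequentially \<and>
          (\<lambda>n. simple_cintegral \<mu> (S n)) \<longlonglongrightarrow> x)"

definition cintegral ::
  "('g::topological_space set \<Rightarrow> complex) \<Rightarrow> ('g \<Rightarrow> 'x::complex_normed_vector) \<Rightarrow> 'x" where
  "cintegral \<mu> f = (THE x. has_cintegral \<mu> f x)"

lemma regular_complex_measures_empty: "\<mu> {} = 0" if "\<mu> \<in> regular_complex_measures"
proof -
  have "(\<lambda>i. \<mu> (A i)) sums \<mu> (\<Union>i. A i)"
    if "range A \<subseteq> sets borel" "disjoint_family A" for A :: "nat \<Rightarrow> 'a set"
    using \<open>\<mu> \<in> regular_complex_measures\<close> that by (simp add: regular_complex_measures_def)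
  from this[of "\<lambda>_. {}"] have "(\<lambda>i::nat. \<mu> ({} :: 'a set)) sums \<mu> (\<Union>i::nat. {})"
    by (simp add: disjoint_family_on_def)
  then have "(\<lambda>i::nat. \<mu> ({} :: 'a set)) \<longlonglongrightarrow> 0"
    by (intro summable_LIMSEQ_zero sums_summable)
  then show ?thesis by (simp add: LIMSEQ_const_iff)
qed

lemma regular_complex_measures_Un:
  assumes "\<mu> \<in> regular_complex_measures" "A \<in> sets borel" "B \<in> sets borel" "A \<inter> B = {}"
  shows "\<mu> (A \<union> B) = \<mu> A + \<mu> B"
proof -
  have "disjoint_family (binaryset A B)" "range (binaryset A B) \<subseteq> sets borel"
    using assms by (auto simp: disjoint_family_on_def binaryset_def)
  then have "(\<lambda>i. \<mu> (binaryset A B i)) sums \<mu> (\<Union>i. binaryset A B i)"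
    using assms(1) by (simp add: regular_complex_measures_def)
  moreover have "(\<lambda>i. \<mu> (binaryset A B i)) sums (\<mu> A + \<mu> B)"
    by (rule binaryset_sums) (rule regular_complex_measures_empty[OF assms(1)])
  ultimately show ?thesis by (simp add: sums_unique2 UN_binaryset_eq)
qed

lemma regular_complex_measures_UN:
  assumes \<mu>: "\<mu> \<in> regular_complex_measures" and "finite I"
    and "\<And>i. i \<in> I \<Longrightarrow> A i \<in> sets borel" and "disjoint_family_on A I"
  shows "\<mu> (\<Union>i\<in>I. A i) = (\<Sum>i\<in>I. \<mu> (A i))"
  using assms(2-)
proof (induction I)
  case empty
  then show ?case by (simp add: regular_complex_measures_empty[OF \<mu>])
next
  case (insert i I)
  have "\<mu> (A i \<union> (\<Union>i\<in>I. A i)) = \<mu> (A i) + \<mu> (\<Union>i\<in>I. A i)"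
    using insert by (intro regular_complex_measures_Un[OF \<mu>]) (auto simp: disjoint_family_on_def)
  moreover have "\<mu> (\<Union>i\<in>I. A i) = (\<Sum>i\<in>I. \<mu> (A i))"
    using insert by (intro insert.IH) (auto simp: disjoint_family_on_def)
  ultimately show ?case using insert by simp
qed

lemma simple_function_borel_vimage:
  assumes "simple_function borel S"
  shows "S -` X \<in> sets borel"
proof -
  have "S -` X = (\<Union>y\<in>X \<inter> range S. S -` {y})" by auto
  then show ?thesis
    using assms by (auto simp: simple_function_def intro!: sets.finite_UN)
qed

lemma simple_cintegral_diff_le:
  assumes \<mu>: "\<mu> \<in> regular_complex_measures"
    and S: "simple_function borel S" and R: "simple_function borel R"
    and le: "\<And>u. norm (S u - R u) \<le> e"
  shows "norm (simple_cintegral \<mu> S - simple_cintegral \<mu> R) \<le> e * variation \<mu> UNIV"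
proof -
  define P where "P = (\<lambda>u. (S u, R u))"
  have sub: "range P \<subseteq> range S \<times> range R" by (auto simp: P_def)
  have fin: "finite (range P)"
    by (rule finite_subset[OF sub]) (use S R in \<open>auto simp: simple_function_def\<close>)
  have meas: "P -` {p} \<in> sets borel" for p
  proof -
    have "P -` {p} = S -` {fst p} \<inter> R -` {snd p}" by (auto simp: P_def)
    then show ?thesis by (simp add: simple_function_borel_vimage S R sets.Int)
  qed
  have disj: "disjoint_family_on (\<lambda>p. P -` {p}) X" for X
    unfolding disjoint_family_on_def by blast
  have gen: "simple_cintegral \<mu> F = (\<Sum>p\<in>range P. \<mu> (P -` {p}) *\<^sub>C h p)"
    if F: "\<And>u. F u = h (P u)" for F h
  proof -
    have rng: "range F = h ` range P" by (auto simp: F)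
    have "\<mu> (F -` {y}) = (\<Sum>p\<in>{p\<in>range P. h p = y}. \<mu> (P -` {p}))" for y
    proof -
      have "F -` {y} = (\<Union>p\<in>{p\<in>range P. h p = y}. P -` {p})" by (auto simp: F)
      then show ?thesis
        using fin meas disj by (simp only:) (rule regular_complex_measures_UN[OF \<mu>], auto)
    qed
    then have "simple_cintegral \<mu> F =
        (\<Sum>y\<in>h ` range P. \<Sum>p\<in>{p\<in>range P. h p = y}. \<mu> (P -` {p}) *\<^sub>C h p)"
      unfolding simple_cintegral_def rng by (simp add: scaleC_sum_left)
    also have "\<dots> = (\<Sum>p\<in>range P. \<mu> (P -` {p}) *\<^sub>C h p)"
      by (rule sum.image_gen[OF fin, symmetric])
    finally show ?thesis .
  qed
  have "simple_cintegral \<mu> S - simple_cintegral \<mu> R =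
      (\<Sum>p\<in>range P. \<mu> (P -` {p}) *\<^sub>C (fst p - snd p))"
    using gen[of S fst] gen[of R snd]
    by (simp add: P_def scaleC_diff_right sum_subtractf)
  also have "norm \<dots> \<le> (\<Sum>p\<in>range P. cmod (\<mu> (P -` {p})) * e)"
    by (rule sum_norm_le) (auto simp: norm_scaleC P_def intro!: mult_left_mono le)
  also have "\<dots> = e * (\<Sum>F\<in>(\<lambda>p. P -` {p}) ` range P. cmod (\<mu> F))"
  proof -
    have "inj_on (\<lambda>p. P -` {p}) (range P)" by (auto simp: inj_on_def)
    then show ?thesis by (simp add: sum.reindex sum_distrib_left mult.commute)
  qed
  also have "\<dots> \<le> e * variation \<mu> UNIV"
  proof (intro mult_left_mono variation_upper)
    show "(\<lambda>p. P -` {p}) ` range P \<in> borel_families UNIV"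
      using fin meas by (auto simp: borel_families_def disjoint_def)
    show "0 \<le> e" using le[of undefined] norm_ge_zero order_trans by blast
  qed (use \<mu> in \<open>simp add: regular_complex_measures_def\<close>)
  finally show ?thesis .
qed

lemma has_cintegral_unique:
  assumes \<mu>: "\<mu> \<in> regular_complex_measures"
    and "has_cintegral \<mu> f x" "has_cintegral \<mu> f y"
  shows "x = y"
proof -
  obtain S R where
    S: "\<And>n. simple_function borel (S n)" "uniform_limit UNIV S f sequentially"
      "(\<lambda>n. simple_cintegral \<mu> (S n)) \<longlonglongrightarrow> x" and
    R: "\<And>n. simple_function borel (R n)" "uniform_limit UNIV R f sequentially"
      "(\<lambda>n. simple_cintegral \<mu> (R n)) \<longlonglongrightarrow> y"
    using assms(2,3) unfolding has_cintegral_def by blast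
  let ?V = "variation \<mu> UNIV + 1"
  have V: "?V > 0"
    using variation_nonneg[of \<mu> UNIV] \<mu> by (simp add: regular_complex_measures_def)
  have lim: "(\<lambda>n. simple_cintegral \<mu> (S n) - simple_cintegral \<mu> (R n)) \<longlonglongrightarrow> 0"
  proof (rule tendstoI)
    fix e :: real assume e: "e > 0"
    define d where "d = e / (2 * ?V)"
    have d: "d > 0" using e V by (simp add: d_def)
    have "2 * (e / (2 * v)) * v = e" if "v > 0" for v :: real
      using that by simp
    from this[OF V] have dV: "2 * d * ?V = e" by (simp only: d_def)
    have "\<forall>\<^sub>F n in sequentially. \<forall>u\<in>UNIV. dist (S n u) (f u) < d"
      "\<forall>\<^sub>F n in sequentially. \<forall>u\<in>UNIV. dist (R n u) (f u) < d"
      using uniform_limitD[OF S(2) d] uniform_limitD[OF R(2) d] by auto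
    then show "\<forall>\<^sub>F n in sequentially.
        dist (simple_cintegral \<mu> (S n) - simple_cintegral \<mu> (R n)) 0 < e"
    proof eventually_elim
      case (elim n)
      have "norm (S n u - R n u) \<le> 2 * d" for u
        using elim[rule_format, of u] dist_triangle2[of "S n u" "R n u" "f u"]
        unfolding dist_norm[of "S n u" "R n u", symmetric] by simp
      then have "norm (simple_cintegral \<mu> (S n) - simple_cintegral \<mu> (R n))
          \<le> 2 * d * variation \<mu> UNIV"
        by (rule simple_cintegral_diff_le[OF \<mu> S(1) R(1)])
      also have "\<dots> < 2 * d * ?V" using d by simp
      also have "\<dots> = e" by (rule dV)
      finally show ?case by simp
    qed
  qed
  have "(\<lambda>n. simple_cintegral \<mu> (S n) - simple_cintegral \<mu> (R n)) \<longlonglongrightarrow> x - y"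
    by (intro tendsto_diff S R)
  then have "x - y = 0" by (rule LIMSEQ_unique[OF _ lim])
  then show ?thesis by simp
qed

lemma simple_function_approx:
  fixes f :: "'g::topological_space \<Rightarrow> 'x::real_normed_vector"
  assumes G: "compact (UNIV :: 'g set)" and f: "continuous_on UNIV f" and e: "e > 0"
  shows "\<exists>S. simple_function borel S \<and> (\<forall>u. dist (S u) (f u) < e)"
proof -
  have "compact (range f)" using compact_continuous_image[OF f G] .
  then obtain C where "finite C" and C: "range f \<subseteq> (\<Union>c\<in>C. ball c e)"
    using e unfolding compact_eq_totally_bounded by blast
  obtain cs where cs: "set cs = C" using finite_list[OF \<open>finite C\<close>] ..
  define idx where "idx u = (LEAST k. k < length cs \<and> f u \<in> ball (cs ! k) e)" for u
  have idx: "idx u < length cs \<and> f u \<in> ball (cs ! idx u) e" for u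
  proof -
    have "\<exists>k. k < length cs \<and> f u \<in> ball (cs ! k) e"
    proof -
      obtain c where "c \<in> C" "f u \<in> ball c e" using C by blast
      then show ?thesis using cs by (metis in_set_conv_nth)
    qed
    then show ?thesis unfolding idx_def by (rule LeastI_ex)
  qed
  have open_pre: "open {u. f u \<in> ball c e}" for c
    using open_vimage[OF open_ball f, of c e] by (simp add: vimage_def)
  have meas: "{u. idx u = k} \<in> sets borel" for k
  proof (cases "k < length cs")
    case True
    have "{u. idx u = k} = {u. f u \<in> ball (cs ! k) e} - (\<Union>j<k. {u. f u \<in> ball (cs ! j) e})"
    proof safe
      fix u j assume "j < idx u" "f u \<in> ball (cs ! j) e" "k = idx u"
      then show False
        using not_less_Least[of j "\<lambda>k. k < length cs \<and> f u \<in> ball (cs ! k) e"] True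
        unfolding idx_def[of u, symmetric] by (meson less_trans)
    next
      fix u assume u: "f u \<in> ball (cs ! k) e" "u \<notin> (\<Union>j<k. {u. f u \<in> ball (cs ! j) e})"
      show "idx u = k"
        unfolding idx_def[of u]
      proof (rule Least_equality)
        show "k < length cs \<and> f u \<in> ball (cs ! k) e" using u(1) True by blast
        show "k \<le> j" if "j < length cs \<and> f u \<in> ball (cs ! j) e" for j
          using u(2) that by (meson UN_I lessThan_iff mem_Collect_eq not_le)
      qed
    qed (use idx in auto)
    then show ?thesis
      using open_pre by (auto intro!: sets.Diff sets.finite_UN borel_open)
  next
    case False
    then have "{u. idx u = k} = {}" using idx by auto
    then show ?thesis by simp
  qed
  define S where "S u = cs ! idx u" for u
  have "range S \<subseteq> C" using idx cs by (auto simp: S_def)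
  then have "finite (range S)" using \<open>finite C\<close> finite_subset by blast
  moreover have "S -` {y} \<in> sets borel" for y
  proof -
    have "S -` {y} = (\<Union>k\<in>{k. k < length cs \<and> cs ! k = y}. {u. idx u = k})"
      using idx by (auto simp: S_def)
    then show ?thesis using meas by (auto intro!: sets.finite_UN)
  qed
  ultimately have "simple_function borel S" by (simp add: simple_function_def)
  moreover have "dist (S u) (f u) < e" for u using idx[of u] by (simp add: S_def)
  ultimately show ?thesis by blast
qed

lemma has_cintegral_cintegral:
  fixes f :: "'g::topological_space \<Rightarrow> 'x::complex_banach"
  assumes G: "compact (UNIV :: 'g set)" and f: "continuous_on UNIV f"
    and \<mu>: "\<mu> \<in> regular_complex_measures"
  shows "has_cintegral \<mu> f (cintegral \<mu> f)"
proof -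
  let ?d = "\<lambda>n. inverse (real (Suc n))"
  have "\<exists>S. simple_function borel S \<and> (\<forall>u. dist (S u) (f u) < ?d n)" for n
    by (rule simple_function_approx[OF G f]) simp
  then obtain S where S: "\<And>n. simple_function borel (S n)"
    and lt: "\<And>n u. dist (S n u) (f u) < ?d n"
    by metis
  have lim_d: "?d \<longlonglongrightarrow> 0" by (rule LIMSEQ_inverse_real_of_nat)
  have ul: "uniform_limit UNIV S f sequentially"
  proof (rule uniform_limitI)
    fix e :: real assume "e > 0"
    then have "\<forall>\<^sub>F n in sequentially. ?d n < e" by (rule order_tendstoD(2)[OF lim_d])
    then show "\<forall>\<^sub>F n in sequentially. \<forall>u\<in>UNIV. dist (S n u) (f u) < e"
      by eventually_elim (use lt less_trans in blast)
  qed
  let ?V = "variation \<mu> UNIV + 1"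
  have V: "?V > 0"
    using variation_nonneg[of \<mu> UNIV] \<mu> by (simp add: regular_complex_measures_def)
  have "Cauchy (\<lambda>n. simple_cintegral \<mu> (S n))"
  proof (rule metric_CauchyI)
    fix e :: real assume e: "e > 0"
    define d where "d = e / (2 * ?V)"
    have d: "d > 0" using e V by (simp add: d_def)
    have "2 * (e / (2 * v)) * v = e" if "v > 0" for v :: real
      using that by simp
    from this[OF V] have dV: "2 * d * ?V = e" by (simp only: d_def)
    obtain M where M: "\<And>n. n \<ge> M \<Longrightarrow> ?d n < d"
      using order_tendstoD(2)[OF lim_d d] unfolding eventually_sequentially by blast
    have "dist (simple_cintegral \<mu> (S m)) (simple_cintegral \<mu> (S n)) < e"
      if mn: "m \<ge> M" "n \<ge> M" for m n
    proof -
      have "norm (S m u - S n u) \<le> 2 * d" for u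
        using M[OF mn(1)] M[OF mn(2)] lt[of m u] lt[of n u] dist_triangle2[of "S m u" "S n u" "f u"]
        by (simp add: dist_norm)
      then have "norm (simple_cintegral \<mu> (S m) - simple_cintegral \<mu> (S n))
          \<le> 2 * d * variation \<mu> UNIV"
        by (rule simple_cintegral_diff_le[OF \<mu> S S])
      also have "\<dots> < 2 * d * ?V" using d by simp
      also have "\<dots> = e" by (rule dV)
      finally show ?thesis by (simp add: dist_norm)
    qed
    then show "\<exists>M. \<forall>m\<ge>M. \<forall>n\<ge>M.
        dist (simple_cintegral \<mu> (S m)) (simple_cintegral \<mu> (S n)) < e" by blast
  qed
  then obtain x where "(\<lambda>n. simple_cintegral \<mu> (S n)) \<longlonglongrightarrow> x"
    using Cauchy_convergent convergent_def by blast
  then have x: "has_cintegral \<mu> f x"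
    using S ul unfolding has_cintegral_def by blast
  then show ?thesis
    unfolding cintegral_def by (rule theI) (rule has_cintegral_unique[OF \<mu> _ x])
qed

section \<open>Convolution operators and Fourier coefficients\<close>

definition convolution ::
  "('g::topological_ab_group_add \<Rightarrow>\<^sub>C 'x::complex_banach) \<Rightarrow> 'g cmeasure \<Rightarrow> 'g \<Rightarrow> 'x" where
  "convolution f \<mu> t = cintegral (cmeas \<mu>) (\<lambda>u. f (t - u))"

definition dual_group :: "('g::topological_ab_group_add \<Rightarrow> complex) set" where
  "dual_group = {\<gamma>. continuous_on UNIV \<gamma> \<and> (\<forall>t. cmod (\<gamma> t) = 1) \<and> (\<forall>t u. \<gamma> (t + u) = \<gamma> t * \<gamma> u)}"

definition normalized_haar :: "'g::topological_ab_group_add measure \<Rightarrow> bool" where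
  "normalized_haar m \<longleftrightarrow> sets m = sets borel \<and> emeasure m UNIV = 1 \<and>
     (\<forall>a. \<forall>E\<in>sets borel. emeasure m ((+) a ` E) = emeasure m E) \<and>
     (\<forall>E\<in>sets borel. emeasure m E = (INF U\<in>{U. open U \<and> E \<subseteq> U}. emeasure m U) \<and>
        emeasure m E = (SUP K\<in>{K. compact K \<and> K \<subseteq> E}. emeasure m K))"

lemma normalized_haar_regular_complex_measure:
  fixes m :: "'g::{topological_ab_group_add, t2_space} measure"
  assumes "normalized_haar m"
  shows "(\<lambda>E. complex_of_real (measure m E)) \<in> regular_complex_measures"
proof -
  let ?c = "\<lambda>E. complex_of_real (measure m E)"
  have sets [simp]: "sets m = sets borel" and one: "emeasure m UNIV = 1"
    and outer: "\<And>E. E \<in> sets borel \<Longrightarrow> emeasure m E = (INF U\<in>{U. open U \<and> E \<subseteq> U}. emeasure m U)"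
    and inner: "\<And>E. E \<in> sets borel \<Longrightarrow> emeasure m E = (SUP K\<in>{K. compact K \<and> K \<subseteq> E}. emeasure m K)"
    using assms unfolding normalized_haar_def by blast+
  have space: "space m = UNIV" using sets_eq_imp_space_eq[OF sets] by simp
  interpret finite_measure m by standard (simp add: space one)
  have Sum: "(\<Sum>F\<in>P. cmod (?c F)) \<le> measure m E"
    if P: "P \<in> borel_families E" and E: "E \<in> sets borel" for P E
  proof -
    have "(\<Sum>F\<in>P. cmod (?c F)) = measure m (\<Union>F\<in>P. F)"
      using P by (subst finite_measure_finite_Union[where A = "\<lambda>F. F"])
        (auto simp: borel_families_def disjoint_family_on_def disjoint_def)
    also have "\<dots> \<le> measure m E"
      using P E by (intro finite_measure_mono) (auto simp: borel_families_def)
    finally show ?thesis .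
  qed
  have "\<exists>K U. compact K \<and> open U \<and> K \<subseteq> E \<and> E \<subseteq> U \<and> variation ?c (U - K) < e"
    if E: "E \<in> sets borel" and e: "e > 0" for E e
  proof -
    have "emeasure m E < emeasure m E + ennreal (e / 2)"
      using e by (simp add: emeasure_eq_measure ennreal_less_iff flip: ennreal_plus)
    then have "(INF U\<in>{U. open U \<and> E \<subseteq> U}. emeasure m U) < emeasure m E + ennreal (e / 2)"
      unfolding outer[OF E, symmetric] .
    then obtain U where U: "open U" "E \<subseteq> U" "emeasure m U < emeasure m E + ennreal (e / 2)"
      by (auto simp: INF_less_iff)
    have "\<exists>K. compact K \<and> K \<subseteq> E \<and> measure m E - e / 2 < measure m K"
    proof (cases "measure m E - e / 2 < 0")
      case True
      then show ?thesis by (intro exI[of _ "{}"]) auto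
    next
      case False
      then have "ennreal (measure m E - e / 2) < emeasure m E"
        using e by (simp add: emeasure_eq_measure ennreal_less_iff)
      then have "ennreal (measure m E - e / 2) <
          (SUP K\<in>{K. compact K \<and> K \<subseteq> E}. emeasure m K)"
        unfolding inner[OF E, symmetric] .
      then obtain K where "compact K" "K \<subseteq> E" "ennreal (measure m E - e / 2) < emeasure m K"
        by (auto simp: less_SUP_iff)
      then show ?thesis
        using False by (auto simp: emeasure_eq_measure ennreal_less_iff)
    qed
    then obtain K where K: "compact K" "K \<subseteq> E" "measure m E - e / 2 < measure m K" by blast
    have "measure m U < measure m E + e / 2"
      using U(3) e by (simp add: emeasure_eq_measure ennreal_less_iff flip: ennreal_plus)
    moreover have KU: "K \<in> sets borel" "U \<in> sets borel"
      using K(1) U(1) by (auto intro: borel_compact)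
    moreover have "measure m (U - K) = measure m U - measure m K"
      using KU K U by (intro finite_measure_Diff) auto
    ultimately have "measure m (U - K) < e" using K(3) by linarith
    moreover have "variation ?c (U - K) \<le> measure m (U - K)"
      using KU by (intro variation_least Sum) auto
    ultimately show ?thesis using K U by fastforce
  qed
  moreover have "bdd_above ((\<lambda>P. \<Sum>F\<in>P. cmod (?c F)) ` borel_families UNIV)"
    by (rule bdd_aboveI2[where M = "measure m UNIV"]) (rule Sum, auto)
  moreover have "(\<lambda>i. ?c (A i)) sums ?c (\<Union>i. A i)"
    if "range A \<subseteq> sets borel" "disjoint_family A" for A :: "nat \<Rightarrow> 'g set"
    using finite_measure_UNION[of A] that by (simp add: sums_of_real_iff)
  ultimately show ?thesis
    by (auto simp: regular_complex_measures_def measure_notin_sets)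
qed

definition fourier_coeff ::
  "'g::topological_ab_group_add measure \<Rightarrow> ('g \<Rightarrow>\<^sub>C 'x::complex_banach) \<Rightarrow> ('g \<Rightarrow> complex) \<Rightarrow> 'x" where
  "fourier_coeff m f \<gamma> =
     cintegral (\<lambda>E. complex_of_real (measure m E)) (\<lambda>t. cnj (\<gamma> t) *\<^sub>C apply_bcontfun f t)"

section \<open>Schatten classes\<close>

definition cadjoint :: "('h::complex_hilbert \<Rightarrow> 'h) \<Rightarrow> 'h \<Rightarrow> 'h" where
  "cadjoint U = (THE V. \<forall>x y. cinner (U x) y = cinner x (V y))"

definition compact_operator :: "('a::complex_normed_vector \<Rightarrow> 'b::complex_normed_vector) \<Rightarrow> bool" where
  "compact_operator U \<longleftrightarrow> bounded_clinear U \<and> compact (closure (U ` cball 0 1))"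

text \<open>\<open>\<sigma>\<close> is the sequence of singular numbers of the compact operator \<open>U\<close>: the eigenvalues of
  \<open>(U\<^sup>*U)\<^sup>1\<^sup>/\<^sup>2\<close> in decreasing order, each positive one repeated according to its (finite)
  multiplicity, and padded with zeros if there are only finitely many positive ones.  The
  eigenspace of \<open>(U\<^sup>*U)\<^sup>1\<^sup>/\<^sup>2\<close> for \<open>t > 0\<close> is that of \<open>U\<^sup>*U\<close> for \<open>t\<^sup>2\<close>.\<close>

definition singular_numbers :: "('h::complex_hilbert \<Rightarrow> 'h) \<Rightarrow> (nat \<Rightarrow> real) \<Rightarrow> bool" where
  "singular_numbers U \<sigma> \<longleftrightarrow> decseq \<sigma> \<and> (\<forall>n. 0 \<le> \<sigma> n) \<and>
     (\<forall>t>0. finite {n. \<sigma> n = t} \<and>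
        card {n. \<sigma> n = t} =
          vector_space.dim scaleC {x. cadjoint U (U x) = complex_of_real (t\<^sup>2) *\<^sub>C x})"

definition schatten_class :: "ennreal \<Rightarrow> ('h::complex_hilbert \<Rightarrow> 'h) set" where
  "schatten_class r =
     (if r = \<infinity> then {U. bounded_clinear U}
      else {U. compact_operator U \<and>
               (\<exists>\<sigma>. singular_numbers U \<sigma> \<and> summable (\<lambda>n. \<sigma> n powr enn2real r))})"

section \<open>Absolutely summing operators and the summability property\<close>

definition dual_ball :: "('x::complex_normed_vector \<Rightarrow> complex) set" where
  "dual_ball = {\<phi>. bounded_clinear \<phi> \<and> onorm \<phi> \<le> 1}"

definition absolutely_summing ::
  "real \<Rightarrow> ('x::complex_banach \<Rightarrow> 'y::complex_banach) set" where
  "absolutely_summing s = {T. bounded_clinear T \<and>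
     (\<exists>C>0. \<forall>N (x :: nat \<Rightarrow> 'x).
        (\<Sum>n=1..N. norm (T (x n)) powr s) \<le>
          C powr s * (SUP \<phi>\<in>dual_ball. \<Sum>n=1..N. cmod (\<phi> (x n)) powr s))}"

text \<open>Property \<open>(l\<^sub>r)\<close>, with \<open>s\<close> and \<open>r\<close> related by \<open>1 / r = 1 / s - 1\<close>.  The Hilbert space \<open>H\<close> is
  a type and cannot be quantified inside the definition; it is passed as an argument, and an
  operator possesses the property if it does so for every instance of the type variable \<open>'h\<close>.\<close>

definition property_l ::
  "'h::complex_hilbert itself \<Rightarrow> 'g::{topological_ab_group_add, t2_space} measure \<Rightarrow>
   real \<Rightarrow> ennreal \<Rightarrow> ('x::complex_banach \<Rightarrow> 'y::complex_banach) \<Rightarrow> bool" where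
  "property_l H m s r T \<longleftrightarrow> bounded_clinear T \<and>
     (\<forall>f :: 'g \<Rightarrow>\<^sub>C 'x.
        (\<exists>(A :: 'g cmeasure \<Rightarrow> 'h) (U :: 'h \<Rightarrow> 'h) (B :: 'h \<Rightarrow> 'g \<Rightarrow>\<^sub>C 'x).
           bounded_clinear A \<and> U \<in> schatten_class r \<and> bounded_clinear B \<and>
           (\<forall>\<mu>. convolution f \<mu> = apply_bcontfun (B (U (A \<mu>))))) \<longrightarrow>
        (\<lambda>\<gamma>. norm (T (fourier_coeff m f \<gamma>)) powr s) summable_on dual_group)"

end

theory Submission
  imports Defs
begin

text \<open>Fix \<open>\<phi>\<close> in the dual ball, and for a character \<open>\<gamma>\<close> let \<open>a \<gamma> = A (\<gamma> m)\<close> and let \<open>\<psi> \<gamma> h\<close> be the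
  Fourier coefficient at \<open>\<gamma>\<close> of \<open>\<phi> \<circ> B h\<close>.  Since \<open>B U A\<close> is convolution with \<open>f\<close>, the matrix
  \<open>\<psi> \<gamma>' (U (a \<gamma>))\<close> is diagonal, and its diagonal consists of the values of \<open>\<phi>\<close> at the Fourier
  coefficients of \<open>f\<close>.  Both \<open>\<Sum>\<gamma>. (norm (a \<gamma>))\<^sup>2\<close> and the Hilbert--Schmidt norm of \<open>\<psi>\<close> are bounded
  independently of \<open>\<phi>\<close>, so the diagonal lies in \<open>S\<^sub>2 S\<^sub>r S\<^sub>2 \<subseteq> S\<^sub>s\<close> because \<open>1 / s = 1 / r + 1\<close>.
  Hence the Fourier coefficients of \<open>f\<close> are weakly \<open>s\<close>-summable, and \<open>T\<close> turns weak into absolute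
  \<open>s\<close>-summability.\<close>

section \<open>Hilbert spaces\<close>

text \<open>Fixing \<open>\<phi>\<close> is forced: \<open>X\<close> carries no Hilbert structure,
  so only the resulting scalar matrix can be compared with singular numbers. Both square-sum bounds
  have one source. Characters are orthonormal and \<open>m\<close> has mass one, so a trigonometric
  polynomial whose coefficients have square sum at most S has L1 norm at most sqrt S. Written as a
  pairing with such a polynomial, the square sum S itself is at most k * sqrt S, with k the norm of
  \<open>A\<close> or of \<open>B\<close>; hence S \<le> k^2. The rule for products of Schatten
  classes is proved for diagonals only, where it reduces to an estimate of the smallest entry: among
  more than 3 * n indices some entry is at most w n * \<sigma> n * v n, where \<open>w\<close>,
  \<open>\<sigma>\<close>, \<open>v\<close> control the three factors on the complement of n vectors
  each. Deleting such entries one by one bounds the whole sum, and Young's inequality separates the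
  factors. The constant depends only on s, on \<open>U\<close> and on the norms of \<open>A\<close>
  and \<open>B\<close>.\<close>

lemma cinner_add_right: "cinner x (y + z) = cinner x y + cinner x z"
  for x y z :: "'h::complex_hilbert"
  by (metis cinner_add_left cinner_commute complex_cnj_add)

lemma cinner_scaleC_right: "cinner x (c *\<^sub>C y) = cnj c * cinner x y"
  for x y :: "'h::complex_hilbert"
  by (metis cinner_commute cinner_scaleC_left complex_cnj_mult)

lemma cinner_zero_left [simp]: "cinner 0 x = 0"
  for x :: "'h::complex_hilbert"
  using cinner_add_left[of 0 0 x] by simp

lemma cinner_zero_right [simp]: "cinner x 0 = 0"
  for x :: "'h::complex_hilbert"
  using cinner_add_right[of x 0 0] by simp

lemma scaleC_minus_left: "(- c) *\<^sub>C x = - (c *\<^sub>C x)"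
  for x :: "'h::complex_normed_vector"
  using scaleC_add_left[of "- c" c x] by (simp add: eq_neg_iff_add_eq_0)

lemma cinner_minus_left: "cinner (- x) y = - cinner x y"
  for x y :: "'h::complex_hilbert"
  using cinner_add_left[of "- x" x y] by (simp add: eq_neg_iff_add_eq_0)

lemma cinner_minus_right: "cinner x (- y) = - cinner x y"
  for x y :: "'h::complex_hilbert"
  using cinner_add_right[of x "- y" y] by (simp add: eq_neg_iff_add_eq_0)

lemma cinner_diff_left: "cinner (x - y) z = cinner x z - cinner y z"
  for x y z :: "'h::complex_hilbert"
  using cinner_add_left[of x "- y" z] by (simp add: cinner_minus_left)

lemma cinner_diff_right: "cinner x (y - z) = cinner x y - cinner x z"
  for x y z :: "'h::complex_hilbert"
  using cinner_add_right[of x y "- z"] by (simp add: cinner_minus_right)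

lemma cinner_sum_left: "cinner (sum f A) y = (\<Sum>i\<in>A. cinner (f i) y)"
  for y :: "'h::complex_hilbert"
  by (induction A rule: infinite_finite_induct) (simp_all add: cinner_add_left)

lemma cinner_sum_right: "cinner x (sum f A) = (\<Sum>i\<in>A. cinner x (f i))"
  for x :: "'h::complex_hilbert"
  by (induction A rule: infinite_finite_induct) (simp_all add: cinner_add_right)

lemma cinner_eq_zero_commute: "cinner x y = 0 \<longleftrightarrow> cinner y x = 0"
  for x y :: "'h::complex_hilbert"
  by (metis cinner_commute complex_cnj_zero)

lemma cmod_cinner_commute: "cmod (cinner x y) = cmod (cinner y x)"
  for x y :: "'h::complex_hilbert"
  by (metis cinner_commute complex_mod_cnj)

lemma cinner_eqI:
  fixes x y :: "'h::complex_hilbert"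
  assumes "\<And>z. cinner z x = cinner z y"
  shows "x = y"
proof -
  have "cinner (x - y) (x - y) = 0"
    using assms by (simp add: cinner_diff_right)
  then show ?thesis
    by (simp add: cinner_self)
qed

lemma norm_add_squared: "(norm (x + y))\<^sup>2 = (norm x)\<^sup>2 + (norm y)\<^sup>2 + 2 * Re (cinner x y)"
  for x y :: "'h::complex_hilbert"
proof -
  have "cinner (x + y) (x + y) = cinner x x + cinner y y + (cinner x y + cnj (cinner x y))"
    using cinner_commute[of y x] by (simp add: cinner_add_left cinner_add_right algebra_simps)
  then have "complex_of_real ((norm (x + y))\<^sup>2) =
      complex_of_real ((norm x)\<^sup>2 + (norm y)\<^sup>2 + 2 * Re (cinner x y))"
    unfolding cinner_self complex_add_cnj by simp
  then show ?thesis
    using of_real_eq_iff by blast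
qed

lemma norm_diff_squared: "(norm (x - y))\<^sup>2 = (norm x)\<^sup>2 + (norm y)\<^sup>2 - 2 * Re (cinner x y)"
  for x y :: "'h::complex_hilbert"
  using norm_add_squared[of x "- y"] by (simp add: cinner_minus_right)

lemma parallelogram:
  "(norm (x + y))\<^sup>2 + (norm (x - y))\<^sup>2 = 2 * (norm x)\<^sup>2 + 2 * (norm y)\<^sup>2"
  for x y :: "'h::complex_hilbert"
  by (simp add: norm_add_squared norm_diff_squared)

text \<open>Norm at most one instead of one: the greedy choice below may have to return 0, and zero
  vectors are harmless in Bessel's inequality. A family instead of a set lets 0 occur
  repeatedly.\<close>

definition suborthonormal_on :: "'i set \<Rightarrow> ('i \<Rightarrow> 'h::complex_hilbert) \<Rightarrow> bool" where
  "suborthonormal_on I h \<longleftrightarrow>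
     (\<forall>i\<in>I. norm (h i) \<le> 1) \<and> (\<forall>i\<in>I. \<forall>j\<in>I. i \<noteq> j \<longrightarrow> cinner (h i) (h j) = 0)"

lemma suborthonormal_norm_sum_le:
  assumes I: "finite I" and h: "suborthonormal_on I h"
  shows "(norm (\<Sum>i\<in>I. c i *\<^sub>C h i))\<^sup>2 \<le> (\<Sum>i\<in>I. (cmod (c i))\<^sup>2)"
proof -
  have "cinner (\<Sum>i\<in>I. c i *\<^sub>C h i) (\<Sum>j\<in>I. c j *\<^sub>C h j) =
      (\<Sum>i\<in>I. \<Sum>j\<in>I. c i * cnj (c j) * cinner (h i) (h j))"
    unfolding cinner_sum_left cinner_scaleC_left
    unfolding cinner_sum_right cinner_scaleC_right sum_distrib_left
    by (simp add: mult_ac)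
  also have "\<dots> = (\<Sum>i\<in>I. \<Sum>j\<in>I. if i = j then complex_of_real ((cmod (c i) * norm (h i))\<^sup>2) else 0)"
    by (intro sum.cong refl) (use h in \<open>auto simp: suborthonormal_on_def cinner_self
          complex_norm_square power_mult_distrib simp del: of_real_power\<close>)
  also have "\<dots> = complex_of_real (\<Sum>i\<in>I. (cmod (c i) * norm (h i))\<^sup>2)"
    using I by simp
  finally have "(norm (\<Sum>i\<in>I. c i *\<^sub>C h i))\<^sup>2 = (\<Sum>i\<in>I. (cmod (c i) * norm (h i))\<^sup>2)"
    unfolding cinner_self of_real_eq_iff .
  also have "\<dots> \<le> (\<Sum>i\<in>I. (cmod (c i))\<^sup>2)"
    using h by (intro sum_mono power_mono) (auto simp: suborthonormal_on_def intro: mult_left_le)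
  finally show ?thesis .
qed

text \<open>Expand the squared distance from x to \<open>?y\<close>: the cross term is -2 * ?S and
  the squared norm of \<open>?y\<close> is at most \<open>?S\<close>, so the nonnegative total is at
  most the squared norm of x minus \<open>?S\<close>.\<close>

lemma bessel:
  fixes x :: "'h::complex_hilbert"
  assumes I: "finite I" and h: "suborthonormal_on I h"
  shows "(\<Sum>i\<in>I. (cmod (cinner x (h i)))\<^sup>2) \<le> (norm x)\<^sup>2"
proof -
  let ?y = "\<Sum>i\<in>I. cinner x (h i) *\<^sub>C h i"
  let ?S = "\<Sum>i\<in>I. (cmod (cinner x (h i)))\<^sup>2"
  have "cinner x ?y = complex_of_real ?S"
    unfolding cinner_sum_right cinner_scaleC_right of_real_sum
    by (intro sum.cong refl) (simp only: complex_norm_square mult.commute)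
  then have "Re (cinner x ?y) = ?S" by simp
  moreover have "0 \<le> (norm (x - ?y))\<^sup>2" by simp
  ultimately show ?thesis
    using suborthonormal_norm_sum_le[OF I h, of "\<lambda>i. cinner x (h i)"]
    unfolding norm_diff_squared by simp
qed

lemma cinner_cauchy_schwarz: "cmod (cinner x y) \<le> norm x * norm y"
  for x y :: "'h::complex_hilbert"
proof (cases "y = 0")
  case False
  let ?e = "complex_of_real (1 / norm y) *\<^sub>C y"
  have "suborthonormal_on {()} (\<lambda>_. ?e)"
    using False by (auto simp: suborthonormal_on_def norm_scaleC norm_divide)
  from bessel[OF _ this, of x] have "(cmod (cinner x ?e))\<^sup>2 \<le> (norm x)\<^sup>2" by simp
  then have "cmod (cinner x ?e) \<le> norm x" by (rule power2_le_imp_le) simp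
  then show ?thesis
    using False by (simp add: cinner_scaleC_right norm_mult norm_divide field_simps)
qed simp

lemma bounded_linear_cinner_left: "bounded_linear (\<lambda>x. cinner x y)"
  for y :: "'h::complex_hilbert"
  by (rule bounded_linear_intro[of _ "norm y"])
    (simp_all add: cinner_add_left scaleR_scaleC cinner_scaleC_left cinner_cauchy_schwarz
      scaleC_complex_def)

section \<open>Bounded operators, the Riesz representation and adjoints\<close>

lemma bounded_clinearD:
  assumes "bounded_clinear T"
  shows "bounded_linear T" "T (c *\<^sub>C x) = c *\<^sub>C T x"
  using assms by (auto simp: bounded_clinear_def)

lemma bounded_clinear_sum_scaleC:
  assumes "bounded_clinear T"
  shows "T (\<Sum>i\<in>I. c i *\<^sub>C x i) = (\<Sum>i\<in>I. c i *\<^sub>C T (x i))"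
  using assms by (simp add: linear_sum bounded_linear.linear bounded_clinear_def)

text \<open>A sequence of unit vectors on which \<open>Re \<circ> f\<close> approaches its norm is Cauchy by the
  parallelogram law, and its limit represents \<open>f\<close>.\<close>

lemma riesz_representation:
  fixes f :: "'h::complex_hilbert \<Rightarrow> complex"
  assumes f: "bounded_clinear f"
  shows "\<exists>z. \<forall>x. f x = cinner x z"
proof (cases "\<forall>x. f x = 0")
  case True
  then show ?thesis by (intro exI[of _ 0]) simp
next
  case False
  interpret f: bounded_linear f using f by (simp add: bounded_clinear_def)
  have fC: "f (c *\<^sub>C x) = c * f x" for c x
    using f by (simp add: bounded_clinear_def scaleC_complex_def)
  let ?k = "onorm f"
  have le: "cmod (f x) \<le> ?k * norm x" for x
    by (rule onorm[OF f.bounded_linear_axioms])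
  have k: "?k > 0"
    using False onorm_pos_lt[OF f.bounded_linear_axioms] by blast
  have ex: "\<exists>x. norm x = 1 \<and> f x \<in> \<real> \<and> ?k - inverse (real (Suc n)) < Re (f x)" for n
  proof -
    \<comment> \<open>The second argument of \<open>max\<close> keeps \<open>?d\<close> nonnegative,
      so that \<open>?d * norm x < cmod (f x)\<close> makes x and f x nonzero and the phase of f x
      can be rotated away in \<open>y\<close>.\<close>
    let ?d = "max (?k - inverse (real (Suc n))) (?k / 2)"
    have d: "0 \<le> ?d" "?d < ?k" using k by auto
    then obtain x where x: "?d * norm x < cmod (f x)"
      using onorm_bound[of ?d f] by (meson not_le)
    then have x0: "x \<noteq> 0" "f x \<noteq> 0"
      using mult_nonneg_nonneg[OF d(1) norm_ge_zero[of x]] by (auto simp: f.zero)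
    define y where "y = (cnj (f x) / complex_of_real (cmod (f x) * norm x)) *\<^sub>C x"
    have "norm y = 1" using x0 by (simp add: y_def norm_scaleC norm_mult norm_divide)
    moreover have "f y = complex_of_real (cmod (f x) / norm x)"
    proof -
      have "cnj (f x) * f x = complex_of_real (cmod (f x)) * complex_of_real (cmod (f x))"
        using complex_norm_square[of "f x"] by (simp add: power2_eq_square mult.commute)
      then show ?thesis
        using x0 by (simp add: y_def fC field_simps)
    qed
    moreover have "?d < cmod (f x) / norm x" 
      by (rule pos_less_divide_eq[THEN iffD2, OF _ x]) (use x0 in simp)
    ultimately show ?thesis by (intro exI[of _ y]) (auto simp del: of_nat_Suc)
  qed
  then obtain u where u: "\<And>n. norm (u n) = 1" "\<And>n. f (u n) \<in> \<real>"
    "\<And>n. ?k - inverse (real (Suc n)) < Re (f (u n))" by metis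
  let ?e = "\<lambda>n. inverse (real (Suc n))"
  have dist: "(norm (u m - u n))\<^sup>2 \<le> 4 * (?e m + ?e n) / ?k" for m n
  proof -
    let ?s = "norm (u m + u n)"
    have s2: "?s \<le> 2" using norm_triangle_ineq[of "u m" "u n"] u(1) by simp
    \<comment> \<open>The sum of two near-maximizers must be long, otherwise \<open>f\<close> there
      would exceed \<open>?k * ?s\<close>; the parallelogram law turns this into closeness.\<close>
    have "2 * ?k - (?e m + ?e n) \<le> Re (f (u m + u n))"
      using u(3)[of m] u(3)[of n] by (simp add: f.add)
    also have "\<dots> \<le> ?k * ?s"
      using complex_Re_le_cmod le order_trans by blast
    finally have "2 - ?s \<le> (?e m + ?e n) / ?k"
      unfolding pos_le_divide_eq[OF k] by (simp add: algebra_simps del: of_nat_Suc)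
    have "(norm (u m - u n))\<^sup>2 = (2 - ?s) * (2 + ?s)"
      using parallelogram[of "u m" "u n"] u(1) by (simp add: algebra_simps power2_eq_square)
    also have "\<dots> \<le> (2 - ?s) * 4" using s2 by (intro mult_left_mono) auto
    also have "\<dots> \<le> (?e m + ?e n) / ?k * 4"
      using \<open>2 - ?s \<le> _\<close> by (intro mult_right_mono) auto
    finally show ?thesis by (simp add: mult_ac)
  qed
  have lim_e: "?e \<longlonglongrightarrow> 0" by (rule LIMSEQ_inverse_real_of_nat)
  have sum_lt: "4 * (a + b) < x" if "a < x / 8" "b < x / 8" for a b x :: real
    using that by simp
  have "Cauchy u"
  proof (rule metric_CauchyI)
    fix \<epsilon> :: real assume \<epsilon>: "\<epsilon> > 0"
    then have "\<epsilon>\<^sup>2 * ?k / 8 > 0" using k by simp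
    then obtain M where M: "\<And>n. n \<ge> M \<Longrightarrow> ?e n < \<epsilon>\<^sup>2 * ?k / 8"
      using order_tendstoD(2)[OF lim_e] unfolding eventually_sequentially by blast
    have "dist (u m) (u n) < \<epsilon>" if "m \<ge> M" "n \<ge> M" for m n
    proof -
      have "(norm (u m - u n))\<^sup>2 \<le> 4 * (?e m + ?e n) / ?k" by (rule dist)
      also have "\<dots> < \<epsilon>\<^sup>2" 
        unfolding pos_divide_less_eq[OF k] by (rule sum_lt[OF M[OF that(1)] M[OF that(2)]])
      finally show ?thesis
        using \<epsilon> by (simp add: dist_norm power2_less_imp_less)
    qed
    then show "\<exists>M. \<forall>m\<ge>M. \<forall>n\<ge>M. dist (u m) (u n) < \<epsilon>" by blast
  qed
  then obtain z where z: "u \<longlonglongrightarrow> z" using Cauchy_convergent convergent_def by blast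
  have nz: "norm z = 1"
    using tendsto_norm[OF z] u(1) by (simp add: LIMSEQ_const_iff)
  have fz: "f z = complex_of_real ?k"
  proof -
    have flim: "(\<lambda>n. f (u n)) \<longlonglongrightarrow> f z" by (rule f.tendsto[OF z])
    have "(\<lambda>n. ?k - ?e n) \<longlonglongrightarrow> ?k - 0" by (intro tendsto_intros lim_e)
    then have "?k \<le> Re (f z)"
      by (intro LIMSEQ_le[OF _ tendsto_Re[OF flim]]) (use u(3) less_imp_le in auto)
    moreover have "cmod (f z) \<le> ?k" using le[of z] nz by simp
    moreover have "f z \<in> \<real>"
      by (rule closed_sequentially[OF closed_complex_Reals _ flim]) (use u(2) in auto)
    ultimately show ?thesis
      using complex_Re_le_cmod[of "f z"] by (auto simp: complex_is_Real_iff complex_eq_iff)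
  qed
  \<comment> \<open>z has minimal norm on the affine hyperplane f = ?k, so moving along the kernel
    of f cannot shorten it; this gives orthogonality.\<close>
  have ker: "cinner y z = 0" if y: "f y = 0" for y
  proof -
    define c where "c = cinner z y"
    have "norm z \<le> norm (z - t *\<^sub>C y)" for t
    proof -
      have "?k \<le> ?k * norm (z - t *\<^sub>C y)"
        using le[of "z - t *\<^sub>C y"] k by (simp add: f.diff fC y fz)
      then show ?thesis using k nz by simp
    qed
    then have sq: "(norm z)\<^sup>2 \<le> (norm (z - t *\<^sub>C y))\<^sup>2" for t
      by (intro power_mono) auto
    have *: "2 * Re (cnj t * c) \<le> (cmod t)\<^sup>2 * (norm y)\<^sup>2" for t
      using sq[of t]
      by (simp add: norm_diff_squared c_def cinner_scaleC_right norm_scaleC power_mult_distrib)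
    \<comment> \<open>The test point is t = r * c. With this r the quadratic term is at most half of
      the linear one; the added 1 covers y = 0.\<close>
    define r where "r = 1 / ((norm y)\<^sup>2 + 1)"
    have r: "r > 0" "r * (norm y)\<^sup>2 \<le> 1"
      by (auto simp: r_def field_simps add_pos_nonneg)
    have "Re (cnj (complex_of_real r * c) * c) = r * (cmod c)\<^sup>2"
      by (simp only: cmod_power2) (simp add: power2_eq_square algebra_simps)
    moreover have "cmod (complex_of_real r * c) = r * cmod c"
      using r(1) by (simp add: norm_mult)
    ultimately have "2 * (r * (cmod c)\<^sup>2) \<le> (r * cmod c)\<^sup>2 * (norm y)\<^sup>2"
      using *[of "complex_of_real r * c"] by simp
    also have "\<dots> = (r * (norm y)\<^sup>2) * (r * (cmod c)\<^sup>2)"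
      by (simp add: power2_eq_square)
    also have "\<dots> \<le> 1 * (r * (cmod c)\<^sup>2)"
      using r by (intro mult_right_mono) auto
    finally have "r * (cmod c)\<^sup>2 \<le> 0" by simp
    then have "c = 0" using r(1) by (simp add: mult_le_0_iff)
    then show ?thesis by (simp add: c_def cinner_eq_zero_commute)
  qed
  have "f x = cinner x (complex_of_real ?k *\<^sub>C z)" for x
  proof -
    have "f (x - (f x / complex_of_real ?k) *\<^sub>C z) = 0"
      using k by (simp add: f.diff fC fz)
    from ker[OF this] show ?thesis
      using k by (simp add: cinner_diff_left cinner_scaleC_left cinner_scaleC_right cinner_self nz)
  qed
  then show ?thesis by blast
qed

text \<open>\<open>cadjoint\<close> is a definite description. Existence comes from the Riesz
  representation for each y, uniqueness from the fact that inner products determine a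
  vector.\<close>

lemma cadjoint:
  fixes U :: "'h::complex_hilbert \<Rightarrow> 'h"
  assumes U: "bounded_clinear U"
  shows "cinner (U x) y = cinner x (cadjoint U y)"
proof -
  have "\<exists>z. \<forall>x. cinner (U x) y = cinner x z" for y
    using U bounded_linear_compose[OF bounded_linear_cinner_left bounded_clinearD(1)[OF U]]
    by (intro riesz_representation)
      (auto simp: bounded_clinear_def cinner_scaleC_left scaleC_complex_def)
  then obtain V where V: "\<forall>x y. cinner (U x) y = cinner x (V y)" by metis
  have "cadjoint U = V"
    unfolding cadjoint_def
  proof (rule the_equality)
    show "\<forall>x y. cinner (U x) y = cinner x (V y)" by (rule V)
    fix W assume W: "\<forall>x y. cinner (U x) y = cinner x (W y)"
    show "W = V"
      by (rule ext, rule cinner_eqI) (metis V W)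
  qed
  then show ?thesis using V by simp
qed

lemma bounded_linear_cadjoint:
  fixes U :: "'h::complex_hilbert \<Rightarrow> 'h"
  assumes U: "bounded_clinear U"
  shows "bounded_linear (cadjoint U)"
proof (rule bounded_linear_intro[of _ "onorm U"])
  show "cadjoint U (x + y) = cadjoint U x + cadjoint U y" for x y
    by (rule cinner_eqI) (simp add: cinner_add_right cadjoint[OF U, symmetric])
  show "cadjoint U (r *\<^sub>R x) = r *\<^sub>R cadjoint U x" for r x
    by (rule cinner_eqI)
      (simp add: cinner_scaleC_right scaleR_scaleC cadjoint[OF U, symmetric])
  show "norm (cadjoint U y) \<le> norm y * onorm U" for y
  proof (cases "cadjoint U y = 0")
    case True
    then show ?thesis using onorm_pos_le[OF bounded_clinearD(1)[OF U]] by simp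
  next
    case False
    let ?v = "cadjoint U y"
    have "(norm ?v)\<^sup>2 = cmod (cinner (U ?v) y)"
      by (simp add: cadjoint[OF U] cinner_self norm_power)
    also have "\<dots> \<le> norm (U ?v) * norm y" by (rule cinner_cauchy_schwarz)
    also have "\<dots> \<le> onorm U * norm ?v * norm y"
      by (intro mult_right_mono onorm bounded_clinearD(1)[OF U]) auto
    finally show ?thesis using False by (simp add: power2_eq_square mult_ac)
  qed
qed

section \<open>Singular numbers of compact operators\<close>

definition orthonormal :: "'h::complex_hilbert set \<Rightarrow> bool" where
  "orthonormal B \<longleftrightarrow>
     (\<forall>b\<in>B. norm b = 1) \<and> (\<forall>b\<in>B. \<forall>b'\<in>B. b \<noteq> b' \<longrightarrow> cinner b b' = 0)"

lemma orthonormal_cinner: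
  assumes "orthonormal B" "b \<in> B" "b' \<in> B"
  shows "cinner b b' = (if b = b' then 1 else 0)"
  using assms by (auto simp: orthonormal_def cinner_self)

text \<open>An orthonormal set of maximal cardinality is a basis.\<close>

lemma orthonormal_basis_exists:
  fixes M :: "'h::complex_hilbert set"
  assumes zeroM: "0 \<in> M"
    and diff: "\<And>x y. x \<in> M \<Longrightarrow> y \<in> M \<Longrightarrow> x - y \<in> M"
    and scale: "\<And>c x. x \<in> M \<Longrightarrow> c *\<^sub>C x \<in> M"
    and bound: "\<And>B. orthonormal B \<Longrightarrow> B \<subseteq> M \<Longrightarrow> finite B \<and> card B \<le> K"
  shows "\<exists>B\<subseteq>M. orthonormal B \<and> finite B \<and> card B = vector_space.dim scaleC M \<and>
    (\<forall>x\<in>M. (\<forall>b\<in>B. cinner x b = 0) \<longrightarrow> x = 0)"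
proof -
  interpret V: vector_space "scaleC :: complex \<Rightarrow> 'h \<Rightarrow> 'h" by (rule vector_space_scaleC)
  have "orthonormal ({} :: 'h set) \<and> {} \<subseteq> M" by (simp add: orthonormal_def)
  then have "\<exists>B. (orthonormal B \<and> B \<subseteq> M) \<and> (\<forall>B'. orthonormal B' \<and> B' \<subseteq> M \<longrightarrow> card B' \<le> card B)"
    using bound by (intro ex_has_greatest_nat[of _ "{}" card "Suc K"])
      (auto simp: less_Suc_eq_le)
  then obtain B where B: "orthonormal B" "B \<subseteq> M"
    and max: "\<And>B'. orthonormal B' \<Longrightarrow> B' \<subseteq> M \<Longrightarrow> card B' \<le> card B" by blast
  have fin: "finite B" using bound[OF B] by simp
  have zero: "x = 0" if x: "x \<in> M" "\<forall>b\<in>B. cinner x b = 0" for x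
  proof (rule ccontr)
    assume x0: "x \<noteq> 0"
    define e where "e = complex_of_real (1 / norm x) *\<^sub>C x"
    have e: "norm e = 1" "e \<in> M" "\<forall>b\<in>B. cinner e b = 0"
      using x0 x scale by (auto simp: e_def norm_scaleC norm_divide cinner_scaleC_left)
    have "e \<notin> B" using e by (auto simp: cinner_self)
    moreover have "orthonormal (insert e B)"
      using B(1) e cinner_eq_zero_commute unfolding orthonormal_def by auto
    ultimately show False
      using max[of "insert e B"] e B(2) fin by simp
  qed
  have add: "x + y \<in> M" if "x \<in> M" "y \<in> M" for x y
    using diff[OF that(1) diff[OF zeroM that(2)]] by simp
  \<comment> \<open>The residual of x after projection lies in \<open>M\<close> and is orthogonal to
    \<open>B\<close>, hence is 0 by maximality.\<close>
  have span: "x \<in> V.span B" if x: "x \<in> M" for x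
  proof -
    let ?p = "\<Sum>b\<in>B. cinner x b *\<^sub>C b"
    have "(\<Sum>b\<in>B'. cinner x b *\<^sub>C b) \<in> M" if "finite B'" "B' \<subseteq> B" for B'
      using that by (induction B') (use zeroM add scale B in auto)
    then have "?p \<in> M" using fin by blast
    moreover have "cinner (x - ?p) b = 0" if b: "b \<in> B" for b
    proof -
      have "cinner ?p b = (\<Sum>b'\<in>B. if b' = b then cinner x b' else 0)"
        unfolding cinner_sum_left cinner_scaleC_left
        by (intro sum.cong refl) (simp add: orthonormal_cinner[OF B(1) _ b])
      then show ?thesis using fin b by (simp add: cinner_diff_left)
    qed
    ultimately have "x = ?p" using zero[of "x - ?p"] x diff by simp
    also have "\<dots> \<in> V.span B" by (intro V.span_sum V.span_scale V.span_base)
    finally show ?thesis .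
  qed
  have "V.independent B"
  proof
    assume "V.dependent B"
    then obtain u v where uv: "v \<in> B" "u v \<noteq> 0" "(\<Sum>b\<in>B. u b *\<^sub>C b) = 0"
      using V.dependent_finite[OF fin] by blast
    have "cinner (\<Sum>b\<in>B. u b *\<^sub>C b) v = (\<Sum>b\<in>B. if b = v then u b else 0)"
      unfolding cinner_sum_left cinner_scaleC_left
      by (intro sum.cong refl) (simp add: orthonormal_cinner[OF B(1) _ uv(1)])
    then show False using uv fin by simp
  qed
  moreover have "V.span B = V.span M"
    using span B(2) by (intro V.span_eq[THEN iffD2]) (auto intro: V.span_base)
  ultimately have "card B = V.dim M"
    by (simp add: V.dim_eq_card)
  then show ?thesis using B fin zero by blast
qed

lemma compact_operator_bounded_clinear: "compact_operator U \<Longrightarrow> bounded_clinear U"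
  by (simp add: compact_operator_def)

abbreviation singular_space :: "('h::complex_hilbert \<Rightarrow> 'h) \<Rightarrow> real \<Rightarrow> 'h set" where
  "singular_space U t \<equiv> {x. cadjoint U (U x) = complex_of_real (t\<^sup>2) *\<^sub>C x}"

lemma cinner_singular_space:
  assumes U: "bounded_clinear U" and y: "y \<in> singular_space U t"
  shows "cinner (U x) (U y) = complex_of_real (t\<^sup>2) * cinner x y"
  using y by (simp add: cadjoint[OF U] cinner_scaleC_right)

text \<open>The library assigns dimension \<open>0\<close> to infinite-dimensional spaces, so \<open>singular_numbers\<close> alone
  does not make the singular spaces finite-dimensional.  By compactness they are: \<open>U\<close> maps
  orthonormal vectors of the singular space to points at mutual distance \<open>sqrt 2 * t\<close>.\<close>

lemma orthonormal_singular_space_bounded: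
  assumes U: "compact_operator U" and t: "t > 0"
  shows "\<exists>K. \<forall>B. orthonormal B \<longrightarrow> B \<subseteq> singular_space U t \<longrightarrow> finite B \<and> card B \<le> K"
proof -
  have Ub: "bounded_clinear U" using U by (rule compact_operator_bounded_clinear)
  interpret U: bounded_linear U by (rule bounded_clinearD(1)[OF Ub])
  have "compact (closure (U ` cball 0 1))" using U by (simp add: compact_operator_def)
  moreover have "t / 2 > 0" using t by simp
  ultimately obtain C where C: "finite C" "closure (U ` cball 0 1) \<subseteq> (\<Union>c\<in>C. ball c (t / 2))"
    unfolding compact_eq_totally_bounded by blast
  have "finite B \<and> card B \<le> card C" if B: "orthonormal B" "B \<subseteq> singular_space U t" for B
  proof -
    have "\<exists>c\<in>C. dist c (U b) < t / 2" if "b \<in> B" for b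
    proof -
      have "U b \<in> closure (U ` cball 0 1)"
        using that B(1) closure_subset[of "U ` cball 0 1"] by (auto simp: orthonormal_def)
      then show ?thesis using C(2) by (auto simp: subset_iff)
    qed
    then obtain g where g: "\<And>b. b \<in> B \<Longrightarrow> g b \<in> C" "\<And>b. b \<in> B \<Longrightarrow> dist (g b) (U b) < t / 2"
      by metis
    \<comment> \<open>Two vectors of \<open>B\<close> sharing a centre would have images closer than
      t.\<close>
    have "inj_on g B"
    proof (rule inj_onI, rule ccontr)
      fix b b' assume b: "b \<in> B" "b' \<in> B" "g b = g b'" "b \<noteq> b'"
      have "cinner (U (b - b')) (U (b - b')) = cinner (U (b - b')) (U b) - cinner (U (b - b')) (U b')"
        by (simp add: U.diff cinner_diff_right)
      also have "\<dots> = complex_of_real (t\<^sup>2) * (cinner (b - b') b - cinner (b - b') b')"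
        using b B(2) by (subst (1 2) cinner_singular_space[OF Ub]) (auto simp: right_diff_distrib)
      also have "\<dots> = complex_of_real (2 * t\<^sup>2)"
        using b B(1) by (simp add: cinner_diff_left orthonormal_cinner)
      finally have "(norm (U (b - b')))\<^sup>2 = 2 * t\<^sup>2"
        unfolding cinner_self of_real_eq_iff .
      moreover have "norm (U (b - b')) < t"
        using g(2)[OF b(1)] g(2)[OF b(2)] b(3) dist_triangle3[of "U b" "U b'" "g b"]
        by (simp add: U.diff dist_norm)
      then have "(norm (U (b - b')))\<^sup>2 < t\<^sup>2" by (simp add: power_strict_mono)
      ultimately show False using zero_le_power2[of t] by linarith
    qed
    moreover have "g ` B \<subseteq> C" using g(1) by blast
    ultimately show ?thesis
      by (intro conjI inj_on_finite[OF _ _ C(1)] card_inj_on_le[OF _ _ C(1)])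
  qed
  then show ?thesis by blast
qed

lemma singular_space_basis:
  assumes U: "compact_operator U" and t: "t > 0"
  shows "\<exists>B\<subseteq>singular_space U t. orthonormal B \<and> finite B \<and>
    card B = vector_space.dim scaleC (singular_space U t) \<and>
    (\<forall>x\<in>singular_space U t. (\<forall>b\<in>B. cinner x b = 0) \<longrightarrow> x = 0)"
proof -
  have Ub: "bounded_clinear U" using U by (rule compact_operator_bounded_clinear)
  interpret U: bounded_linear U by (rule bounded_clinearD(1)[OF Ub])
  interpret V: bounded_linear "cadjoint U" by (rule bounded_linear_cadjoint[OF Ub])
  have scale: "cadjoint U (c *\<^sub>C x) = c *\<^sub>C cadjoint U x" for c x
    by (rule cinner_eqI) (simp add: cadjoint[OF Ub, symmetric] cinner_scaleC_right)
  obtain K where "\<forall>B. orthonormal B \<longrightarrow> B \<subseteq> singular_space U t \<longrightarrow> finite B \<and> card B \<le> K"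
    using orthonormal_singular_space_bounded[OF U t] ..
  then show ?thesis
    by (intro orthonormal_basis_exists[where K = K])
      (auto simp: U.zero V.zero U.diff V.diff scaleC_diff_right bounded_clinearD(2)[OF Ub] scale
        scaleC_scaleC mult.commute)
qed

text \<open>On the complement of the singular spaces already removed, the supremum of \<open>norm (U x)\<close> over
  the unit ball is attained by compactness, and a maximizer is an eigenvector of \<open>U\<^sup>* U\<close>.\<close>

lemma singular_value_on_invariant_complement:
  fixes U :: "'h::complex_hilbert \<Rightarrow> 'h"
  assumes U: "compact_operator U"
    and B: "\<And>b. b \<in> B \<Longrightarrow> \<exists>t. b \<in> singular_space U t"
    and c: "0 \<le> c"
    and x: "\<forall>b\<in>B. cinner x b = 0" "norm (U x) > c * norm x"
  shows "\<exists>\<rho> y. \<rho> > c \<and> y \<noteq> 0 \<and> y \<in> singular_space U \<rho> \<and> (\<forall>b\<in>B. cinner y b = 0)"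
proof -
  have Ub: "bounded_clinear U" using U by (rule compact_operator_bounded_clinear)
  interpret U: bounded_linear U by (rule bounded_clinearD(1)[OF Ub])
  interpret V: bounded_linear "cadjoint U" by (rule bounded_linear_cadjoint[OF Ub])
  let ?P = "\<lambda>x. cadjoint U (U x)"
  define M where "M = {x. \<forall>b\<in>B. cinner x b = 0}"
  define \<rho> where "\<rho> = (SUP x\<in>M \<inter> cball 0 1. norm (U x))"
  have bdd: "bdd_above ((\<lambda>x. norm (U x)) ` (M \<inter> cball 0 1))"
  proof (rule bdd_aboveI2)
    fix z assume "z \<in> M \<inter> cball 0 1"
    then have "onorm U * norm z \<le> onorm U * 1"
      by (intro mult_left_mono onorm_pos_le U.bounded_linear_axioms) auto
    then show "norm (U z) \<le> onorm U"
      using onorm[OF U.bounded_linear_axioms, of z] by simp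
  qed
  have M_scale: "c *\<^sub>C z \<in> M" if "z \<in> M" for c z
    using that by (simp add: M_def cinner_scaleC_left)
  have normalize: "norm (U z) / norm z \<le> \<rho>" if "z \<in> M" "z \<noteq> 0" for z
  proof -
    have "norm (U (complex_of_real (1 / norm z) *\<^sub>C z)) \<le> \<rho>"
      unfolding \<rho>_def using that
      by (intro cSUP_upper bdd) (auto intro: M_scale simp: norm_scaleC norm_divide)
    then show ?thesis
      by (simp add: bounded_clinearD(2)[OF Ub] norm_scaleC norm_divide)
  qed
  have le: "norm (U z) \<le> \<rho> * norm z" if "z \<in> M" for z
    using normalize[OF that] by (cases "z = 0") (auto simp: U.zero divide_le_eq)
  have "x \<noteq> 0" using x(2) by (auto simp: U.zero)
  then have "c < norm (U x) / norm x" using x(2) by (simp add: less_divide_eq)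
  then have \<rho>c: "\<rho> > c" using normalize[of x] x(1) \<open>x \<noteq> 0\<close> by (simp add: M_def)
  then have \<rho>: "\<rho> > 0" using c by simp
  \<comment> \<open>Each b is an eigenvector of the self-adjoint map \<open>?P\<close>, so its
    orthogonal complement is invariant.\<close>
  have P_M: "?P z \<in> M" if z: "z \<in> M" for z
    unfolding M_def
  proof (clarify)
    fix b assume b: "b \<in> B"
    then obtain t where t: "b \<in> singular_space U t" using B by blast
    have "cinner (U z) (U b) = 0"
      using cinner_singular_space[OF Ub t, of z] z b by (simp add: M_def)
    then show "cinner (?P z) b = 0"
      by (simp add: cinner_eq_zero_commute[of "?P z"] cinner_eq_zero_commute[of "U z"]
          flip: cadjoint[OF Ub])
  qed
  \<comment> \<open>By invariance \<open>le\<close> applies to \<open>?P z\<close> itself, which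
    bounds the adjoint by \<open>\<rho>\<close> on the image of \<open>M\<close>.\<close>
  have P_le: "norm (?P z) \<le> \<rho> * norm (U z)" if z: "z \<in> M" for z
  proof (cases "?P z = 0")
    case True
    then show ?thesis using \<rho> by simp
  next
    case False
    have "(norm (?P z))\<^sup>2 = cmod (cinner (?P z) (?P z))"
      by (simp add: cinner_self norm_power)
    also have "\<dots> = cmod (cinner (U (?P z)) (U z))" by (simp add: cadjoint[OF Ub])
    also have "\<dots> \<le> norm (U (?P z)) * norm (U z)" by (rule cinner_cauchy_schwarz)
    also have "\<dots> \<le> (\<rho> * norm (?P z)) * norm (U z)"
      by (intro mult_right_mono le P_M z) simp
    finally show ?thesis using False by (simp add: power2_eq_square mult_ac)
  qed
  \<comment> \<open>Near-maximizers are approximate eigenvectors: the right-hand side vanishes as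
    \<open>norm (U z)\<close> approaches \<open>\<rho>\<close>.\<close>
  have P_diff: "(norm (?P z - complex_of_real (\<rho>\<^sup>2) *\<^sub>C z))\<^sup>2 \<le> \<rho>\<^sup>2 * (\<rho>\<^sup>2 - (norm (U z))\<^sup>2)"
    if z: "z \<in> M" "norm z \<le> 1" for z
  proof -
    have "cinner (?P z) z = complex_of_real ((norm (U z))\<^sup>2)"
      using cinner_commute[of "?P z" z] by (simp add: cinner_self flip: cadjoint[OF Ub])
    then have "(norm (?P z - complex_of_real (\<rho>\<^sup>2) *\<^sub>C z))\<^sup>2 =
        (norm (?P z))\<^sup>2 + (\<rho>\<^sup>2)\<^sup>2 * (norm z)\<^sup>2 - 2 * (\<rho>\<^sup>2 * (norm (U z))\<^sup>2)"
      by (simp add: norm_diff_squared norm_scaleC cinner_scaleC_right power_mult_distrib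
          norm_power)
    also have "\<dots> \<le> (\<rho> * norm (U z))\<^sup>2 + (\<rho>\<^sup>2)\<^sup>2 * 1 - 2 * (\<rho>\<^sup>2 * (norm (U z))\<^sup>2)"
      using z(2) P_le[OF z(1)]
      by (intro diff_right_mono add_mono power_mono mult_left_mono) (auto simp: power_le_one)
    also have "\<dots> = \<rho>\<^sup>2 * (\<rho>\<^sup>2 - (norm (U z))\<^sup>2)"
      by (simp add: algebra_simps power2_eq_square)
    finally show ?thesis .
  qed
  have "\<exists>z\<in>M \<inter> cball 0 1. \<rho> - inverse (real (Suc n)) < norm (U z)" for n
  proof -
    have "0 \<in> M \<inter> cball 0 1" by (simp add: M_def)
    then have "M \<inter> cball 0 1 \<noteq> {}" by blast
    then show ?thesis
      using less_cSUP_iff[OF _ bdd, of "\<rho> - inverse (real (Suc n))"] unfolding \<rho>_def by simp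
  qed
  then obtain z where z: "\<And>n. z n \<in> M" "\<And>n. norm (z n) \<le> 1"
    "\<And>n. \<rho> - inverse (real (Suc n)) < norm (U (z n))"
    by (metis IntE dist_0_norm mem_cball)
  have lim_norm: "(\<lambda>n. norm (U (z n))) \<longlonglongrightarrow> \<rho>"
  proof (rule tendsto_sandwich[OF always_eventually always_eventually])
    show "\<forall>n. \<rho> - inverse (real (Suc n)) \<le> norm (U (z n))" using z(3) less_imp_le by blast
    show "\<forall>n. norm (U (z n)) \<le> \<rho>"
      using z(1,2) by (auto simp: \<rho>_def intro!: cSUP_upper bdd)
    show "(\<lambda>n. \<rho> - inverse (real (Suc n))) \<longlonglongrightarrow> \<rho>"
      using tendsto_diff[OF tendsto_const LIMSEQ_inverse_real_of_nat, of \<rho>] by simp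
  qed simp
  have "(\<lambda>n. (norm (?P (z n) - complex_of_real (\<rho>\<^sup>2) *\<^sub>C z n))\<^sup>2) \<longlonglongrightarrow> 0"
  proof (rule tendsto_sandwich[OF always_eventually always_eventually tendsto_const])
    show "\<forall>n. (norm (?P (z n) - complex_of_real (\<rho>\<^sup>2) *\<^sub>C z n))\<^sup>2 \<le> \<rho>\<^sup>2 * (\<rho>\<^sup>2 - (norm (U (z n)))\<^sup>2)"
      using P_diff z by blast
    have "(\<lambda>n. \<rho>\<^sup>2 * (\<rho>\<^sup>2 - (norm (U (z n)))\<^sup>2)) \<longlonglongrightarrow> \<rho>\<^sup>2 * (\<rho>\<^sup>2 - \<rho>\<^sup>2)"
      by (intro tendsto_intros lim_norm)
    then show "(\<lambda>n. \<rho>\<^sup>2 * (\<rho>\<^sup>2 - (norm (U (z n)))\<^sup>2)) \<longlonglongrightarrow> 0" by simp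
  qed simp
  from tendsto_real_sqrt[OF this]
  have diff0: "(\<lambda>n. ?P (z n) - complex_of_real (\<rho>\<^sup>2) *\<^sub>C z n) \<longlonglongrightarrow> 0"
    by (simp add: tendsto_norm_zero_cancel)
  have "U (z n) \<in> closure (U ` cball 0 1)" for n
    using z(2) closure_subset[of "U ` cball 0 1"] by auto
  moreover have "compact (closure (U ` cball 0 1))" using U by (simp add: compact_operator_def)
  ultimately obtain r w where "strict_mono r" "((\<lambda>n. U (z n)) \<circ> r) \<longlonglongrightarrow> w"
    unfolding compact_def by meson
  then have r: "strict_mono r" "(\<lambda>n. U (z (r n))) \<longlonglongrightarrow> w" by (simp_all add: comp_def)
  \<comment> \<open>Compactness gives a limit only for the images. Since \<open>?P (z (r n))\<close>
    tends to \<open>cadjoint U w\<close> and its difference from \<open>\<rho>\<^sup>2\<close> times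
    \<open>z (r n)\<close> tends to 0, the maximizers must converge to this y.\<close>
  define y where "y = inverse (\<rho>\<^sup>2) *\<^sub>R cadjoint U w"
  have "(\<lambda>n. inverse (\<rho>\<^sup>2) *\<^sub>R
      (?P (z (r n)) - (?P (z (r n)) - complex_of_real (\<rho>\<^sup>2) *\<^sub>C z (r n)))) \<longlonglongrightarrow>
      inverse (\<rho>\<^sup>2) *\<^sub>R (cadjoint U w - 0)"
    using LIMSEQ_subseq_LIMSEQ[OF diff0 r(1)]
    by (intro tendsto_intros V.tendsto r(2)) (simp add: comp_def)
  then have lim_y: "(\<lambda>n. z (r n)) \<longlonglongrightarrow> y"
    using \<rho> by (simp add: y_def flip: scaleR_scaleC of_real_power)
  have w: "U y = w" by (rule LIMSEQ_unique[OF U.tendsto[OF lim_y] r(2)])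
  have "norm (U y) = \<rho>"
    using LIMSEQ_unique[OF tendsto_norm[OF U.tendsto[OF lim_y]]]
      LIMSEQ_subseq_LIMSEQ[OF lim_norm r(1)] by (simp add: comp_def)
  then have "y \<noteq> 0" using \<rho> by (auto simp: U.zero)
  moreover have "?P y = \<rho>\<^sup>2 *\<^sub>R y"
    using \<rho> unfolding w by (simp add: y_def)
  then have "?P y = complex_of_real (\<rho>\<^sup>2) *\<^sub>C y" by (simp only: scaleR_scaleC)
  moreover have "cinner y b = 0" if b: "b \<in> B" for b
  proof -
    have "(\<lambda>n. cinner (z (r n)) b) \<longlonglongrightarrow> cinner y b"
      by (rule bounded_linear.tendsto[OF bounded_linear_cinner_left lim_y])
    then show ?thesis using z(1) b by (simp add: M_def LIMSEQ_const_iff)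
  qed
  ultimately show ?thesis using \<rho>c by blast
qed

text \<open>Removing bases of all singular spaces for values above \<open>\<sigma> n\<close> costs
  at most n vectors, because such values occur only at indices below n. If the bound failed on the
  complement, there would be a further nonzero singular vector there with value
  \<open>\<rho> > \<sigma> n\<close>, orthogonal to a basis of its own singular space.\<close>

lemma singular_number_bound:
  fixes U :: "'h::complex_hilbert \<Rightarrow> 'h"
  assumes U: "compact_operator U" and \<sigma>: "singular_numbers U \<sigma>"
  shows "\<exists>B. finite B \<and> card B \<le> n \<and>
    (\<forall>x. (\<forall>b\<in>B. cinner x b = 0) \<longrightarrow> norm (U x) \<le> \<sigma> n * norm x)"
proof -
  have dec: "decseq \<sigma>" and nonneg: "\<And>k. 0 \<le> \<sigma> k"
    and mult: "\<And>t. t > 0 \<Longrightarrow>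
      finite {k. \<sigma> k = t} \<and> card {k. \<sigma> k = t} = vector_space.dim scaleC (singular_space U t)"
    using \<sigma> unfolding singular_numbers_def by blast+
  let ?basis = "\<lambda>t B. B \<subseteq> singular_space U t \<and> finite B \<and> card B = card {k. \<sigma> k = t} \<and>
      (\<forall>x\<in>singular_space U t. (\<forall>b\<in>B. cinner x b = 0) \<longrightarrow> x = 0)"
  define B where "B t = (SOME B. ?basis t B)" for t
  have B: "?basis t (B t)" if "t > 0" for t
    unfolding B_def
  proof (rule someI_ex)
    show "\<exists>B. ?basis t B"
      using singular_space_basis[OF U that] unfolding conjunct2[OF mult[OF that]] by blast
  qed
  define T where "T = \<sigma> ` {k. \<sigma> k > \<sigma> n}"
  have sub: "{k. \<sigma> k > \<sigma> n} \<subseteq> {..<n}"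
    using decseqD[OF dec] by (auto simp: not_less[symmetric])
  have T: "finite T" "\<And>t. t \<in> T \<Longrightarrow> t > \<sigma> n" "\<And>t. t \<in> T \<Longrightarrow> t > 0"
    using finite_subset[OF sub] nonneg le_less_trans by (auto simp: T_def)
  let ?B = "\<Union>t\<in>T. B t"
  have "card ?B \<le> (\<Sum>t\<in>T. card (B t))" by (rule card_UN_le[OF T(1)])
  also have "\<dots> = (\<Sum>t\<in>T. card {k. \<sigma> k = t})"
    using B T(3) by (intro sum.cong) auto
  also have "\<dots> = card (\<Union>t\<in>T. {k. \<sigma> k = t})"
    by (rule card_UN_disjoint[symmetric]) (use T(1,3) mult in auto)
  also have "\<dots> \<le> card {..<n}"
  proof (rule card_mono)
    have "(\<Union>t\<in>T. {k. \<sigma> k = t}) \<subseteq> {k. \<sigma> k > \<sigma> n}" by (auto simp: T_def)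
    then show "(\<Union>t\<in>T. {k. \<sigma> k = t}) \<subseteq> {..<n}" using sub by (rule subset_trans)
  qed simp
  finally have card: "card ?B \<le> n" by simp
  have "norm (U x) \<le> \<sigma> n * norm x" if x: "\<forall>b\<in>?B. cinner x b = 0" for x
  proof (rule ccontr)
    assume "\<not> ?thesis"
    then have x': "norm (U x) > \<sigma> n * norm x" by simp
    have "\<exists>t. b \<in> singular_space U t" if "b \<in> ?B" for b
      using that T(3) B by blast
    from singular_value_on_invariant_complement[OF U this nonneg x x']
    obtain \<rho> y where y: "\<rho> > \<sigma> n" "y \<noteq> 0" "y \<in> singular_space U \<rho>" "\<forall>b\<in>?B. cinner y b = 0"
      by blast
    have \<rho>: "\<rho> > 0" using y(1) nonneg[of n] by simp
    have "\<forall>b\<in>B \<rho>. cinner y b = 0"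
    proof (cases "\<rho> \<in> T")
      case True
      then show ?thesis using y(4) by blast
    next
      case False
      \<comment> \<open>A value not listed by \<open>\<sigma>\<close> has dimension 0. As the basis
        is finite, it is empty, and its completeness then leaves only the zero vector.\<close>
      then have "{k. \<sigma> k = \<rho>} = {}" using y(1) by (auto simp: T_def)
      then have "card (B \<rho>) = 0" using B[OF \<rho>] by simp
      then have "B \<rho> = {}" using B[OF \<rho>] card_0_eq by blast
      then show ?thesis by simp
    qed
    then show False using B[OF \<rho>] y by blast
  qed
  moreover have "finite ?B" using T B by blast
  ultimately show ?thesis using card by blast
qed

section \<open>Diagonal operators factoring through a Schatten class\<close>

text \<open>Greedy choice: \<open>h n\<close> nearly maximizes \<open>q\<close> on the unit ball of the complement of its
  predecessors.  This replaces a singular value decomposition up to the factor \<open>2\<close>.\<close>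

lemma greedy_orthogonal_sequence:
  fixes q :: "'h::complex_hilbert \<Rightarrow> real"
  assumes scale: "\<And>c x. q (c *\<^sub>C x) = cmod c * q x"
    and nonneg: "\<And>x. 0 \<le> q x"
    and bound: "\<And>(N::nat) h. suborthonormal_on {..<N} h \<Longrightarrow> (\<Sum>n<N. (q (h n))\<^sup>2) \<le> S"
  shows "\<exists>h w. (\<forall>n::nat. 0 \<le> w n) \<and>
    (\<forall>n x. (\<forall>k<n. cinner x (h k) = 0) \<longrightarrow> q x \<le> w n * norm x) \<and>
    (\<forall>N. (\<Sum>n<N. (w n)\<^sup>2) \<le> 4 * S)"
proof -
  have q0: "q 0 = 0" using scale[of 0 0] by simp
  let ?good = "\<lambda>f (n::nat) r. norm r \<le> 1 \<and> (\<forall>k<n. cinner r (f k) = 0) \<and>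
    (\<forall>y. norm y \<le> 1 \<longrightarrow> (\<forall>k<n. cinner y (f k) = 0) \<longrightarrow> q y \<le> 2 * q r)"
  have q_le: "q y \<le> sqrt S" if "norm y \<le> 1" for y
  proof -
    have "(q y)\<^sup>2 \<le> S"
      using bound[of 1 "\<lambda>_. y"] that by (simp add: suborthonormal_on_def)
    then show ?thesis by (simp add: real_le_rsqrt)
  qed
  have ex: "\<exists>r. ?good f n r" for f n
  proof -
    define D where "D = {y. norm y \<le> 1 \<and> (\<forall>k<n. cinner y (f k) = 0)}"
    have D0: "0 \<in> D" by (simp add: D_def)
    have bdd: "bdd_above (q ` D)" by (rule bdd_aboveI2[where M = "sqrt S"]) (simp add: D_def q_le)
    define m where "m = (SUP y\<in>D. q y)"
    have upper: "q y \<le> m" if "y \<in> D" for y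
      unfolding m_def by (rule cSUP_upper[OF that bdd])
    show ?thesis
    \<comment> \<open>For m \<le> 0 the vector 0 will do; otherwise m / 2 < m, which is the origin
      of the factor 2.\<close>
    proof (cases "m \<le> 0")
      case True
      then have "?good f n 0" using upper order_trans by (fastforce simp: D_def q0)
      then show ?thesis by blast
    next
      case False
      then have "m / 2 < m" by simp
      then obtain r where r: "r \<in> D" "m / 2 < q r"
        unfolding m_def using less_cSUP_iff[OF _ bdd] D0 by blast
      have "q y \<le> 2 * q r" if "y \<in> D" for y
        using upper[OF that] r(2) by simp
      then have "?good f n r" using r(1) by (simp add: D_def)
      then show ?thesis by blast
    qed
  qed
  have "\<exists>f. \<forall>n. ?good f n (f n)"
    by (rule dependent_wellorder_choice[where P = ?good]) (use ex in auto)
  then obtain h where h: "\<And>n. ?good h n (h n)" by blast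
  have "q x \<le> 2 * q (h n) * norm x" if x: "\<forall>k<n. cinner x (h k) = 0" for n x
  proof (cases "x = 0")
    case True
    then show ?thesis by (simp add: q0)
  next
    case False
    have "q (complex_of_real (1 / norm x) *\<^sub>C x) \<le> 2 * q (h n)"
      using h[of n] x False by (auto simp: norm_scaleC norm_divide cinner_scaleC_left)
    then show ?thesis using False by (simp add: scale norm_divide divide_le_eq)
  qed
  moreover have "(\<Sum>n<N. (2 * q (h n))\<^sup>2) \<le> 4 * S" for N
  proof -
    have "suborthonormal_on {..<N} h"
      unfolding suborthonormal_on_def
    proof (intro conjI ballI impI)
      fix i j :: nat assume "i \<noteq> j"
      then consider "i < j" | "j < i" by linarith
      then show "cinner (h i) (h j) = 0"
        using h[of i] h[of j] cinner_eq_zero_commute by cases blast+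
    qed (use h in blast)
    from bound[OF this] show ?thesis by (simp add: power_mult_distrib flip: sum_distrib_left)
  qed
  ultimately show ?thesis
    using nonneg by (intro exI[of _ h] exI[of _ "\<lambda>n. 2 * q (h n)"]) auto
qed

text \<open>Gaussian elimination: with a pivot \<open>c i \<noteq> 0\<close>, every other
  \<open>c'\<close> is replaced by \<open>e c'\<close>, which vanishes at i; the smaller system is
  solved on \<open>F - {i}\<close>, and the pivot equation determines \<open>y i\<close>. Equations
  may merge under elimination, which only lowers their number.\<close>

lemma homogeneous_system_solution:
  fixes J :: "('i \<Rightarrow> 'k::field) set"
  assumes "finite J" "finite F" "card J < card F"
  shows "\<exists>x. (\<exists>i\<in>F. x i \<noteq> 0) \<and> (\<forall>c\<in>J. (\<Sum>i\<in>F. x i * c i) = 0)"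
  using assms
proof (induction J arbitrary: F rule: measure_induct_rule[of card])
  case (less J)
  show ?case
  proof (cases "\<exists>c\<in>J. \<exists>i\<in>F. c i \<noteq> 0")
    case False
    moreover have "F \<noteq> {}" using less.prems by auto
    ultimately show ?thesis by (intro exI[of _ "\<lambda>_. 1"]) auto
  next
    case True
    then obtain c i where c: "c \<in> J" "i \<in> F" "c i \<noteq> 0" by blast
    define e where "e c' = (\<lambda>j. c' j - c' i / c i * c j)" for c'
    let ?K = "e ` (J - {c})"
    have J: "card (J - {c}) < card J" using c(1) less.prems(1) by (intro psubset_card_mono) auto
    have K: "card ?K \<le> card (J - {c})" using less.prems(1) by (intro card_image_le) simp
    have "\<exists>x. (\<exists>j\<in>F - {i}. x j \<noteq> 0) \<and> (\<forall>c\<in>?K. (\<Sum>j\<in>F - {i}. x j * c j) = 0)"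
    proof (rule less.IH)
      show "card ?K < card J" using J K by simp
      show "card ?K < card (F - {i})"
        using K J less.prems(3) c(2) by (simp add: card_Diff_singleton)
    qed (use less.prems in auto)
    then obtain x where x: "\<exists>j\<in>F - {i}. x j \<noteq> 0"
      and eq: "\<And>c'. c' \<in> J - {c} \<Longrightarrow> (\<Sum>j\<in>F - {i}. x j * e c' j) = 0" by blast
    define y where "y = x(i := - (\<Sum>j\<in>F - {i}. x j * c j) / c i)"
    have y_sum: "(\<Sum>j\<in>F. y j * c' j) = y i * c' i + (\<Sum>j\<in>F - {i}. x j * c' j)" for c'
    proof -
      have "(\<Sum>j\<in>F - {i}. y j * c' j) = (\<Sum>j\<in>F - {i}. x j * c' j)"
        by (intro sum.cong) (auto simp: y_def)
      then show ?thesis using c(2) less.prems(2) by (simp add: sum.remove)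
    qed
    have c0: "(\<Sum>j\<in>F. y j * c j) = 0" unfolding y_sum using c(3) by (simp add: y_def)
    have "(\<Sum>j\<in>F. y j * c' j) = 0" if c': "c' \<in> J" for c'
    proof (cases "c' = c")
      case True
      then show ?thesis using c0 by simp
    next
      case False
      have "(\<Sum>j\<in>F. y j * c' j) - c' i / c i * (\<Sum>j\<in>F. y j * c j) = (\<Sum>j\<in>F. y j * e c' j)"
        by (simp add: e_def right_diff_distrib sum_subtractf sum_distrib_left mult_ac)
      also have "\<dots> = 0"
        unfolding y_sum using eq[of c'] False c' c(3) by (simp add: e_def)
      finally show ?thesis using c0 by simp
    qed
    moreover have "\<exists>j\<in>F. y j \<noteq> 0" using x by (auto simp: y_def)
    ultimately show ?thesis by blast
  qed
qed

text \<open>Some nontrivial combination of the more than \<open>3 * n\<close> vectors \<open>a \<gamma>\<close> satisfies the \<open>3 * n\<close>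
  linear conditions under which all three factors are small.\<close>

lemma diagonal_min_bound:
  fixes U :: "'h::complex_hilbert \<Rightarrow> 'h" and a :: "'i \<Rightarrow> 'h" and \<psi> :: "'i \<Rightarrow> 'h \<Rightarrow> complex"
  assumes F: "finite F" "3 * n < card F"
    and U: "bounded_clinear U"
    and \<psi>: "\<And>\<gamma>. \<gamma> \<in> F \<Longrightarrow> bounded_clinear (\<psi> \<gamma>)"
    and diag: "\<And>\<gamma> \<gamma>'. \<gamma> \<in> F \<Longrightarrow> \<gamma>' \<in> F \<Longrightarrow> \<psi> \<gamma>' (U (a \<gamma>)) = (if \<gamma> = \<gamma>' then d \<gamma> else 0)"
    and nonneg: "0 \<le> w" "0 \<le> u" "0 \<le> v"
    and w: "\<And>x. (\<forall>k<n. cinner x (h k) = 0) \<Longrightarrow> L2_set (\<lambda>\<gamma>. cmod (cinner x (a \<gamma>))) F \<le> w * norm x"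
    and v: "\<And>x. (\<forall>k<n. cinner x (g k) = 0) \<Longrightarrow> L2_set (\<lambda>\<gamma>. cmod (\<psi> \<gamma> x)) F \<le> v * norm x"
    and B: "finite B" "card B \<le> n"
    and u: "\<And>x. (\<forall>b\<in>B. cinner x b = 0) \<Longrightarrow> norm (U x) \<le> u * norm x"
  shows "\<exists>\<gamma>\<in>F. cmod (d \<gamma>) \<le> w * u * v"
proof (rule ccontr)
  assume "\<not> ?thesis"
  then have big: "w * u * v < cmod (d \<gamma>)" if "\<gamma> \<in> F" for \<gamma>
    using that by force
  \<comment> \<open>One group of at most n conditions per factor: y orthogonal to the
    \<open>h k\<close>, y orthogonal to \<open>B\<close>, and \<open>U y\<close> orthogonal to the
    \<open>g k\<close>.\<close>
  define J where "J = (\<lambda>k \<gamma>. cinner (a \<gamma>) (h k)) ` {..<n} \<union> (\<lambda>b \<gamma>. cinner (a \<gamma>) b) ` B \<union>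
    (\<lambda>k \<gamma>. cinner (U (a \<gamma>)) (g k)) ` {..<n}"
  have "card ((\<lambda>k \<gamma>. cinner (a \<gamma>) (h k)) ` {..<n}) \<le> n"
    "card ((\<lambda>k \<gamma>. cinner (U (a \<gamma>)) (g k)) ` {..<n}) \<le> n"
    using card_image_le[OF finite_lessThan[of n]] by (metis card_lessThan)+
  moreover have "card ((\<lambda>b \<gamma>. cinner (a \<gamma>) b) ` B) \<le> n"
    using card_image_le[OF B(1)] B(2) order_trans by blast
  ultimately have "card J \<le> n + n + n"
    unfolding J_def by (intro card_Un_le[THEN order_trans] add_mono)
  then have "card J < card F" using F(2) by simp
  moreover have "finite J" using B(1) by (simp add: J_def)
  ultimately obtain x where x: "\<exists>\<gamma>\<in>F. x \<gamma> \<noteq> 0" and eq: "\<And>c. c \<in> J \<Longrightarrow> (\<Sum>\<gamma>\<in>F. x \<gamma> * c \<gamma>) = 0"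
    using homogeneous_system_solution[of J F] F(1) by blast
  define y where "y = (\<Sum>\<gamma>\<in>F. x \<gamma> *\<^sub>C a \<gamma>)"
  let ?L = "L2_set (\<lambda>\<gamma>. cmod (x \<gamma>)) F"
  have Uy: "U y = (\<Sum>\<gamma>\<in>F. x \<gamma> *\<^sub>C U (a \<gamma>))"
    unfolding y_def by (rule bounded_clinear_sum_scaleC[OF U])
  have "cinner y (h k) = 0" if "k < n" for k
    using eq[of "\<lambda>\<gamma>. cinner (a \<gamma>) (h k)"] that
    by (simp add: J_def y_def cinner_sum_left cinner_scaleC_left)
  then have 1: "L2_set (\<lambda>\<gamma>. cmod (cinner y (a \<gamma>))) F \<le> w * norm y" by (intro w) blast
  have "cinner y b = 0" if "b \<in> B" for b
    using eq[of "\<lambda>\<gamma>. cinner (a \<gamma>) b"] that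
    by (simp add: J_def y_def cinner_sum_left cinner_scaleC_left)
  then have 2: "norm (U y) \<le> u * norm y" by (intro u) blast
  have "cinner (U y) (g k) = 0" if "k < n" for k
    using eq[of "\<lambda>\<gamma>. cinner (U (a \<gamma>)) (g k)"] that
    by (simp add: J_def Uy cinner_sum_left cinner_scaleC_left)
  then have 3: "L2_set (\<lambda>\<gamma>. cmod (\<psi> \<gamma> (U y))) F \<le> v * norm (U y)" by (intro v) blast
  \<comment> \<open>\<open>w\<close> bounds the inner products of y with the
    \<open>a \<gamma>\<close>; expanding one copy of y in \<open>cinner y y\<close> turns this into
    a bound of y by its own coefficients.\<close>
  have y: "norm y \<le> w * ?L"
  proof (cases "y = 0")
    case False
    have "(norm y)\<^sup>2 = cmod (cinner y y)" by (simp add: cinner_self norm_power)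
    also have "\<dots> = cmod (\<Sum>\<gamma>\<in>F. cnj (x \<gamma>) * cinner y (a \<gamma>))"
      by (subst (2) y_def) (simp add: cinner_sum_right cinner_scaleC_right)
    also have "\<dots> \<le> (\<Sum>\<gamma>\<in>F. \<bar>cmod (x \<gamma>)\<bar> * \<bar>cmod (cinner y (a \<gamma>))\<bar>)"
      by (rule sum_norm_le) (simp add: norm_mult)
    also have "\<dots> \<le> ?L * L2_set (\<lambda>\<gamma>. cmod (cinner y (a \<gamma>))) F" by (rule L2_set_mult_ineq)
    also have "\<dots> \<le> ?L * (w * norm y)" by (intro mult_left_mono 1 L2_set_nonneg)
    finally show ?thesis using False by (simp add: power2_eq_square mult_ac)
  qed (simp add: nonneg L2_set_nonneg)
  have \<psi>y: "\<psi> \<gamma> (U y) = x \<gamma> * d \<gamma>" if \<gamma>: "\<gamma> \<in> F" for \<gamma>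
  proof -
    have "\<psi> \<gamma> (U y) = (\<Sum>\<gamma>'\<in>F. x \<gamma>' * \<psi> \<gamma> (U (a \<gamma>')))"
      unfolding Uy bounded_clinear_sum_scaleC[OF \<psi>[OF \<gamma>]] scaleC_complex_def ..
    also have "\<dots> = (\<Sum>\<gamma>'\<in>F. if \<gamma>' = \<gamma> then x \<gamma>' * d \<gamma>' else 0)"
      using \<gamma> by (intro sum.cong) (auto simp: diag)
    finally show ?thesis using F(1) \<gamma> by simp
  qed
  \<comment> \<open>By diagonality the l2 norm of \<open>x \<gamma> * d \<gamma>\<close> is at most
    \<open>w * u * v\<close> times that of x, although every entry of \<open>d\<close> exceeds
    \<open>w * u * v\<close> in modulus and x is nonzero somewhere on \<open>F\<close>.\<close>
  have "L2_set (\<lambda>\<gamma>. cmod (x \<gamma>) * cmod (d \<gamma>)) F = L2_set (\<lambda>\<gamma>. cmod (\<psi> \<gamma> (U y))) F"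
    by (intro L2_set_cong) (simp_all add: \<psi>y norm_mult)
  also have "\<dots> \<le> v * (u * (w * ?L))"
    using 3 mult_left_mono[OF 2 nonneg(3)] mult_left_mono[OF mult_left_mono[OF y nonneg(2)] nonneg(3)]
    by linarith
  also have "\<dots> = L2_set (\<lambda>\<gamma>. w * u * v * cmod (x \<gamma>)) F"
    using nonneg by (simp add: L2_set_right_distrib mult_ac)
  finally have "(\<Sum>\<gamma>\<in>F. (cmod (x \<gamma>) * cmod (d \<gamma>))\<^sup>2) \<le> (\<Sum>\<gamma>\<in>F. (w * u * v * cmod (x \<gamma>))\<^sup>2)"
    by (simp add: L2_set_def)
  moreover have "(\<Sum>\<gamma>\<in>F. (w * u * v * cmod (x \<gamma>))\<^sup>2) < (\<Sum>\<gamma>\<in>F. (cmod (x \<gamma>) * cmod (d \<gamma>))\<^sup>2)"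
  proof (rule sum_strict_mono_ex1[OF F(1)])
    have "w * u * v * cmod (x \<gamma>) \<le> cmod (x \<gamma>) * cmod (d \<gamma>)" if "\<gamma> \<in> F" for \<gamma>
      using mult_right_mono[OF less_imp_le[OF big[OF that]], of "cmod (x \<gamma>)"] by (simp add: mult_ac)
    then show "\<forall>\<gamma>\<in>F. (w * u * v * cmod (x \<gamma>))\<^sup>2 \<le> (cmod (x \<gamma>) * cmod (d \<gamma>))\<^sup>2"
      using nonneg by (intro ballI power_mono) auto
    obtain \<gamma> where \<gamma>: "\<gamma> \<in> F" "x \<gamma> \<noteq> 0" using x by blast
    have "w * u * v * cmod (x \<gamma>) < cmod (x \<gamma>) * cmod (d \<gamma>)"
      using mult_strict_right_mono[OF big[OF \<gamma>(1)], of "cmod (x \<gamma>)"] \<gamma>(2) by (simp add: mult_ac)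
    then have "(w * u * v * cmod (x \<gamma>))\<^sup>2 < (cmod (x \<gamma>) * cmod (d \<gamma>))\<^sup>2"
      using nonneg by (intro power_strict_mono) auto
    then show "\<exists>\<gamma>\<in>F. (w * u * v * cmod (x \<gamma>))\<^sup>2 < (cmod (x \<gamma>) * cmod (d \<gamma>))\<^sup>2"
      using \<gamma>(1) by blast
  qed
  ultimately show False by simp
qed

text \<open>Delete one small entry at a time: among \<open>Suc N\<close> indices some entry is at
  most \<open>\<tau> (N div 3)\<close>, since 3 * (N div 3) \<le> N. Each \<open>\<tau> n\<close> is
  used at most three times, hence the factor 3.\<close>

lemma sum_le_of_min_bound:
  fixes d :: "'i \<Rightarrow> real"
  assumes F: "finite F"
    and \<tau>: "\<And>n. 0 \<le> \<tau> n"
    and min: "\<And>F' n. F' \<subseteq> F \<Longrightarrow> 3 * n < card F' \<Longrightarrow> \<exists>\<gamma>\<in>F'. d \<gamma> \<le> \<tau> n"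
  shows "sum d F \<le> 3 * (\<Sum>n<card F. \<tau> n)"
proof -
  have "sum d F' \<le> (\<Sum>k<N. \<tau> (k div 3))" if "F' \<subseteq> F" "card F' = N" for F' N
    using that
  proof (induction N arbitrary: F')
    case 0
    then show ?case using finite_subset[OF _ F] by fastforce
  next
    case (Suc N)
    have fin: "finite F'" using Suc.prems F finite_subset by blast
    have "3 * (N div 3) < card F'" using Suc.prems(2) by simp
    from min[OF Suc.prems(1) this] obtain \<gamma> where \<gamma>: "\<gamma> \<in> F'" "d \<gamma> \<le> \<tau> (N div 3)" by blast
    have "sum d (F' - {\<gamma>}) \<le> (\<Sum>k<N. \<tau> (k div 3))"
      using Suc \<gamma>(1) fin by (intro Suc.IH) auto
    then show ?case using \<gamma> fin by (simp add: sum.remove)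
  qed
  then have "sum d F \<le> (\<Sum>k<card F. \<tau> (k div 3))" by blast
  also have "\<dots> \<le> (\<Sum>k<3 * card F. \<tau> (k div 3))"
    by (intro sum_mono2) (auto simp: \<tau>)
  also have "\<dots> = 3 * (\<Sum>n<card F. \<tau> n)"
  proof -
    have "(\<Sum>k<3 * N. \<tau> (k div 3)) = 3 * (\<Sum>n<N. \<tau> n)" for N
    proof (induction N)
      case (Suc N)
      have "3 * Suc N = Suc (Suc (Suc (3 * N)))" by simp
      moreover have "Suc (3 * N) div 3 = N" "Suc (Suc (3 * N)) div 3 = N" by presburger+
      ultimately show ?case using Suc by (simp del: mult_Suc_right)
    qed simp
    then show ?thesis .
  qed
  finally show ?thesis .
qed

text \<open>The hypothesis \<open>young\<close> hides the exponent r, so that finite and infinite r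
  are treated alike. Greedy sequences for the two square-sum seminorms supply \<open>w\<close> and
  \<open>v\<close>. In the constant, 3 comes from the deletion argument, and 2 * c is the 4 of the
  greedy choice times the c / 2 left by the estimate of w * v by half the sum of squares.\<close>

lemma diagonal_powr_sum_bound:
  fixes U :: "'h::complex_hilbert \<Rightarrow> 'h" and a :: "'i \<Rightarrow> 'h" and \<psi> :: "'i \<Rightarrow> 'h \<Rightarrow> complex"
  assumes s: "0 < s" and F: "finite F"
    and U: "bounded_clinear U"
    and \<psi>: "\<And>\<gamma>. \<gamma> \<in> F \<Longrightarrow> bounded_clinear (\<psi> \<gamma>)"
    and diag: "\<And>\<gamma> \<gamma>'. \<gamma> \<in> F \<Longrightarrow> \<gamma>' \<in> F \<Longrightarrow> \<psi> \<gamma>' (U (a \<gamma>)) = (if \<gamma> = \<gamma>' then d \<gamma> else 0)"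
    and a: "(\<Sum>\<gamma>\<in>F. (norm (a \<gamma>))\<^sup>2) \<le> \<alpha>"
    and \<psi>_bound: "\<And>(N::nat) h. suborthonormal_on {..<N} h \<Longrightarrow>
      (\<Sum>n<N. \<Sum>\<gamma>\<in>F. (cmod (\<psi> \<gamma> (h n)))\<^sup>2) \<le> \<beta>"
    and \<sigma>: "\<And>n. 0 \<le> \<sigma> n"
    and U_bound: "\<And>n. \<exists>B. finite B \<and> card B \<le> n \<and>
      (\<forall>x. (\<forall>b\<in>B. cinner x b = 0) \<longrightarrow> norm (U x) \<le> \<sigma> n * norm x)"
    and c: "0 \<le> c"
    and young: "\<And>n p. 0 \<le> p \<Longrightarrow> (p * \<sigma> n) powr s \<le> c * p + e n"
    and e: "\<And>N::nat. (\<Sum>n<N. e n) \<le> R"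
  shows "(\<Sum>\<gamma>\<in>F. cmod (d \<gamma>) powr s) \<le> 3 * (2 * c * (\<alpha> + \<beta>) + R)"
proof -
  let ?qa = "\<lambda>x. L2_set (\<lambda>\<gamma>. cmod (cinner x (a \<gamma>))) F"
  let ?q\<psi> = "\<lambda>x. L2_set (\<lambda>\<gamma>. cmod (\<psi> \<gamma> x)) F"
  have sq: "(L2_set f F)\<^sup>2 = (\<Sum>\<gamma>\<in>F. (f \<gamma>)\<^sup>2)" for f
    unfolding L2_set_def by (simp add: sum_nonneg)
  have "(\<Sum>n<N. (?qa (h n))\<^sup>2) \<le> \<alpha>" if "suborthonormal_on {..<N} h" for N :: nat and h
  proof -
    have "(\<Sum>n<N. (?qa (h n))\<^sup>2) = (\<Sum>\<gamma>\<in>F. \<Sum>n<N. (cmod (cinner (a \<gamma>) (h n)))\<^sup>2)"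
      unfolding sq by (subst sum.swap) (simp only: cmod_cinner_commute[of "a _"])
    also have "\<dots> \<le> (\<Sum>\<gamma>\<in>F. (norm (a \<gamma>))\<^sup>2)"
      by (intro sum_mono bessel that) simp
    finally show ?thesis using a by simp
  qed
  moreover have "?qa (c *\<^sub>C x) = cmod c * ?qa x" for c x
    by (simp add: cinner_scaleC_left norm_mult L2_set_right_distrib)
  ultimately obtain h w where w: "\<And>n::nat. 0 \<le> w n"
      "\<And>n x. (\<forall>k<n. cinner x (h k) = 0) \<Longrightarrow> ?qa x \<le> w n * norm x"
      "\<And>N. (\<Sum>n<N. (w n)\<^sup>2) \<le> 4 * \<alpha>"
    using greedy_orthogonal_sequence[of ?qa \<alpha>] L2_set_nonneg by metis
  have "(\<Sum>n<N. (?q\<psi> (h n))\<^sup>2) \<le> \<beta>" if "suborthonormal_on {..<N} h" for N :: nat and h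
    unfolding sq by (rule \<psi>_bound[OF that])
  moreover have "?q\<psi> (c *\<^sub>C x) = cmod c * ?q\<psi> x" for c x
  proof -
    have "?q\<psi> (c *\<^sub>C x) = L2_set (\<lambda>\<gamma>. cmod c * cmod (\<psi> \<gamma> x)) F"
      using \<psi> by (intro L2_set_cong) (auto simp: bounded_clinearD(2) scaleC_complex_def norm_mult)
    then show ?thesis by (simp add: L2_set_right_distrib)
  qed
  ultimately obtain g v where v: "\<And>n::nat. 0 \<le> v n"
      "\<And>n x. (\<forall>k<n. cinner x (g k) = 0) \<Longrightarrow> ?q\<psi> x \<le> v n * norm x"
      "\<And>N. (\<Sum>n<N. (v n)\<^sup>2) \<le> 4 * \<beta>"
    using greedy_orthogonal_sequence[of ?q\<psi> \<beta>] L2_set_nonneg by metis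
  have "\<exists>\<gamma>\<in>F'. cmod (d \<gamma>) powr s \<le> (w n * \<sigma> n * v n) powr s"
    if F': "F' \<subseteq> F" "3 * n < card F'" for F' n
  proof -
    obtain B where B: "finite B" "card B \<le> n"
      "\<And>x. (\<forall>b\<in>B. cinner x b = 0) \<Longrightarrow> norm (U x) \<le> \<sigma> n * norm x"
      using U_bound[of n] by blast
    \<comment> \<open>Restriction to \<open>F'\<close> only lowers the seminorms, so sequences
      chosen once for \<open>F\<close> serve every subset.\<close>
    have mono: "L2_set f F' \<le> L2_set f F" for f
      unfolding L2_set_def using F' F by (intro real_sqrt_le_mono sum_mono2) auto
    have "\<exists>\<gamma>\<in>F'. cmod (d \<gamma>) \<le> w n * \<sigma> n * v n"
    proof (rule diagonal_min_bound[OF _ F'(2) U])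
      show "finite F'" using F F'(1) finite_subset by blast
      show "bounded_clinear (\<psi> \<gamma>)" if "\<gamma> \<in> F'" for \<gamma> using that F'(1) \<psi> by blast
      show "\<psi> \<gamma>' (U (a \<gamma>)) = (if \<gamma> = \<gamma>' then d \<gamma> else 0)" if "\<gamma> \<in> F'" "\<gamma>' \<in> F'" for \<gamma> \<gamma>'
        using that F'(1) by (intro diag) blast+
      show "L2_set (\<lambda>\<gamma>. cmod (cinner x (a \<gamma>))) F' \<le> w n * norm x"
        if "\<forall>k<n. cinner x (h k) = 0" for x
        by (rule order_trans[OF mono w(2)[OF that]])
      show "L2_set (\<lambda>\<gamma>. cmod (\<psi> \<gamma> x)) F' \<le> v n * norm x"
        if "\<forall>k<n. cinner x (g k) = 0" for x
        by (rule order_trans[OF mono v(2)[OF that]])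
    qed (fact w(1) v(1) \<sigma> B)+
    then show ?thesis using s by (meson norm_ge_zero order_less_imp_le powr_mono2)
  qed
  from sum_le_of_min_bound[OF F _ this]
  have "(\<Sum>\<gamma>\<in>F. cmod (d \<gamma>) powr s) \<le> 3 * (\<Sum>n<card F. (w n * \<sigma> n * v n) powr s)"
    by simp
  also have "\<dots> \<le> 3 * (\<Sum>n<card F. c / 2 * (w n)\<^sup>2 + c / 2 * (v n)\<^sup>2 + e n)"
  proof (intro mult_left_mono sum_mono)
    fix n
    have "(w n * \<sigma> n * v n) powr s \<le> c * (w n * v n) + e n"
      using young[of "w n * v n" n] w(1) v(1) by (simp add: mult_ac)
    also have "c * (w n * v n) \<le> c * (((w n)\<^sup>2 + (v n)\<^sup>2) / 2)"
      using sum_squares_bound[of "w n" "v n"] by (intro mult_left_mono c) simp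
    finally show "(w n * \<sigma> n * v n) powr s \<le> c / 2 * (w n)\<^sup>2 + c / 2 * (v n)\<^sup>2 + e n"
      by (simp add: algebra_simps add_divide_distrib)
  qed simp
  also have "\<dots> = 3 * (c / 2 * (\<Sum>n<card F. (w n)\<^sup>2) + c / 2 * (\<Sum>n<card F. (v n)\<^sup>2) + (\<Sum>n<card F. e n))"
    by (simp add: sum.distrib sum_distrib_left)
  also have "\<dots> \<le> 3 * (c / 2 * (4 * \<alpha>) + c / 2 * (4 * \<beta>) + R)"
    using c by (intro mult_left_mono add_mono w(3) v(3) e) auto
  finally show ?thesis by (simp add: algebra_simps)
qed

section \<open>Measures with bounded densities\<close>

lemma norm_cmeasure_eq_variation: "norm \<mu> = variation (cmeas \<mu>) UNIV"
  by (rule norm_cmeasure_def)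

lemma cmeas_sum: "cmeas (sum f I) E = (\<Sum>i\<in>I. cmeas (f i) E)"
  by (induction I rule: infinite_finite_induct) simp_all

lemma bounded_bilinear_scaleC:
  "bounded_bilinear (scaleC :: complex \<Rightarrow> 'x::complex_normed_vector \<Rightarrow> 'x)"
  by standard
    (auto simp: scaleC_add_left scaleC_add_right scaleR_scaleC scaleC_scaleC norm_scaleC
      scaleC_complex_def mult.commute intro!: exI[of _ 1])

lemmas continuous_on_scaleC = bounded_bilinear.continuous_on[OF bounded_bilinear_scaleC]

text \<open>Large enough for the characters and their simple approximants; on a finite measure all
  of these are integrable.\<close>

definition bounded_borel :: "('g::topological_space \<Rightarrow> complex) \<Rightarrow> bool" where
  "bounded_borel g \<longleftrightarrow> g \<in> borel_measurable borel \<and> (\<exists>C. \<forall>t. cmod (g t) \<le> C)"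

lemma bounded_borel_diff:
  assumes "bounded_borel f" "bounded_borel g"
  shows "bounded_borel (\<lambda>t. f t - g t)"
proof -
  obtain C D where "\<And>t. cmod (f t) \<le> C" "\<And>t. cmod (g t) \<le> D"
    using assms unfolding bounded_borel_def by blast
  then have "cmod (f t - g t) \<le> C + D" for t
    by (meson add_mono norm_triangle_ineq4 order_trans)
  then show ?thesis using assms by (auto simp: bounded_borel_def)
qed

lemma bounded_borel_indicator: "E \<in> sets borel \<Longrightarrow> bounded_borel (indicator E)"
  unfolding bounded_borel_def by (auto intro!: exI[of _ 1] simp: indicator_def)

lemma bounded_borel_simple:
  assumes "simple_function borel S"
  shows "bounded_borel S"
proof -
  have "finite (range S)" using assms by (simp add: simple_function_def)
  then have "bounded (range S)" by (rule finite_imp_bounded)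
  then show ?thesis
    using borel_measurable_simple_function[OF assms] by (auto simp: bounded_borel_def bounded_iff)
qed

locale compact_haar =
  fixes m :: "'g::{topological_ab_group_add, t2_space} measure"
  assumes compact_UNIV: "compact (UNIV :: 'g set)"
    and haar: "normalized_haar m"
begin

lemma sets_m [measurable_cong, simp]: "sets m = sets borel"
  using haar unfolding normalized_haar_def by blast

lemma space_m [simp]: "space m = UNIV"
  using sets_eq_imp_space_eq[OF sets_m] by simp

lemma emeasure_UNIV [simp]: "emeasure m UNIV = 1"
  using haar unfolding normalized_haar_def by blast

lemma emeasure_translate: "E \<in> sets borel \<Longrightarrow> emeasure m ((+) a ` E) = emeasure m E"
  using haar unfolding normalized_haar_def by blast

sublocale finite_measure m
  by (rule finite_measureI) simp

lemma measure_UNIV [simp]: "measure m UNIV = 1"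
  by (simp add: measure_def)

lemma borel_measurable_m [simp]: "borel_measurable m = borel_measurable borel"
  by (rule measurable_cong_sets) simp_all

lemma integrable_bounded_borel: "bounded_borel g \<Longrightarrow> integrable m g"
  unfolding bounded_borel_def by (auto intro!: integrable_const_bound)

lemma continuous_bounded:
  fixes f :: "'g \<Rightarrow> 'b::real_normed_vector"
  assumes "continuous_on UNIV f"
  shows "\<exists>C. \<forall>t. norm (f t) \<le> C"
  using compact_imp_bounded[OF compact_continuous_image[OF assms compact_UNIV]]
  by (auto simp: bounded_iff)

lemma bounded_borel_continuous: "continuous_on UNIV g \<Longrightarrow> bounded_borel (g :: 'g \<Rightarrow> complex)"
  using continuous_bounded[of g] by (auto simp: bounded_borel_def borel_measurable_continuous_onI)

lemma integrable_continuous: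
  fixes f :: "'g \<Rightarrow> 'b::{banach, second_countable_topology}"
  assumes "continuous_on UNIV f"
  shows "integrable m f"
proof -
  obtain C where "\<And>t. norm (f t) \<le> C" using continuous_bounded[OF assms] by blast
  then show ?thesis
    using assms by (intro integrable_const_bound[of _ C]) (auto intro: borel_measurable_continuous_onI)
qed

lemma norm_integral_le:
  fixes f :: "'g \<Rightarrow> 'b::{banach, second_countable_topology}"
  assumes "integrable m f" "\<And>t. norm (f t) \<le> C"
  shows "norm (\<integral>t. f t \<partial>m) \<le> C"
proof -
  have "norm (\<integral>t. f t \<partial>m) \<le> (\<integral>t. norm (f t) \<partial>m)" by (rule integral_norm_bound)
  also have "\<dots> \<le> (\<integral>t. C \<partial>m)" using assms by (intro integral_mono) auto
  finally show ?thesis by simp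
qed

lemma integral_translate:
  fixes f :: "'g \<Rightarrow> 'b::{banach, second_countable_topology}"
  assumes "f \<in> borel_measurable borel"
  shows "(\<integral>t. f (a + t) \<partial>m) = (\<integral>t. f t \<partial>m)"
proof -
  have cont: "continuous_on UNIV ((+) a)" by (intro continuous_intros)
  have meas: "(+) a \<in> measurable m borel"
    using borel_measurable_continuous_onI[OF cont] by simp
  have "distr m borel ((+) a) = m"
  proof (rule measure_eqI)
    fix E assume E: "E \<in> sets (distr m borel ((+) a))"
    have "(+) a -` E = (+) (- a) ` E"
    proof (intro equalityI subsetI)
      fix t assume "t \<in> (+) a -` E"
      then show "t \<in> (+) (- a) ` E" by (intro image_eqI[of _ _ "a + t"]) auto
    qed auto
    then show "emeasure (distr m borel ((+) a)) E = emeasure m E"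
      using E emeasure_translate[of E "- a"] by (simp add: emeasure_distr[OF meas])
  qed simp
  then show ?thesis using integral_distr[OF meas assms] by simp
qed

text \<open>The value 0 off the Borel sets is the normalization in
  \<open>regular_complex_measures\<close>. For a character g this is the measure to which
  \<open>A\<close> will be applied.\<close>

definition density_cmeasure :: "('g \<Rightarrow> complex) \<Rightarrow> 'g cmeasure" where
  "density_cmeasure g =
     Abs_cmeasure (\<lambda>E. if E \<in> sets borel then LINT t:E|m. g t else 0)"

lemma set_integrable_bounded_borel:
  "bounded_borel g \<Longrightarrow> E \<in> sets borel \<Longrightarrow> set_integrable m E g"
  unfolding set_integrable_def by (intro integrable_mult_indicator integrable_bounded_borel) auto

text \<open>The common source of the regularity of density measures and of their norm bound by the
  L1 norm.\<close>

lemma borel_families_set_integral_le: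
  assumes g: "bounded_borel g" and P: "P \<in> borel_families E" and E: "E \<in> sets borel"
  shows "(\<Sum>F\<in>P. cmod (LINT t:F|m. g t)) \<le> (LINT t:E|m. cmod (g t))"
proof -
  have P': "finite P" "disjoint_family_on (\<lambda>F. F) P" "\<And>F. F \<in> P \<Longrightarrow> F \<in> sets borel" "\<Union>P \<subseteq> E"
    using P by (auto simp: borel_families_def disjoint_family_on_def disjoint_def)
  have int: "set_integrable m F (\<lambda>t. cmod (g t))" if "F \<in> sets borel" for F
    using integrable_norm[OF integrable_bounded_borel[OF g]] that unfolding set_integrable_def
    by (intro integrable_mult_indicator) auto
  have "cmod (LINT t:F|m. g t) \<le> (LINT t:F|m. cmod (g t))" if "F \<in> P" for F
    unfolding set_lebesgue_integral_def
    using integral_norm_bound[of m "\<lambda>t. indicator F t *\<^sub>R g t"] by simp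
  then have "(\<Sum>F\<in>P. cmod (LINT t:F|m. g t)) \<le> (\<Sum>F\<in>P. LINT t:F|m. cmod (g t))"
    by (rule sum_mono)
  also have "\<dots> = (LINT t:(\<Union>F\<in>P. F)|m. cmod (g t))"
    by (rule set_integral_finite_Union[symmetric]) (use P' int in auto)
  also have "\<dots> \<le> (LINT t:E|m. cmod (g t))"
    unfolding set_lebesgue_integral_def
  proof (rule integral_mono)
    have "(\<Union>F\<in>P. F) \<in> sets borel" using P' by (intro sets.finite_UN) auto
    then show "integrable m (\<lambda>t. indicator (\<Union>F\<in>P. F) t *\<^sub>R cmod (g t))"
      "integrable m (\<lambda>t. indicator E t *\<^sub>R cmod (g t))"
      using int E unfolding set_integrable_def by blast+
  qed (use P'(4) in \<open>auto simp: indicator_def\<close>)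
  finally show ?thesis .
qed

text \<open>The variation on E is at most \<open>C * measure m E\<close>, so finite variation and
  regularity are inherited from the Haar measure.\<close>

lemma density_in_regular_complex_measures:
  assumes g: "bounded_borel g"
  shows "(\<lambda>E. if E \<in> sets borel then LINT t:E|m. g t else 0) \<in> regular_complex_measures"
    (is "?\<mu> \<in> _")
proof -
  obtain C where C: "\<And>t. cmod (g t) \<le> C" using g by (auto simp: bounded_borel_def)
  have C0: "0 \<le> C" using norm_ge_zero C order_trans by blast
  have Sum: "(\<Sum>F\<in>P. cmod (?\<mu> F)) \<le> C * measure m E"
    if P: "P \<in> borel_families E" and E: "E \<in> sets borel" for P E
  proof -
    have "(\<Sum>F\<in>P. cmod (?\<mu> F)) = (\<Sum>F\<in>P. cmod (LINT t:F|m. g t))"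
      using P by (intro sum.cong) (auto simp: borel_families_def)
    also have "\<dots> \<le> (LINT t:E|m. cmod (g t))" by (rule borel_families_set_integral_le[OF g P E])
    also have "\<dots> \<le> (LINT t:E|m. C)"
    proof -
      have "integrable m (\<lambda>t. indicator E t *\<^sub>R cmod (g t))"
        using integrable_norm[OF integrable_bounded_borel[OF g]] E
        by (intro integrable_mult_indicator) auto
      then show ?thesis
        unfolding set_lebesgue_integral_def
      proof (rule integral_mono)
        show "integrable m (\<lambda>t. indicator E t *\<^sub>R C)"
          using E by (intro integrable_mult_indicator) auto
      qed (use C in \<open>auto simp: indicator_def\<close>)
    qed
    also have "\<dots> = C * measure m E"
      using E by (simp add: set_lebesgue_integral_def mult.commute)
    finally show ?thesis .
  qed
  have "(\<lambda>i. ?\<mu> (A i)) sums ?\<mu> (\<Union>i. A i)"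
    if A: "range A \<subseteq> sets borel" "disjoint_family A" for A :: "nat \<Rightarrow> 'g set"
  proof -
    have A': "A i \<in> sets borel" for i using A(1) by blast
    have "(\<lambda>n. LINT t:(\<Union>i\<in>{..<n}. A i)|m. g t) \<longlonglongrightarrow> (LINT t:(\<Union>n. \<Union>i\<in>{..<n}. A i)|m. g t)"
      using A' by (intro set_integral_cont_up set_integrable_bounded_borel[OF g])
        (auto simp: incseq_def intro!: sets.countable_UN sets.finite_UN intro: less_le_trans)
    also have "(\<Union>n. \<Union>i\<in>{..<n}. A i) = (\<Union>i. A i)" by auto
    also have "(\<lambda>n. LINT t:(\<Union>i\<in>{..<n}. A i)|m. g t) = (\<lambda>n. \<Sum>i<n. LINT t:A i|m. g t)"
      using A(2) A' by (intro ext set_integral_finite_Union set_integrable_bounded_borel[OF g])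
        (auto simp: disjoint_family_on_def)
    finally show ?thesis using A' by (simp add: sums_def sets.countable_UN)
  qed
  moreover have "bdd_above ((\<lambda>P. \<Sum>F\<in>P. cmod (?\<mu> F)) ` borel_families UNIV)"
    by (rule bdd_aboveI2[where M = "C * measure m UNIV"]) (rule Sum, auto)
  moreover have "\<exists>K U. compact K \<and> open U \<and> K \<subseteq> E \<and> E \<subseteq> U \<and> variation ?\<mu> (U - K) < e"
    if E: "E \<in> sets borel" and e: "e > 0" for E e
  proof -
    let ?c = "\<lambda>E. complex_of_real (measure m E)"
    have c: "?c \<in> regular_complex_measures" by (rule normalized_haar_regular_complex_measure[OF haar])
    have "e / (C + 1) > 0" using e C0 by simp
    then obtain K U where KU: "compact K" "open U" "K \<subseteq> E" "E \<subseteq> U" "variation ?c (U - K) < e / (C + 1)"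
      using c E unfolding regular_complex_measures_def by blast
    have KU': "U - K \<in> sets borel" using KU by (auto intro: borel_compact)
    have "measure m (U - K) \<le> variation ?c (U - K)"
      using variation_upper[of ?c "{U - K}" "U - K"] c KU'
      by (simp add: regular_complex_measures_def borel_families_def)
    then have "measure m (U - K) < e / (C + 1)" using KU(5) by simp
    then have less: "(C + 1) * measure m (U - K) < e" using C0 by (simp add: pos_less_divide_eq mult.commute)
    have "variation ?\<mu> (U - K) \<le> C * measure m (U - K)"
      by (rule variation_least) (rule Sum[OF _ KU'])
    also have "\<dots> \<le> (C + 1) * measure m (U - K)" by (intro mult_right_mono) auto
    also note less
    finally show ?thesis using KU by blast
  qed
  ultimately show ?thesis unfolding regular_complex_measures_def by simp
qed

lemma cmeas_density:
  assumes "bounded_borel g" "E \<in> sets borel"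
  shows "cmeas (density_cmeasure g) E = (LINT t:E|m. g t)"
  using assms
  by (simp add: density_cmeasure_def Abs_cmeasure_inverse density_in_regular_complex_measures)

lemma norm_density_le:
  assumes g: "bounded_borel g"
  shows "norm (density_cmeasure g) \<le> (\<integral>t. cmod (g t) \<partial>m)"
  unfolding norm_cmeasure_eq_variation
proof (rule variation_least)
  fix P :: "'g set set" assume P: "P \<in> borel_families UNIV"
  have "(\<Sum>F\<in>P. cmod (cmeas (density_cmeasure g) F)) = (\<Sum>F\<in>P. cmod (LINT t:F|m. g t))"
    using P by (intro sum.cong) (auto simp: borel_families_def cmeas_density[OF g])
  also have "\<dots> \<le> (LINT t:UNIV|m. cmod (g t))" by (rule borel_families_set_integral_le[OF g P]) simp
  finally show "(\<Sum>F\<in>P. cmod (cmeas (density_cmeasure g) F)) \<le> (\<integral>t. cmod (g t) \<partial>m)"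
    by (simp add: set_lebesgue_integral_def)
qed

lemma density_diff:
  assumes "bounded_borel f" "bounded_borel g"
  shows "density_cmeasure (\<lambda>t. f t - g t) = density_cmeasure f - density_cmeasure g"
  using assms
  by (intro cmeasure_eqI)
    (simp add: cmeas_density bounded_borel_diff set_integral_diff set_integrable_bounded_borel)

text \<open>Lets a linear operator on measures be evaluated at a simple density piece by
  piece.\<close>

lemma density_sum_indicator:
  assumes R: "finite R" and E: "\<And>p. p \<in> R \<Longrightarrow> E p \<in> sets borel"
    and g: "bounded_borel g" "\<And>t. g t = (\<Sum>p\<in>R. c p * indicator (E p) t)"
  shows "density_cmeasure g = (\<Sum>p\<in>R. c p *\<^sub>C density_cmeasure (indicator (E p)))"
proof (rule cmeasure_eqI)
  fix A :: "'g set" assume A: "A \<in> sets borel"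
  have int: "integrable m (\<lambda>t. indicator A t *\<^sub>R (indicator (E p) t :: complex))" if "p \<in> R" for p
    using set_integrable_bounded_borel[OF bounded_borel_indicator A] E[OF that]
    by (simp only: set_integrable_def)
  have "cmeas (density_cmeasure g) A = (\<integral>t. (\<Sum>p\<in>R. c p * (indicator A t *\<^sub>R indicator (E p) t)) \<partial>m)"
    unfolding cmeas_density[OF g(1) A] set_lebesgue_integral_def
    by (intro Bochner_Integration.integral_cong refl)
      (simp add: g(2) sum_distrib_left scaleR_conv_of_real mult_ac)
  also have "\<dots> = (\<Sum>p\<in>R. c p * (LINT t:A|m. indicator (E p) t))"
    unfolding set_lebesgue_integral_def integral_mult_right_zero[symmetric]
    by (rule Bochner_Integration.integral_sum) (rule integrable_mult_right[OF int])
  also have "\<dots> = cmeas (\<Sum>p\<in>R. c p *\<^sub>C density_cmeasure (indicator (E p))) A"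
    using E A by (simp add: cmeas_sum cmeas_density bounded_borel_indicator)
  finally show "cmeas (density_cmeasure g) A = cmeas (\<Sum>p\<in>R. c p *\<^sub>C density_cmeasure (indicator (E p))) A" .
qed

text \<open>Reduces convolutions and Fourier coefficients with values in a possibly non-separable
  space to ordinary scalar integrals. For simple functions it is linearity, and both sides pass to
  uniform limits.\<close>

lemma functional_cintegral_density:
  fixes F :: "'g \<Rightarrow> 'x::complex_banach" and \<phi> :: "'x \<Rightarrow> complex"
  assumes g: "bounded_borel g" and F: "continuous_on UNIV F" and \<phi>: "bounded_clinear \<phi>"
  shows "\<phi> (cintegral (cmeas (density_cmeasure g)) F) = (\<integral>t. \<phi> (F t) * g t \<partial>m)"
proof -
  let ?\<mu> = "cmeas (density_cmeasure g)"
  interpret \<phi>: bounded_linear \<phi> by (rule bounded_clinearD(1)[OF \<phi>])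
  obtain C where C: "\<And>t. cmod (g t) \<le> C" using g by (auto simp: bounded_borel_def)
  have C0: "0 \<le> C" using norm_ge_zero C order_trans by blast
  obtain S where S: "\<And>n. simple_function borel (S n)" "uniform_limit UNIV S F sequentially"
    "(\<lambda>n. simple_cintegral ?\<mu> (S n)) \<longlonglongrightarrow> cintegral ?\<mu> F"
    using has_cintegral_cintegral[OF compact_UNIV F cmeas] unfolding has_cintegral_def by blast
  have bb: "bounded_borel (\<lambda>t. \<phi> (F t) * g t)"
  proof -
    have "continuous_on UNIV (\<lambda>t. \<phi> (F t))" by (rule \<phi>.continuous_on[OF F])
    then have b: "bounded_borel (\<lambda>t. \<phi> (F t))" by (rule bounded_borel_continuous)
    then obtain D where "\<And>t. cmod (\<phi> (F t)) \<le> D" by (auto simp: bounded_borel_def)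
    then have "cmod (\<phi> (F t) * g t) \<le> D * C" for t
      using C unfolding norm_mult by (intro mult_mono) (auto intro: order_trans[OF norm_ge_zero])
    then show ?thesis using b g by (auto simp: bounded_borel_def)
  qed
  have simple: "integrable m (\<lambda>t. \<phi> (S n t) * g t)"
    "\<phi> (simple_cintegral ?\<mu> (S n)) = (\<integral>t. \<phi> (S n t) * g t \<partial>m)" for n
  proof -
    have fin: "finite (range (S n))" using S(1) by (simp add: simple_function_def)
    have meas: "S n -` {y} \<in> sets borel" for y by (rule simple_function_borel_vimage[OF S(1)])
    have eq: "\<phi> (S n t) * g t = (\<Sum>y\<in>range (S n). \<phi> y * (indicator (S n -` {y}) t *\<^sub>R g t))" for t
    proof -
      have "(\<Sum>y\<in>range (S n). \<phi> y * (indicator (S n -` {y}) t *\<^sub>R g t)) =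
          (\<Sum>y\<in>range (S n). if S n t = y then \<phi> y * g t else 0)"
        by (intro sum.cong) (auto simp: indicator_def)
      then show ?thesis using fin by simp
    qed
    have int: "integrable m (\<lambda>t. indicator (S n -` {y}) t *\<^sub>R g t)" for y
      using set_integrable_bounded_borel[OF g meas] by (simp add: set_integrable_def)
    show "integrable m (\<lambda>t. \<phi> (S n t) * g t)"
      unfolding eq using int by (intro Bochner_Integration.integrable_sum integrable_mult_right)
    have "\<phi> (simple_cintegral ?\<mu> (S n)) =
        (\<Sum>y\<in>range (S n). \<integral>t. \<phi> y * (indicator (S n -` {y}) t *\<^sub>R g t) \<partial>m)"
      unfolding simple_cintegral_def bounded_clinear_sum_scaleC[OF \<phi>] cmeas_density[OF g meas]
        set_lebesgue_integral_def scaleC_complex_def integral_mult_right_zero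
      by (simp only: mult.commute)
    also have "\<dots> = (\<integral>t. \<phi> (S n t) * g t \<partial>m)"
      unfolding eq using int
      by (intro Bochner_Integration.integral_sum[symmetric] integrable_mult_right)
    finally show "\<phi> (simple_cintegral ?\<mu> (S n)) = (\<integral>t. \<phi> (S n t) * g t \<partial>m)" .
  qed
  have "(\<lambda>n. \<integral>t. \<phi> (S n t) * g t \<partial>m) \<longlonglongrightarrow> (\<integral>t. \<phi> (F t) * g t \<partial>m)"
  proof (rule tendstoI)
    fix e :: real assume e: "e > 0"
    \<comment> \<open>The added 1 makes k positive even if \<open>onorm \<phi> * C\<close> is 0, and
      gives the strict inequality at the end.\<close>
    define k where "k = onorm \<phi> * C + 1"
    have k: "k > 0" "onorm \<phi> * C < k"
      using onorm_pos_le[OF \<phi>.bounded_linear_axioms] C0 by (simp_all add: k_def add_nonneg_pos)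
    then have "e / k > 0" using e by simp
    then have "\<forall>\<^sub>F n in sequentially. \<forall>t\<in>UNIV. dist (S n t) (F t) < e / k"
      by (rule uniform_limitD[OF S(2)])
    then show "\<forall>\<^sub>F n in sequentially.
        dist (\<integral>t. \<phi> (S n t) * g t \<partial>m) (\<integral>t. \<phi> (F t) * g t \<partial>m) < e"
    proof eventually_elim
      case (elim n)
      have "cmod ((\<integral>t. \<phi> (S n t) * g t \<partial>m) - (\<integral>t. \<phi> (F t) * g t \<partial>m)) =
          cmod (\<integral>t. \<phi> (S n t) * g t - \<phi> (F t) * g t \<partial>m)"
        by (simp add: simple(1) integrable_bounded_borel[OF bb])
      also have "\<dots> \<le> onorm \<phi> * C * (e / k)"
      proof (rule norm_integral_le)
        fix t
        have "cmod (\<phi> (S n t) * g t - \<phi> (F t) * g t) = cmod (\<phi> (S n t - F t)) * cmod (g t)"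
          by (simp add: \<phi>.diff left_diff_distrib flip: norm_mult)
        also have "\<dots> \<le> (onorm \<phi> * (e / k)) * C"
        proof (rule mult_mono)
          have "cmod (\<phi> (S n t - F t)) \<le> onorm \<phi> * norm (S n t - F t)"
            by (rule onorm[OF \<phi>.bounded_linear_axioms])
          also have "\<dots> \<le> onorm \<phi> * (e / k)"
            using elim by (intro mult_left_mono onorm_pos_le \<phi>.bounded_linear_axioms)
              (simp add: dist_norm less_imp_le)
          finally show "cmod (\<phi> (S n t - F t)) \<le> onorm \<phi> * (e / k)" .
        qed (use C e k onorm_pos_le[OF \<phi>.bounded_linear_axioms] in auto)
        finally show "cmod (\<phi> (S n t) * g t - \<phi> (F t) * g t) \<le> onorm \<phi> * C * (e / k)"
          by (simp add: mult_ac)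
      qed (simp add: simple(1) integrable_bounded_borel[OF bb])
      also have "\<dots> < k * (e / k)" using k e by (intro mult_strict_right_mono) auto
      also have "\<dots> = e" using k by simp
      finally show ?case by (simp add: dist_norm)
    qed
  qed
  moreover have "(\<lambda>n. \<integral>t. \<phi> (S n t) * g t \<partial>m) \<longlonglongrightarrow> \<phi> (cintegral ?\<mu> F)"
    using \<phi>.tendsto[OF S(3)] unfolding simple(2) .
  ultimately show ?thesis by (rule LIMSEQ_unique[symmetric])
qed

end

section \<open>Harmonic analysis\<close>

lemma dual_groupD:
  assumes "\<gamma> \<in> dual_group"
  shows "continuous_on UNIV \<gamma>" "cmod (\<gamma> t) = 1" "\<gamma> (t + u) = \<gamma> t * \<gamma> u" "\<gamma> t * cnj (\<gamma> t) = 1"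
    "\<gamma> (- t) = cnj (\<gamma> t)"
proof -
  show 1: "continuous_on UNIV \<gamma>" "cmod (\<gamma> t) = 1" "\<gamma> (t + u) = \<gamma> t * \<gamma> u" for t u
    using assms by (auto simp: dual_group_def)
  show 2: "\<gamma> t * cnj (\<gamma> t) = 1" using complex_norm_square[of "\<gamma> t"] 1(2) by simp
  have "\<gamma> 0 = 1" using 1(3)[of 0 0] 1(2)[of 0] by auto
  then have "\<gamma> t * \<gamma> (- t) = \<gamma> t * cnj (\<gamma> t)" using 1(3)[of t "- t"] 2 by simp
  then show "\<gamma> (- t) = cnj (\<gamma> t)" using 1(2)[of t] by auto
qed

text \<open>Resolves the self-referential estimate with which both Hilbert-Schmidt bounds
  end.\<close>

lemma le_power2_of_le_mult_sqrt:
  fixes k S :: real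
  assumes "0 \<le> S" "0 \<le> k" "S \<le> k * sqrt S"
  shows "S \<le> k\<^sup>2"
proof (cases "S = 0")
  case False
  have "sqrt S * sqrt S \<le> k * sqrt S" using assms by simp
  then have "sqrt S \<le> k" by (rule mult_right_le_imp_le) (use False assms in simp)
  then show ?thesis by (rule sqrt_le_D)
qed simp

lemma dual_ballD:
  assumes "\<phi> \<in> dual_ball"
  shows "bounded_clinear \<phi>" "cmod (\<phi> x) \<le> norm x"
proof -
  show b: "bounded_clinear \<phi>" using assms by (simp add: dual_ball_def)
  have "cmod (\<phi> x) \<le> onorm \<phi> * norm x" by (rule onorm[OF bounded_clinearD(1)[OF b]])
  also have "\<dots> \<le> 1 * norm x" using assms by (intro mult_right_mono) (auto simp: dual_ball_def)
  finally show "cmod (\<phi> x) \<le> norm x" by simp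
qed

context compact_haar
begin

text \<open>Joint continuity of \<open>k (t - u)\<close> and compactness in t give continuity in u
  uniformly in t, that is, for the supremum norm. Hence \<open>u \<mapsto> k (\<cdot> - u)\<close>
  has simple approximations.\<close>

lemma translations_continuous:
  fixes k :: "'g \<Rightarrow> complex"
  assumes k: "continuous_on UNIV k"
  shows "\<exists>K :: 'g \<Rightarrow> 'g \<Rightarrow>\<^sub>C complex. continuous_on UNIV K \<and> (\<forall>u t. apply_bcontfun (K u) t = k (t - u))"
proof -
  obtain C where C: "\<And>t. cmod (k t) \<le> C" using continuous_bounded[OF k] by blast
  define K where "K u = Bcontfun (\<lambda>t. k (t - u))" for u
  have cont: "continuous_on UNIV (\<lambda>t. k (t - u))" for u
    by (intro continuous_on_compose2[OF k] continuous_intros) auto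
  have K: "apply_bcontfun (K u) t = k (t - u)" for u t
    unfolding K_def using C by (subst Bcontfun_inverse) (auto intro: bcontfun_normI cont)
  have joint: "continuous_on (UNIV \<times> UNIV) (\<lambda>(u, t). k (t - u))"
    unfolding split_beta by (intro continuous_on_compose2[OF k] continuous_intros) auto
  have "continuous_on UNIV K"
    unfolding continuous_on_def
  proof (intro ballI tendstoI)
    fix u0 :: 'g and e :: real assume "e > 0"
    then have "e / 2 > 0" by simp
    from continuous_on_prod_compactE[OF joint compact_UNIV UNIV_I[of u0] this]
    obtain X where X: "u0 \<in> X" "open X" "\<forall>u\<in>X \<inter> UNIV. \<forall>t\<in>UNIV.
        dist (case (u, t) of (u, t) \<Rightarrow> k (t - u)) (case (u0, t) of (u, t) \<Rightarrow> k (t - u)) \<le> e / 2"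
      by blast
    have "dist (K u) (K u0) < e" if "u \<in> X" for u
    proof -
      have "dist (K u) (K u0) \<le> e / 2"
        using X(3) that by (intro dist_bound) (simp add: K)
      then show ?thesis using \<open>e > 0\<close> by simp
    qed
    then show "\<forall>\<^sub>F u in at u0 within UNIV. dist (K u) (K u0) < e"
      unfolding eventually_at_topological using X(1,2) by blast
  qed
  then show ?thesis using K by blast
qed

text \<open>Evaluate the double integral of \<open>k (t - u)\<close> in both orders.  Since the product of the Borel
  algebras may be too small for Fubini's theorem, \<open>u \<mapsto> k (\<cdot> - u)\<close> is first replaced by a simple
  function with values in \<open>C(G)\<close>.\<close>

lemma integral_reflect:
  fixes k :: "'g \<Rightarrow> complex"
  assumes k: "continuous_on UNIV k"
  shows "(\<integral>t. k (- t) \<partial>m) = (\<integral>t. k t \<partial>m)"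
proof -
  let ?I = "\<integral>t. k t \<partial>m" and ?J = "\<integral>t. k (- t) \<partial>m"
  have cont: "continuous_on UNIV (\<lambda>t. k (a - t))" "continuous_on UNIV (\<lambda>t. k (t - a))"
    "continuous_on UNIV (\<lambda>t. k (- t))" for a
    by (intro continuous_on_compose2[OF k] continuous_intros; simp)+
  have J: "(\<integral>u. k (t - u) \<partial>m) = ?J" for t
    using integral_translate[OF borel_measurable_continuous_onI[OF cont(1)], of t t] by simp
  have I: "(\<integral>t. k (t - u) \<partial>m) = ?I" for u
    using integral_translate[OF borel_measurable_continuous_onI[OF k], of "- u"] by simp
  obtain K :: "'g \<Rightarrow> 'g \<Rightarrow>\<^sub>C complex" where K: "continuous_on UNIV K"
    "\<And>u t. apply_bcontfun (K u) t = k (t - u)"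
    using translations_continuous[OF k] by blast
  have "cmod (?J - ?I) \<le> 2 * e" if e: "e > 0" for e
  proof -
    obtain S where S: "simple_function borel S" and SK: "\<And>u. dist (S u) (K u) < e"
      using simple_function_approx[OF compact_UNIV K(1) e] by blast
    have fin: "finite (range S)" using S by (simp add: simple_function_def)
    have meas: "S -` {y} \<in> sets borel" for y by (rule simple_function_borel_vimage[OF S])
    have ind: "(\<Sum>y\<in>range S. indicator (S -` {y}) u * g y) = g (S u)" for u and g :: "_ \<Rightarrow> complex"
    proof -
      have "(\<Sum>y\<in>range S. indicator (S -` {y}) u * g y) = (\<Sum>y\<in>range S. if S u = y then g y else 0)"
        by (intro sum.cong) (auto simp: indicator_def)
      then show ?thesis using fin by simp
    qed
    have int_ind: "integrable m (indicator (S -` {y}) :: 'g \<Rightarrow> complex)" for y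
      using meas by (intro integrable_bounded_borel bounded_borel_indicator)
    define p where "p y = (\<integral>u. indicator (S -` {y}) u \<partial>m :: complex)" for y
    have sum_p: "integrable m (\<lambda>u. g (S u))" "(\<integral>u. g (S u) \<partial>m) = (\<Sum>y\<in>range S. p y * g y)"
      for g :: "_ \<Rightarrow> complex"
    proof -
      have "integrable m (\<lambda>u. \<Sum>y\<in>range S. indicator (S -` {y}) u * g y)"
        by (intro Bochner_Integration.integrable_sum integrable_mult_left int_ind)
      then show "integrable m (\<lambda>u. g (S u))" unfolding ind .
      have "(\<integral>u. (\<Sum>y\<in>range S. indicator (S -` {y}) u * g y) \<partial>m) = (\<Sum>y\<in>range S. p y * g y)"
        unfolding p_def integral_mult_left_zero[symmetric]
        by (intro Bochner_Integration.integral_sum integrable_mult_left int_ind)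
      then show "(\<integral>u. g (S u) \<partial>m) = (\<Sum>y\<in>range S. p y * g y)" unfolding ind .
    qed
    have near: "cmod (apply_bcontfun (S u) t - k (t - u)) \<le> e" for u t
      using dist_bounded[of "S u" t "K u"] SK[of u] by (simp add: K(2) dist_norm)
    have int_b: "integrable m (apply_bcontfun y)" for y :: "'g \<Rightarrow>\<^sub>C complex"
      by (intro integrable_continuous continuous_on_apply_bcontfun)
    \<comment> \<open>The double integral of the simple substitute, a finite sum. Integrating over u
      first puts it near \<open>?J\<close>, over t first near \<open>?I\<close>, since the exact
      inner integrals do not depend on the remaining variable.\<close>
    define Z where "Z = (\<Sum>y\<in>range S. p y * (\<integral>t. apply_bcontfun y t \<partial>m))"
    have "cmod (Z - ?J) \<le> e"
    proof -
      have "Z - ?J = (\<integral>t. (\<Sum>y\<in>range S. p y * apply_bcontfun y t) - ?J \<partial>m)"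
        using int_b by (simp add: Z_def)
      also have "cmod \<dots> \<le> e"
      proof (rule norm_integral_le)
        fix t
        have "(\<Sum>y\<in>range S. p y * apply_bcontfun y t) - ?J = (\<integral>u. apply_bcontfun (S u) t - k (t - u) \<partial>m)"
          using sum_p[of "\<lambda>y. apply_bcontfun y t"] integrable_continuous[OF cont(1)[of t]]
          by (simp add: J)
        also have "cmod \<dots> \<le> e"
          using sum_p(1)[of "\<lambda>y. apply_bcontfun y t"] integrable_continuous[OF cont(1)[of t]] near
          by (intro norm_integral_le) auto
        finally show "cmod ((\<Sum>y\<in>range S. p y * apply_bcontfun y t) - ?J) \<le> e" .
      qed (use int_b in auto)
      finally show ?thesis .
    qed
    moreover have "cmod (Z - ?I) \<le> e"
    proof -
      let ?g = "\<lambda>y. \<integral>t. apply_bcontfun y t \<partial>m"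
      have "Z - ?I = (\<integral>u. ?g (S u) - ?I \<partial>m)"
        using sum_p[of ?g] by (simp add: Z_def)
      also have "cmod \<dots> \<le> e"
      proof (rule norm_integral_le)
        fix u
        have "?g (S u) - ?I = (\<integral>t. apply_bcontfun (S u) t - k (t - u) \<partial>m)"
          using int_b integrable_continuous[OF cont(2)[of u]] by (simp add: I)
        also have "cmod \<dots> \<le> e"
          using int_b integrable_continuous[OF cont(2)[of u]] near by (intro norm_integral_le) auto
        finally show "cmod (?g (S u) - ?I) \<le> e" .
      qed (use sum_p(1)[of ?g] in auto)
      finally show ?thesis .
    qed
    ultimately show ?thesis
      using norm_triangle_ineq4[of "Z - ?I" "Z - ?J"] by simp
  qed
  then have "cmod (?J - ?I) \<le> 0 + e" if "e > 0" for e
    using that[THEN half_gt_zero] by fastforce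
  then have "cmod (?J - ?I) \<le> 0" by (rule field_le_epsilon)
  then show ?thesis by simp
qed

text \<open>If the characters differ at a, then \<open>?\<chi> a \<noteq> 1\<close>, while
  translation by a multiplies the integral of \<open>?\<chi>\<close> by \<open>?\<chi> a\<close>; so
  it is 0.\<close>

lemma characters_orthonormal:
  assumes \<gamma>: "\<gamma> \<in> dual_group" and \<gamma>': "\<gamma>' \<in> dual_group"
  shows "(\<integral>t. cnj (\<gamma> t) * \<gamma>' t \<partial>m) = (if \<gamma> = \<gamma>' then 1 else 0)"
proof (cases "\<gamma> = \<gamma>'")
  case True
  then show ?thesis using dual_groupD(4)[OF \<gamma>] by (simp add: mult.commute)
next
  case False
  let ?\<chi> = "\<lambda>t. cnj (\<gamma> t) * \<gamma>' t"
  have cont: "continuous_on UNIV ?\<chi>"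
    by (intro continuous_intros dual_groupD(1) \<gamma> \<gamma>')
  obtain a where a: "\<gamma> a \<noteq> \<gamma>' a" using False by blast
  have "?\<chi> a \<noteq> 1"
  proof
    assume "?\<chi> a = 1"
    then have "\<gamma> a * cnj (\<gamma> a) * \<gamma>' a = \<gamma> a" by (metis mult.assoc mult.right_neutral)
    then show False using a dual_groupD(4)[OF \<gamma>] by simp
  qed
  moreover have "(\<integral>t. ?\<chi> t \<partial>m) = ?\<chi> a * (\<integral>t. ?\<chi> t \<partial>m)"
  proof -
    have "(\<integral>t. ?\<chi> t \<partial>m) = (\<integral>t. ?\<chi> (a + t) \<partial>m)"
      by (rule integral_translate[OF borel_measurable_continuous_onI[OF cont], symmetric])
    also have "\<dots> = (\<integral>t. ?\<chi> a * ?\<chi> t \<partial>m)"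
      by (simp add: dual_groupD(3)[OF \<gamma>] dual_groupD(3)[OF \<gamma>'] mult_ac)
    finally show ?thesis by (simp only: integral_mult_right_zero)
  qed
  ultimately show ?thesis using False by (simp only: mult_cancel_right1 if_False) metis
qed

section \<open>Hilbert-Schmidt estimates from trigonometric polynomials\<close>

lemma continuous_trig_polynomial:
  fixes v :: "('g \<Rightarrow> complex) \<Rightarrow> 'x::complex_normed_vector"
  assumes "F \<subseteq> dual_group"
  shows "continuous_on UNIV (\<lambda>t. \<Sum>\<gamma>\<in>F. cnj (\<gamma> t) *\<^sub>C v \<gamma>)"
  using assms
  by (intro continuous_on_sum continuous_on_scaleC continuous_on_cnj dual_groupD(1) continuous_on_const)
    blast

text \<open>Orthonormality of the characters evaluates the L2 norm, and on a probability space the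
  L1 norm is no larger. Only norms and inner products are integrated, so the Hilbert space may be
  non-separable.\<close>

lemma trig_polynomial_L1_norm_le:
  fixes v :: "('g \<Rightarrow> complex) \<Rightarrow> 'h::complex_hilbert"
  assumes F: "finite F" "F \<subseteq> dual_group" and S: "(\<Sum>\<gamma>\<in>F. (norm (v \<gamma>))\<^sup>2) \<le> S"
  shows "(\<integral>t. norm (\<Sum>\<gamma>\<in>F. cnj (\<gamma> t) *\<^sub>C v \<gamma>) \<partial>m) \<le> sqrt S"
proof -
  let ?p = "\<lambda>t. \<Sum>\<gamma>\<in>F. cnj (\<gamma> t) *\<^sub>C v \<gamma>"
  have contp: "continuous_on UNIV (\<lambda>t. norm (?p t))"
    by (intro continuous_intros continuous_trig_polynomial F)
  have int: "integrable m (\<lambda>t. cnj (\<gamma> t) * \<gamma>' t)" if "\<gamma> \<in> F" "\<gamma>' \<in> F" for \<gamma> \<gamma>'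
    using that F by (intro integrable_continuous continuous_intros dual_groupD(1)) auto
  have "complex_of_real (\<integral>t. (norm (?p t))\<^sup>2 \<partial>m) = (\<integral>t. cinner (?p t) (?p t) \<partial>m)"
    by (simp add: cinner_self flip: integral_of_real del: of_real_power)
  also have "\<dots> = (\<integral>t. (\<Sum>\<gamma>\<in>F. \<Sum>\<gamma>'\<in>F. cinner (v \<gamma>) (v \<gamma>') * (cnj (\<gamma> t) * \<gamma>' t)) \<partial>m)"
    unfolding cinner_sum_left cinner_scaleC_left
    unfolding cinner_sum_right cinner_scaleC_right sum_distrib_left
    by (simp add: mult_ac)
  also have "\<dots> = (\<Sum>\<gamma>\<in>F. \<Sum>\<gamma>'\<in>F. cinner (v \<gamma>) (v \<gamma>') * (\<integral>t. cnj (\<gamma> t) * \<gamma>' t \<partial>m))"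
    using int by simp
  also have "\<dots> = (\<Sum>\<gamma>\<in>F. \<Sum>\<gamma>'\<in>F. if \<gamma> = \<gamma>' then cinner (v \<gamma>) (v \<gamma>') else 0)"
    using F(2) by (intro sum.cong refl) (simp add: characters_orthonormal subset_iff)
  also have "\<dots> = complex_of_real (\<Sum>\<gamma>\<in>F. (norm (v \<gamma>))\<^sup>2)"
    using F(1) by (simp add: cinner_self)
  finally have sq: "(\<integral>t. (norm (?p t))\<^sup>2 \<partial>m) = (\<Sum>\<gamma>\<in>F. (norm (v \<gamma>))\<^sup>2)"
    unfolding of_real_eq_iff .
  have S0: "0 \<le> S" using S by (meson order_trans sum_nonneg zero_le_power2)
  have le: "(\<integral>t. norm (?p t) \<partial>m) \<le> sqrt S + e" if e: "e > 0" for e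
  proof -
    \<comment> \<open>L1 is compared with L2 through x \<le> (x^2 / ?c + ?c) / 2, sharp at x = ?c;
      the summand e keeps \<open>?c\<close> positive for S = 0.\<close>
    let ?c = "sqrt S + e"
    have c: "?c > 0" using e S0 by (simp add: add_nonneg_pos)
    have "(\<integral>t. norm (?p t) \<partial>m) \<le> (\<integral>t. ((norm (?p t))\<^sup>2 / ?c + ?c) / 2 \<partial>m)"
    proof (rule integral_mono)
      show "integrable m (\<lambda>t. norm (?p t))" by (rule integrable_continuous[OF contp])
      show "integrable m (\<lambda>t. ((norm (?p t))\<^sup>2 / ?c + ?c) / 2)"
        using c by (intro integrable_continuous continuous_intros contp) auto
      have "x \<le> (x\<^sup>2 / ?c + ?c) / 2" for x :: real
        using sum_squares_bound[of x ?c] c by (simp add: field_simps power2_eq_square)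
      then show "norm (?p t) \<le> ((norm (?p t))\<^sup>2 / ?c + ?c) / 2" for t .
    qed
    also have "\<dots> = ((\<integral>t. (norm (?p t))\<^sup>2 \<partial>m) / ?c + ?c) / 2"
      using integrable_continuous[of "\<lambda>t. (norm (?p t))\<^sup>2"] contp
      by (simp add: continuous_on_power)
    also have "\<dots> \<le> (?c\<^sup>2 / ?c + ?c) / 2"
    proof -
      have "S = (sqrt S)\<^sup>2" using S0 by simp
      also have "\<dots> \<le> ?c\<^sup>2" using e S0 by (intro power_mono) auto
      finally show ?thesis
        using S c unfolding sq by (intro divide_right_mono add_right_mono) auto
    qed
    also have "\<dots> = ?c" using c by (simp add: power2_eq_square)
    finally show ?thesis .
  qed
  show ?thesis by (rule field_le_epsilon) (rule le)
qed

text \<open>Replacing the characters by simple functions on a common partition avoids representing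
  functionals on \<open>L\<^sub>1(G)\<close> by bounded functions.\<close>

lemma characters_hilbert_schmidt:
  fixes A :: "'g cmeasure \<Rightarrow> 'h::complex_hilbert"
  assumes A: "bounded_clinear A" and F: "finite F" "F \<subseteq> dual_group"
  shows "(\<Sum>\<gamma>\<in>F. (norm (A (density_cmeasure \<gamma>)))\<^sup>2) \<le> (onorm A)\<^sup>2"
proof -
  interpret A: bounded_linear A by (rule bounded_clinearD(1)[OF A])
  define k where "k = onorm A"
  have k: "0 \<le> k" "\<And>\<mu>. norm (A \<mu>) \<le> k * norm \<mu>"
    unfolding k_def using onorm_pos_le onorm A.bounded_linear_axioms by blast+
  define a where "a \<gamma> = A (density_cmeasure \<gamma>)" for \<gamma>
  define S where "S = (\<Sum>\<gamma>\<in>F. (norm (a \<gamma>))\<^sup>2)"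
  define D where "D = (\<Sum>\<gamma>\<in>F. norm (a \<gamma>))"
  let ?p = "\<lambda>t. \<Sum>\<gamma>\<in>F. cnj (\<gamma> t) *\<^sub>C a \<gamma>"
  have contp: "continuous_on UNIV (\<lambda>t. norm (?p t))"
    by (intro continuous_intros continuous_trig_polynomial F)
  have S0: "0 \<le> S" unfolding S_def by (intro sum_nonneg) simp
  have D0: "0 \<le> D" unfolding D_def by (intro sum_nonneg) simp
  \<comment> \<open>Heuristically S is the pairing of \<open>A\<close> with \<open>?p\<close>, so at
    most k times the L1 norm of \<open>?p\<close>, which is at most sqrt S. The two error terms come
    from replacing the characters by simple functions, once in \<open>?p\<close> and once under
    \<open>A\<close>.\<close>
  have approx: "S \<le> k * (sqrt S + e * D) + k * e * D" if e: "e > 0" for e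
  proof -
    have "\<forall>\<gamma>. \<exists>R. \<gamma> \<in> F \<longrightarrow> simple_function borel R \<and> (\<forall>u. dist (R u) (\<gamma> u) < e)"
      using simple_function_approx[OF compact_UNIV dual_groupD(1) e] F(2) by blast
    then obtain R where R: "\<And>\<gamma>. \<gamma> \<in> F \<Longrightarrow> simple_function borel (R \<gamma>)"
      "\<And>\<gamma> u. \<gamma> \<in> F \<Longrightarrow> dist (R \<gamma> u) (\<gamma> u) < e"
      by metis
    \<comment> \<open>Records the values of all \<open>R \<gamma>\<close> at once, so its fibres are
      the common partition; the value 0 off \<open>F\<close> keeps its range finite.\<close>
    define P where "P u = (\<lambda>\<gamma>. if \<gamma> \<in> F then R \<gamma> u else 0)" for u
    have fin: "finite (range P)"
    proof (rule finite_subset)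
      show "range P \<subseteq> {f. \<forall>\<gamma>. (\<gamma> \<in> F \<longrightarrow> f \<gamma> \<in> (\<Union>\<gamma>\<in>F. range (R \<gamma>))) \<and> (\<gamma> \<notin> F \<longrightarrow> f \<gamma> = 0)}"
        unfolding P_def by fastforce
      show "finite \<dots>"
        using F(1) R(1) by (intro finite_set_of_finite_funs) (auto simp: simple_function_def)
    qed
    let ?E = "\<lambda>p. P -` {p}"
    have E: "?E p \<in> sets borel" for p
    proof (cases "p \<in> range P")
      case True
      then obtain u where u: "p = P u" by blast
      have "P v = P u \<longleftrightarrow> (\<forall>\<gamma>\<in>F. R \<gamma> v = R \<gamma> u)" for v
      proof
        assume eq: "P v = P u"
        show "\<forall>\<gamma>\<in>F. R \<gamma> v = R \<gamma> u"
        proof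
          fix \<gamma> assume "\<gamma> \<in> F"
          then show "R \<gamma> v = R \<gamma> u" using fun_cong[OF eq, of \<gamma>] by (simp add: P_def)
        qed
      qed (auto simp: P_def)
      then have "?E p = (\<Inter>\<gamma>\<in>F. R \<gamma> -` {p \<gamma>})" by (auto simp: u) (auto simp: P_def)
      moreover have "R \<gamma> -` {p \<gamma>} \<in> sets borel" if "\<gamma> \<in> F" for \<gamma>
        by (rule simple_function_borel_vimage[OF R(1)[OF that]])
      then have "(\<Inter>\<gamma>\<in>F. R \<gamma> -` {p \<gamma>}) \<in> sets borel" if "F \<noteq> {}"
        using F(1) that by (intro sets.finite_INT) auto
      ultimately show ?thesis by (cases "F = {}") auto
    next
      case False
      then have "?E p = {}" by auto
      then show ?thesis by simp
    qed
    have ind: "(\<Sum>p\<in>range P. indicator (?E p) t * g p) = g (P t)" for t and g :: "_ \<Rightarrow> 'z::comm_semiring_1"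
    proof -
      have "(\<Sum>p\<in>range P. indicator (?E p) t * g p) = (\<Sum>p\<in>range P. if P t = p then g p else 0)"
        by (intro sum.cong) (auto simp: indicator_def)
      then show ?thesis using fin by simp
    qed
    have bR: "bounded_borel (R \<gamma>)" if "\<gamma> \<in> F" for \<gamma>
      by (rule bounded_borel_simple[OF R(1)[OF that]])
    have AR: "A (density_cmeasure (R \<gamma>)) = (\<Sum>p\<in>range P. p \<gamma> *\<^sub>C A (density_cmeasure (indicator (?E p))))"
      if \<gamma>: "\<gamma> \<in> F" for \<gamma>
    proof -
      have "R \<gamma> t = (\<Sum>p\<in>range P. p \<gamma> * indicator (?E p) t)" for t
        using ind[of t "\<lambda>p. p \<gamma>"] \<gamma> by (simp add: P_def mult.commute)
      from density_sum_indicator[OF fin E bR[OF \<gamma>] this]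
      show ?thesis by (simp add: bounded_clinear_sum_scaleC[OF A])
    qed
    have nE: "norm (A (density_cmeasure (indicator (?E p)))) \<le> k * measure m (?E p)" for p
    proof -
      have "norm (density_cmeasure (indicator (?E p))) \<le> measure m (?E p)"
      proof -
        have "cmod (indicator (?E p) t) = indicator (?E p) t" for t by (simp add: indicator_def)
        then show ?thesis
          using norm_density_le[OF bounded_borel_indicator[OF E[of p]]] E[of p] by simp
      qed
      then show ?thesis using k mult_left_mono order_trans by blast
    qed
    define Z where "Z = (\<Sum>\<gamma>\<in>F. cinner (A (density_cmeasure (R \<gamma>))) (a \<gamma>))"
    let ?Q = "\<lambda>p. \<Sum>\<gamma>\<in>F. cnj (p \<gamma>) *\<^sub>C a \<gamma>"
    \<comment> \<open>Collecting by fibres pairs each indicator measure with the single vector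
      \<open>?Q p\<close>; its image under \<open>A\<close> has norm at most k times the measure of
      the fibre.\<close>
    have "Z = (\<Sum>\<gamma>\<in>F. \<Sum>p\<in>range P. cinner (A (density_cmeasure (indicator (?E p)))) (cnj (p \<gamma>) *\<^sub>C a \<gamma>))"
      by (simp add: Z_def AR cinner_sum_left cinner_scaleC_left cinner_scaleC_right)
    also have "\<dots> = (\<Sum>p\<in>range P. cinner (A (density_cmeasure (indicator (?E p)))) (?Q p))"
      unfolding cinner_sum_right by (rule sum.swap)
    also have "cmod \<dots> \<le> (\<Sum>p\<in>range P. k * (measure m (?E p) * norm (?Q p)))"
    proof (rule sum_norm_le)
      fix p
      have "cmod (cinner (A (density_cmeasure (indicator (?E p)))) (?Q p)) \<le>
          norm (A (density_cmeasure (indicator (?E p)))) * norm (?Q p)"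
        by (rule cinner_cauchy_schwarz)
      also have "\<dots> \<le> k * measure m (?E p) * norm (?Q p)" by (intro mult_right_mono nE) simp
      finally show "cmod (cinner (A (density_cmeasure (indicator (?E p)))) (?Q p)) \<le>
          k * (measure m (?E p) * norm (?Q p))" by (simp add: mult_ac)
    qed
    also have "\<dots> = k * (\<integral>t. norm (?Q (P t)) \<partial>m)"
    proof -
      have int: "integrable m (\<lambda>t. indicator (?E p) t * norm (?Q p))" for p
        using E[of p] by (intro integrable_mult_left) (simp add: less_top[symmetric])
      have "(\<integral>t. norm (?Q (P t)) \<partial>m) = (\<Sum>p\<in>range P. \<integral>t. indicator (?E p) t * norm (?Q p) \<partial>m)"
        unfolding ind[of _ "\<lambda>p. norm (?Q p)", symmetric]
        by (intro Bochner_Integration.integral_sum int)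
      also have "\<dots> = (\<Sum>p\<in>range P. measure m (?E p) * norm (?Q p))"
        using E by simp
      finally show ?thesis by (simp add: sum_distrib_left)
    qed
    also have "\<dots> \<le> k * (sqrt S + e * D)"
    proof (rule mult_left_mono[OF _ k(1)])
      have le: "norm (?Q (P t)) \<le> norm (?p t) + e * D" for t
      proof -
        have "?Q (P t) - ?p t = (\<Sum>\<gamma>\<in>F. cnj (R \<gamma> t - \<gamma> t) *\<^sub>C a \<gamma>)"
          by (simp add: P_def scaleC_add_left scaleC_minus_left algebra_simps flip: sum_subtractf)
            (simp add: diff_conv_add_uminus scaleC_add_left scaleC_minus_left del: add_uminus_conv_diff)
        also have "norm \<dots> \<le> (\<Sum>\<gamma>\<in>F. e * norm (a \<gamma>))"
        proof (rule sum_norm_le)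
          fix \<gamma> assume "\<gamma> \<in> F"
          then have "cmod (R \<gamma> t - \<gamma> t) \<le> e" using R(2) by (simp add: dist_norm less_imp_le)
          then show "norm (cnj (R \<gamma> t - \<gamma> t) *\<^sub>C a \<gamma>) \<le> e * norm (a \<gamma>)"
            unfolding norm_scaleC complex_mod_cnj by (rule mult_right_mono) simp
        qed
        finally have "norm (?Q (P t) - ?p t) \<le> e * D" by (simp add: D_def sum_distrib_left)
        then show ?thesis using norm_triangle_sub[of "?Q (P t)" "?p t"] by simp
      qed
      have "(\<integral>t. norm (?Q (P t)) \<partial>m) \<le> (\<integral>t. norm (?p t) + e * D \<partial>m)"
      proof (rule integral_mono)
        have "integrable m (\<lambda>t. \<Sum>p\<in>range P. indicator (?E p) t * norm (?Q p))"
          using E by (intro Bochner_Integration.integrable_sum integrable_mult_left)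
            (simp add: less_top[symmetric])
        then show "integrable m (\<lambda>t. norm (?Q (P t)))" unfolding ind .
      qed (use le integrable_continuous[OF contp] in auto)
      also have "\<dots> = (\<integral>t. norm (?p t) \<partial>m) + e * D"
        using integrable_continuous[OF contp] by simp
      also have "\<dots> \<le> sqrt S + e * D"
        using trig_polynomial_L1_norm_le[OF F, of a S] by (simp add: S_def)
      finally show "(\<integral>t. norm (?Q (P t)) \<partial>m) \<le> sqrt S + e * D" .
    qed
    finally have Z: "cmod Z \<le> k * (sqrt S + e * D)" .
    have "complex_of_real S - Z = (\<Sum>\<gamma>\<in>F. cinner (A (density_cmeasure (\<lambda>t. \<gamma> t - R \<gamma> t))) (a \<gamma>))"
    proof -
      have "complex_of_real S = (\<Sum>\<gamma>\<in>F. cinner (a \<gamma>) (a \<gamma>))" by (simp add: S_def cinner_self)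
      moreover have "density_cmeasure (\<lambda>t. \<gamma> t - R \<gamma> t) = density_cmeasure \<gamma> - density_cmeasure (R \<gamma>)"
        if "\<gamma> \<in> F" for \<gamma>
        using that F(2) by (intro density_diff bR bounded_borel_continuous dual_groupD(1)) auto
      ultimately show ?thesis
        by (simp add: Z_def A.diff cinner_diff_left sum_subtractf a_def)
    qed
    also have "cmod \<dots> \<le> (\<Sum>\<gamma>\<in>F. k * e * norm (a \<gamma>))"
    proof (rule sum_norm_le)
      fix \<gamma> assume \<gamma>: "\<gamma> \<in> F"
      let ?d = "\<lambda>t. \<gamma> t - R \<gamma> t"
      have b: "bounded_borel ?d"
        using \<gamma> F(2) by (intro bounded_borel_diff bR bounded_borel_continuous dual_groupD(1)) auto
      have "norm (density_cmeasure ?d) \<le> (\<integral>t. cmod (?d t) \<partial>m)" by (rule norm_density_le[OF b])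
      also have "\<dots> \<le> (\<integral>t. e \<partial>m)"
      proof (rule integral_mono)
        show "integrable m (\<lambda>t. cmod (?d t))" by (intro integrable_norm integrable_bounded_borel b)
        show "cmod (?d t) \<le> e" for t
          using R(2)[OF \<gamma>, of t] by (simp add: dist_norm norm_minus_commute less_imp_le)
      qed simp
      finally have "norm (A (density_cmeasure ?d)) \<le> k * e"
        using k mult_left_mono order_trans by fastforce
      then have "norm (A (density_cmeasure ?d)) * norm (a \<gamma>) \<le> k * e * norm (a \<gamma>)"
        by (rule mult_right_mono) simp
      then show "cmod (cinner (A (density_cmeasure ?d)) (a \<gamma>)) \<le> k * e * norm (a \<gamma>)"
        using cinner_cauchy_schwarz order_trans by blast
    qed
    also have "\<dots> = k * e * D" by (simp add: D_def sum_distrib_left)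
    finally have "cmod (complex_of_real S - Z) \<le> k * e * D" .
    moreover have "S \<le> cmod (complex_of_real S - Z) + cmod Z"
      using norm_triangle_ineq[of "complex_of_real S - Z" Z] S0 by simp
    ultimately show ?thesis using Z by linarith
  qed
  have "S \<le> k * sqrt S"
  proof (rule field_le_epsilon)
    fix \<epsilon> :: real assume \<epsilon>: "\<epsilon> > 0"
    \<comment> \<open>Chosen so that the total error 2 * k * D * (\<epsilon> / c) is at most
      \<open>\<epsilon>\<close>.\<close>
    define c where "c = 2 * k * D + 1"
    have c: "c > 0" using k(1) D0 by (simp add: c_def add_nonneg_pos)
    have "S \<le> k * (sqrt S + \<epsilon> / c * D) + k * (\<epsilon> / c) * D"
      using \<epsilon> c by (intro approx) simp
    also have "\<dots> = k * sqrt S + (2 * k * D) * (\<epsilon> / c)" by (simp add: algebra_simps)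
    also have "\<dots> \<le> k * sqrt S + c * (\<epsilon> / c)"
      using \<epsilon> c by (intro add_left_mono mult_right_mono) (auto simp: c_def)
    also have "\<dots> = k * sqrt S + \<epsilon>" using c by simp
    finally show "S \<le> k * sqrt S + \<epsilon>" .
  qed
  with S0 k(1) have "S \<le> k\<^sup>2" by (rule le_power2_of_le_mult_sqrt)
  then show ?thesis by (simp add: S_def a_def k_def)
qed

definition functional_coeff ::
  "('x::complex_banach \<Rightarrow> complex) \<Rightarrow> ('h::complex_hilbert \<Rightarrow> 'g \<Rightarrow>\<^sub>C 'x) \<Rightarrow> ('g \<Rightarrow> complex) \<Rightarrow> 'h \<Rightarrow> complex" where
  "functional_coeff \<phi> B \<gamma> h = (\<integral>t. cnj (\<gamma> t) * \<phi> (apply_bcontfun (B h) t) \<partial>m)"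

lemma continuous_functional:
  assumes "bounded_clinear \<phi>"
  shows "continuous_on UNIV (\<lambda>t. \<phi> (apply_bcontfun f t))"
  by (rule bounded_linear.continuous_on[OF bounded_clinearD(1)[OF assms] continuous_on_apply_bcontfun])

context
  fixes \<phi> :: "'x::complex_banach \<Rightarrow> complex" and B :: "'h::complex_hilbert \<Rightarrow> 'g \<Rightarrow>\<^sub>C 'x"
  assumes \<phi>: "\<phi> \<in> dual_ball" and B: "bounded_clinear B"
begin

interpretation B: bounded_linear B by (rule bounded_clinearD(1)[OF B])
interpretation \<phi>: bounded_linear \<phi> by (rule bounded_clinearD(1)[OF dual_ballD(1)[OF \<phi>]])

lemma functional_le: "cmod (\<phi> (apply_bcontfun (B h) t)) \<le> onorm B * norm h"
proof -
  have "cmod (\<phi> (apply_bcontfun (B h) t)) \<le> norm (apply_bcontfun (B h) t)" by (rule dual_ballD(2)[OF \<phi>])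
  also have "\<dots> \<le> norm (B h)" by (rule norm_bounded)
  also have "\<dots> \<le> onorm B * norm h" by (rule onorm[OF B.bounded_linear_axioms])
  finally show ?thesis .
qed

lemma functional_coeff_integrable:
  assumes "\<gamma> \<in> dual_group"
  shows "integrable m (\<lambda>t. cnj (\<gamma> t) * \<phi> (apply_bcontfun (B h) t))"
  using assms
  by (intro integrable_continuous continuous_intros continuous_functional dual_ballD(1)[OF \<phi>] dual_groupD(1))

lemma functional_scaleC: "\<phi> (apply_bcontfun (B (c *\<^sub>C h)) t) = c * \<phi> (apply_bcontfun (B h) t)"
  using bounded_clinearD(2)[OF B] bounded_clinearD(2)[OF dual_ballD(1)[OF \<phi>]]
  by (simp add: scaleC_complex_def)

lemma bounded_clinear_functional_coeff:
  assumes \<gamma>: "\<gamma> \<in> dual_group"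
  shows "bounded_clinear (functional_coeff \<phi> B \<gamma>)"
  unfolding bounded_clinear_def
proof (intro conjI allI)
  show scale: "functional_coeff \<phi> B \<gamma> (c *\<^sub>C h) = c *\<^sub>C functional_coeff \<phi> B \<gamma> h" for c h
  proof -
    have "functional_coeff \<phi> B \<gamma> (c *\<^sub>C h) = (\<integral>t. c * (cnj (\<gamma> t) * \<phi> (apply_bcontfun (B h) t)) \<partial>m)"
      unfolding functional_coeff_def functional_scaleC by (simp only: mult_ac)
    then show ?thesis unfolding integral_mult_right_zero functional_coeff_def scaleC_complex_def .
  qed
  show "bounded_linear (functional_coeff \<phi> B \<gamma>)"
  proof (rule bounded_linear_intro[of _ "onorm B"])
    show "functional_coeff \<phi> B \<gamma> (x + y) = functional_coeff \<phi> B \<gamma> x + functional_coeff \<phi> B \<gamma> y" for x y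
      using functional_coeff_integrable[OF \<gamma>]
      by (simp add: functional_coeff_def B.add \<phi>.add distrib_left)
    show "functional_coeff \<phi> B \<gamma> (r *\<^sub>R x) = r *\<^sub>R functional_coeff \<phi> B \<gamma> x" for r x
      by (simp add: scaleR_scaleC scale)
    show "norm (functional_coeff \<phi> B \<gamma> x) \<le> norm x * onorm B" for x
      unfolding functional_coeff_def
      by (intro norm_integral_le functional_coeff_integrable[OF \<gamma>])
        (simp add: norm_mult dual_groupD(2)[OF \<gamma>] functional_le mult.commute[of "norm x"])
  qed
qed

text \<open>The \<open>v \<gamma>\<close> are chosen so that
  \<open>?\<psi> \<gamma> (v \<gamma>)\<close> is the square sum over n. Summing over
  \<open>\<gamma>\<close> gives an integral in which the argument \<open>?p t\<close> of
  \<open>B\<close> and the evaluation point t move together; the supremum norm on C(G) bounds its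
  integrand by \<open>onorm B * norm (?p t)\<close>. Suborthonormality bounds the square sum of the
  \<open>v \<gamma>\<close> by S again, so the L1 estimate closes the circle.\<close>

lemma functional_coeff_hilbert_schmidt:
  fixes N :: nat
  assumes F: "finite F" "F \<subseteq> dual_group" and h: "suborthonormal_on {..<N} h"
  shows "(\<Sum>n<N. \<Sum>\<gamma>\<in>F. (cmod (functional_coeff \<phi> B \<gamma> (h n)))\<^sup>2) \<le> (onorm B)\<^sup>2"
proof -
  let ?\<psi> = "functional_coeff \<phi> B"
  define S where "S = (\<Sum>n<N. \<Sum>\<gamma>\<in>F. (cmod (?\<psi> \<gamma> (h n)))\<^sup>2)"
  define v where "v \<gamma> = (\<Sum>n<N. cnj (?\<psi> \<gamma> (h n)) *\<^sub>C h n)" for \<gamma>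
  have S0: "0 \<le> S" unfolding S_def by (intro sum_nonneg) simp
  have S: "S = (\<Sum>\<gamma>\<in>F. \<Sum>n<N. (cmod (?\<psi> \<gamma> (h n)))\<^sup>2)" unfolding S_def by (rule sum.swap)
  have "(norm (v \<gamma>))\<^sup>2 \<le> (\<Sum>n<N. (cmod (?\<psi> \<gamma> (h n)))\<^sup>2)" for \<gamma>
    unfolding v_def using suborthonormal_norm_sum_le[OF _ h, of "\<lambda>n. cnj (?\<psi> \<gamma> (h n))"] by simp
  then have vS: "(\<Sum>\<gamma>\<in>F. (norm (v \<gamma>))\<^sup>2) \<le> S" unfolding S by (rule sum_mono)
  have sum_sq: "?\<psi> \<gamma> (v \<gamma>) = complex_of_real (\<Sum>n<N. (cmod (?\<psi> \<gamma> (h n)))\<^sup>2)" if "\<gamma> \<in> F" for \<gamma>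
  proof -
    have "bounded_clinear (?\<psi> \<gamma>)" using that F(2) by (intro bounded_clinear_functional_coeff) blast
    show ?thesis
      unfolding v_def bounded_clinear_sum_scaleC[OF \<open>bounded_clinear (?\<psi> \<gamma>)\<close>] of_real_sum
        scaleC_complex_def complex_norm_square
      by (simp only: mult.commute)
  qed
  let ?p = "\<lambda>t. \<Sum>\<gamma>\<in>F. cnj (\<gamma> t) *\<^sub>C v \<gamma>"
  have p: "\<phi> (apply_bcontfun (B (?p t)) t) = (\<Sum>\<gamma>\<in>F. cnj (\<gamma> t) * \<phi> (apply_bcontfun (B (v \<gamma>)) t))" for t
  proof -
    have "bounded_clinear (\<lambda>h. \<phi> (apply_bcontfun (B h) t))"
      unfolding bounded_clinear_def
      by (intro conjI bounded_linear_intro[of _ "onorm B"])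
        (simp_all add: B.add \<phi>.add functional_scaleC scaleR_scaleC scaleC_complex_def functional_le
          mult.commute[of _ "onorm B"])
    from bounded_clinear_sum_scaleC[OF this] show ?thesis by (simp add: scaleC_complex_def)
  qed
  have int: "integrable m (\<lambda>t. cnj (\<gamma> t) * \<phi> (apply_bcontfun (B (v \<gamma>)) t))" if "\<gamma> \<in> F" for \<gamma>
    using that F(2) by (intro functional_coeff_integrable) blast
  have "S = cmod (\<Sum>\<gamma>\<in>F. ?\<psi> \<gamma> (v \<gamma>))"
    using S0 by (simp add: sum_sq S flip: of_real_sum del: of_real_power)
  also have "(\<Sum>\<gamma>\<in>F. ?\<psi> \<gamma> (v \<gamma>)) = (\<integral>t. \<phi> (apply_bcontfun (B (?p t)) t) \<partial>m)"
    unfolding p functional_coeff_def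
    by (rule Bochner_Integration.integral_sum[symmetric]) (rule int)
  also have "cmod \<dots> \<le> (\<integral>t. cmod (\<phi> (apply_bcontfun (B (?p t)) t)) \<partial>m)"
    by (rule integral_norm_bound)
  also have "\<dots> \<le> (\<integral>t. onorm B * norm (?p t) \<partial>m)"
  proof (rule integral_mono)
    show "integrable m (\<lambda>t. cmod (\<phi> (apply_bcontfun (B (?p t)) t)))"
      unfolding p using int by (intro integrable_norm Bochner_Integration.integrable_sum)
    show "integrable m (\<lambda>t. onorm B * norm (?p t))"
      by (intro integrable_continuous continuous_intros continuous_trig_polynomial F)
  qed (rule functional_le)
  also have "\<dots> \<le> onorm B * sqrt S"
    unfolding integral_mult_right_zero
    by (intro mult_left_mono trig_polynomial_L1_norm_le F vS onorm_pos_le B.bounded_linear_axioms)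
  finally show ?thesis
    unfolding S_def[symmetric] by (intro le_power2_of_le_mult_sqrt S0 onorm_pos_le B.bounded_linear_axioms)
qed

text \<open>Seen through \<open>\<phi>\<close>, convolving f with the measure of density
  \<open>\<gamma>\<close> yields \<open>\<gamma>\<close> times the Fourier coefficient of f at
  \<open>\<gamma>\<close>; orthogonality of characters then makes the matrix diagonal.\<close>

lemma functional_coeff_convolution:
  assumes conv: "convolution f (density_cmeasure \<gamma>) = apply_bcontfun (B h)"
    and \<gamma>: "\<gamma> \<in> dual_group" and \<gamma>': "\<gamma>' \<in> dual_group"
  shows "functional_coeff \<phi> B \<gamma>' h = (if \<gamma> = \<gamma>' then \<phi> (fourier_coeff m f \<gamma>) else 0)"
proof -
  have b\<phi>: "bounded_clinear \<phi>" by (rule dual_ballD(1)[OF \<phi>])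
  have b1: "bounded_borel (\<lambda>_::'g. 1)" by (intro bounded_borel_continuous continuous_intros)
  \<comment> \<open>The Haar measure has density 1, so the Fourier coefficient falls under the same
    formula as the convolution.\<close>
  have one: "cmeas (density_cmeasure (\<lambda>_. 1)) = (\<lambda>E. complex_of_real (measure m E))"
  proof
    fix E
    show "cmeas (density_cmeasure (\<lambda>_. 1)) E = complex_of_real (measure m E)"
    proof (cases "E \<in> sets borel")
      case True
      then show ?thesis by (simp add: cmeas_density[OF b1] set_lebesgue_integral_def scaleR_conv_of_real)
    next
      case False
      then show ?thesis
        using cmeas[of "density_cmeasure (\<lambda>_. 1)"]
        by (simp add: regular_complex_measures_def measure_notin_sets)
    qed
  qed
  have "\<phi> (fourier_coeff m f \<gamma>) = (\<integral>t. \<phi> (cnj (\<gamma> t) *\<^sub>C apply_bcontfun f t) * 1 \<partial>m)"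
    unfolding fourier_coeff_def one[symmetric]
    by (intro functional_cintegral_density b1 b\<phi> continuous_on_scaleC continuous_on_cnj dual_groupD(1) \<gamma>
        continuous_on_apply_bcontfun)
  then have coeff: "\<phi> (fourier_coeff m f \<gamma>) = (\<integral>t. cnj (\<gamma> t) * \<phi> (apply_bcontfun f t) \<partial>m)"
    using bounded_clinearD(2)[OF b\<phi>] by (simp add: scaleC_complex_def)
  have "\<phi> (apply_bcontfun (B h) t) = \<gamma> t * \<phi> (fourier_coeff m f \<gamma>)" for t
  proof -
    have cont: "continuous_on UNIV (\<lambda>u. apply_bcontfun f (t - u))" for t
      by (intro continuous_on_compose2[OF continuous_on_apply_bcontfun] continuous_intros) auto
    let ?g = "\<lambda>u. \<phi> (apply_bcontfun f (t - u)) * \<gamma> u"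
    have contg: "continuous_on UNIV ?g"
      by (intro continuous_intros \<phi>.continuous_on cont dual_groupD(1) \<gamma>)
    have "\<phi> (apply_bcontfun (B h) t) = (\<integral>u. ?g u \<partial>m)"
      using functional_cintegral_density[OF bounded_borel_continuous[OF dual_groupD(1)[OF \<gamma>]] cont b\<phi>, of t]
      by (simp add: conv[symmetric] convolution_def)
    \<comment> \<open>The shift by t leaves f at -u; reflection invariance of m then produces the
      Fourier integral.\<close>
    also have "\<dots> = (\<integral>u. ?g (t + u) \<partial>m)"
      by (rule integral_translate[OF borel_measurable_continuous_onI[OF contg], symmetric])
    also have "\<dots> = (\<integral>u. \<gamma> t * (cnj (\<gamma> (- u)) * \<phi> (apply_bcontfun f (- u))) \<partial>m)"
      by (simp add: dual_groupD(3,5)[OF \<gamma>] mult_ac)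
    also have "\<dots> = \<gamma> t * (\<integral>u. cnj (\<gamma> u) * \<phi> (apply_bcontfun f u) \<partial>m)"
      using integral_reflect[of "\<lambda>u. cnj (\<gamma> u) * \<phi> (apply_bcontfun f u)"]
      unfolding integral_mult_right_zero
      by (simp add: continuous_on_mult continuous_on_cnj dual_groupD(1)[OF \<gamma>] continuous_functional[OF b\<phi>])
    finally show ?thesis by (simp only: coeff)
  qed
  then have "functional_coeff \<phi> B \<gamma>' h = (\<integral>t. (cnj (\<gamma>' t) * \<gamma> t) * \<phi> (fourier_coeff m f \<gamma>) \<partial>m)"
    by (simp add: functional_coeff_def mult.assoc)
  also have "\<dots> = (\<integral>t. cnj (\<gamma>' t) * \<gamma> t \<partial>m) * \<phi> (fourier_coeff m f \<gamma>)"
    by (rule integral_mult_left_zero)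
  finally show ?thesis using characters_orthonormal[OF \<gamma>' \<gamma>] by auto
qed

end

end

section \<open>The exponents, the weak summability bound and the summing operator\<close>

lemma inverse_exponent_cases:
  fixes r :: ennreal
  assumes s: "0 < s" "s \<le> 1" and r: "1 / r = ennreal (1 / s - 1)"
  obtains "s = 1" "r = \<infinity>" | "s < 1" "r \<noteq> \<infinity>" "enn2real r = s / (1 - s)"
proof (cases "s = 1")
  case True
  then have "r = \<infinity>" using r by (simp add: divide_ennreal_def)
  then show ?thesis using True that(1) by blast
next
  case False
  then have s1: "s < 1" using s by simp
  then have pos: "1 / s - 1 > 0" using s by (simp add: field_simps)
  have "inverse r = ennreal (1 / s - 1)" using r by (simp add: divide_ennreal_def)
  moreover have "r \<noteq> \<infinity>" using calculation pos by (auto simp: ennreal_eq_0_iff)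
  moreover have "r \<noteq> 0" using calculation by auto
  ultimately obtain x where x: "r = ennreal x" "0 < x" "ennreal (inverse x) = ennreal (1 / s - 1)"
    by (cases r) (auto simp: inverse_ennreal ennreal_eq_0_iff less_le)
  then have "inverse x = 1 / s - 1" using pos by simp
  then have "x = inverse (1 / s - 1)" by (metis inverse_inverse_eq)
  also have "\<dots> = s / (1 - s)" using s s1 by (simp add: field_simps)
  finally have "r = ennreal (s / (1 - s))" using x(1) by simp
  then show ?thesis using that(2) s s1 by simp
qed

text \<open>Uniform version for \<open>r < \<infinity>\<close> and \<open>r = \<infinity>\<close> of the facts on singular numbers; the estimate
  with \<open>c\<close> and \<open>e\<close> is Young's inequality for the exponents \<open>1 / s\<close> and \<open>1 / (1 - s)\<close>.\<close>

lemma schatten_class_approximation: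
  fixes U :: "'h::complex_hilbert \<Rightarrow> 'h"
  assumes s: "0 < s" "s \<le> 1" and r: "1 / r = ennreal (1 / s - 1)" and U: "U \<in> schatten_class r"
  shows "bounded_clinear U \<and> (\<exists>\<sigma> c e R. (\<forall>n. 0 \<le> \<sigma> n) \<and>
    (\<forall>n. \<exists>B. finite B \<and> card B \<le> n \<and>
      (\<forall>x. (\<forall>b\<in>B. cinner x b = 0) \<longrightarrow> norm (U x) \<le> \<sigma> n * norm x)) \<and>
    0 \<le> c \<and> (\<forall>n p. 0 \<le> p \<longrightarrow> (p * \<sigma> n) powr s \<le> c * p + e n) \<and>
    (\<forall>N::nat. (\<Sum>n<N. e n) \<le> (R::real)))"
  using s r
proof (cases rule: inverse_exponent_cases)
  case 1
  then have Ub: "bounded_clinear U" using U by (simp add: schatten_class_def)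
  have k: "0 \<le> onorm U" by (rule onorm_pos_le[OF bounded_clinearD(1)[OF Ub]])
  have "norm (U x) \<le> onorm U * norm x" for x by (rule onorm[OF bounded_clinearD(1)[OF Ub]])
  \<comment> \<open>For s = 1 the estimate holds with equality for \<sigma> n = c = onorm U and e =
    0, and no vectors need to be removed.\<close>
  then show ?thesis
    using Ub k 1
    by (intro conjI exI[of _ "\<lambda>_. onorm U"] exI[of _ "onorm U"] exI[of _ "\<lambda>_. 0"] exI[of _ 0])
      (auto simp: mult.commute intro!: exI[of _ "{}"])
next
  case 2
  let ?q = "s / (1 - s)"
  obtain \<sigma> where U': "compact_operator U" and \<sigma>: "singular_numbers U \<sigma>"
    and sum: "summable (\<lambda>n. \<sigma> n powr ?q)"
    using U 2 by (auto simp: schatten_class_def)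
  have nonneg: "0 \<le> \<sigma> n" for n using \<sigma> by (simp add: singular_numbers_def)
  have young: "(p * \<sigma> n) powr s \<le> s * p + (1 - s) * \<sigma> n powr ?q" if p: "0 \<le> p" for p n
  proof -
    have "(p * \<sigma> n) powr s = p powr s * \<sigma> n powr s" using p nonneg by (simp add: powr_mult)
    also have "\<dots> \<le> (p powr s) powr (1 / s) / (1 / s) + (\<sigma> n powr s) powr (1 / (1 - s)) / (1 / (1 - s))"
      using s 2 by (intro Youngs_inequality) (auto simp: field_simps)
    also have "\<dots> = s * p + (1 - s) * \<sigma> n powr ?q"
      using s p 2 by (simp add: powr_powr)
    finally show ?thesis .
  qed
  have "(\<Sum>n<N. (1 - s) * \<sigma> n powr ?q) \<le> (1 - s) * suminf (\<lambda>n. \<sigma> n powr ?q)" for N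
    unfolding sum_distrib_left[symmetric]
    using 2 sum by (intro mult_left_mono sum_le_suminf) auto
  then show ?thesis
    using compact_operator_bounded_clinear[OF U'] nonneg singular_number_bound[OF U' \<sigma>] s young
    by (intro conjI exI[of _ \<sigma>] exI[of _ s] exI[of _ "\<lambda>n. (1 - s) * \<sigma> n powr ?q"]
        exI[of _ "(1 - s) * suminf (\<lambda>n. \<sigma> n powr ?q)"]) auto
qed

text \<open>The point is that \<open>K\<close> is chosen before \<open>F\<close> and
  \<open>\<phi>\<close>, as weak summability requires.\<close>

lemma (in compact_haar) weak_powr_sum_bound:
  fixes f :: "'g \<Rightarrow>\<^sub>C 'x::complex_banach" and A :: "'g cmeasure \<Rightarrow> 'h::complex_hilbert"
  assumes s: "0 < s" "s \<le> 1" and r: "1 / r = ennreal (1 / s - 1)" and U: "U \<in> schatten_class r"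
    and A: "bounded_clinear A" and B: "bounded_clinear B"
    and conv: "\<And>\<mu>. convolution f \<mu> = apply_bcontfun (B (U (A \<mu>)))"
  shows "\<exists>K. \<forall>F \<phi>. finite F \<longrightarrow> F \<subseteq> dual_group \<longrightarrow> \<phi> \<in> dual_ball \<longrightarrow>
    (\<Sum>\<gamma>\<in>F. cmod (\<phi> (fourier_coeff m f \<gamma>)) powr s) \<le> K"
proof -
  obtain \<sigma> c e R where Ub: "bounded_clinear U" and \<sigma>: "\<And>n. 0 \<le> \<sigma> n"
    and bound: "\<And>n. \<exists>B. finite B \<and> card B \<le> n \<and>
      (\<forall>x. (\<forall>b\<in>B. cinner x b = 0) \<longrightarrow> norm (U x) \<le> \<sigma> n * norm x)"
    and c: "0 \<le> c" and young: "\<And>n p. 0 \<le> p \<Longrightarrow> (p * \<sigma> n) powr s \<le> c * p + e n"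
    and e: "\<And>N::nat. (\<Sum>n<N. e n) \<le> R"
    using schatten_class_approximation[OF s r U] by blast
  have "(\<Sum>\<gamma>\<in>F. cmod (\<phi> (fourier_coeff m f \<gamma>)) powr s) \<le>
      3 * (2 * c * ((onorm A)\<^sup>2 + (onorm B)\<^sup>2) + R)"
    if F: "finite F" "F \<subseteq> dual_group" and \<phi>: "\<phi> \<in> dual_ball" for F \<phi>
    using s(1) F(1) Ub
  proof (rule diagonal_powr_sum_bound[where a = "\<lambda>\<gamma>. A (density_cmeasure \<gamma>)"
        and \<psi> = "functional_coeff \<phi> B"])
    show "bounded_clinear (functional_coeff \<phi> B \<gamma>)" if "\<gamma> \<in> F" for \<gamma>
      using that F(2) by (intro bounded_clinear_functional_coeff[OF \<phi> B]) blast
    show "functional_coeff \<phi> B \<gamma>' (U (A (density_cmeasure \<gamma>))) =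
        (if \<gamma> = \<gamma>' then \<phi> (fourier_coeff m f \<gamma>) else 0)" if "\<gamma> \<in> F" "\<gamma>' \<in> F" for \<gamma> \<gamma>'
      using that F(2) by (intro functional_coeff_convolution[OF \<phi> B conv]) blast+
    show "(\<Sum>\<gamma>\<in>F. (norm (A (density_cmeasure \<gamma>)))\<^sup>2) \<le> (onorm A)\<^sup>2"
      by (rule characters_hilbert_schmidt[OF A F])
    show "(\<Sum>n<N. \<Sum>\<gamma>\<in>F. (cmod (functional_coeff \<phi> B \<gamma> (h n)))\<^sup>2) \<le> (onorm B)\<^sup>2"
      if "suborthonormal_on {..<N} h" for N :: nat and h
      by (rule functional_coeff_hilbert_schmidt[OF \<phi> B F that])
  qed (fact \<sigma> bound c young e)+
  then show ?thesis by blast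
qed

lemma dual_ball_nonempty: "(dual_ball :: ('x::complex_normed_vector \<Rightarrow> complex) set) \<noteq> {}"
proof -
  have "(\<lambda>_. 0) \<in> (dual_ball :: ('x \<Rightarrow> complex) set)"
    by (simp add: dual_ball_def bounded_clinear_def onorm_zero)
  then show ?thesis by blast
qed

text \<open>An explicit bound \<open>K\<close> replaces the supremum over the dual ball, and a
  bijection with 1..card F passes from sequences to arbitrary finite index sets.\<close>

lemma absolutely_summing_finite_sum_le:
  fixes T :: "'x::complex_banach \<Rightarrow> 'y::complex_banach" and x :: "'i \<Rightarrow> 'x"
  assumes T: "T \<in> absolutely_summing s"
  shows "\<exists>C>0. \<forall>F K. finite F \<longrightarrow> (\<forall>\<phi>\<in>dual_ball. (\<Sum>i\<in>F. cmod (\<phi> (x i)) powr s) \<le> K) \<longrightarrow>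
    (\<Sum>i\<in>F. norm (T (x i)) powr s) \<le> C powr s * K"
proof -
  obtain C where C: "C > 0" "\<And>N (x :: nat \<Rightarrow> 'x). (\<Sum>n=1..N. norm (T (x n)) powr s) \<le>
      C powr s * (SUP \<phi>\<in>dual_ball. \<Sum>n=1..N. cmod (\<phi> (x n)) powr s)"
    using T unfolding absolutely_summing_def by blast
  have "(\<Sum>i\<in>F. norm (T (x i)) powr s) \<le> C powr s * K"
    if F: "finite F" and K: "\<forall>\<phi>\<in>dual_ball. (\<Sum>i\<in>F. cmod (\<phi> (x i)) powr s) \<le> K" for F K
  proof -
    obtain h where h: "bij_betw h {1..card F} F"
      using ex_bij_betw_nat_finite_1[OF F] by blast
    have "(\<Sum>i\<in>F. norm (T (x i)) powr s) = (\<Sum>n=1..card F. norm (T (x (h n))) powr s)"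
      by (rule sum.reindex_bij_betw[OF h, symmetric])
    also have "\<dots> \<le> C powr s * (SUP \<phi>\<in>dual_ball. \<Sum>n=1..card F. cmod (\<phi> (x (h n))) powr s)"
      by (rule C(2))
    also have "\<dots> \<le> C powr s * K"
    proof (intro mult_left_mono cSUP_least dual_ball_nonempty)
      fix \<phi> :: "'x \<Rightarrow> complex" assume "\<phi> \<in> dual_ball"
      then show "(\<Sum>n=1..card F. cmod (\<phi> (x (h n))) powr s) \<le> K"
        using K sum.reindex_bij_betw[OF h, of "\<lambda>i. cmod (\<phi> (x i)) powr s"] by simp
    qed simp
    finally show ?thesis .
  qed
  then show ?thesis using C(1) by blast
qed

theorem theorem4p8:
  fixes m :: "'g::{topological_ab_group_add, t2_space} measure"
    and T :: "'x::complex_banach \<Rightarrow> 'y::complex_banach"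
    and s :: real and r :: ennreal
  assumes "compact (UNIV :: 'g set)"
    and "normalized_haar m"
    and "0 < s" and "s \<le> 1"
    and "1 / r = ennreal (1 / s - 1)"
    and "T \<in> absolutely_summing s"
  shows "property_l TYPE('h::complex_hilbert) m s r T"
  unfolding property_l_def
proof (intro conjI allI impI)
  show "bounded_clinear T" using assms(6) by (simp add: absolutely_summing_def)
  fix f :: "'g \<Rightarrow>\<^sub>C 'x"
  assume "\<exists>(A :: 'g cmeasure \<Rightarrow> 'h) (U :: 'h \<Rightarrow> 'h) (B :: 'h \<Rightarrow> 'g \<Rightarrow>\<^sub>C 'x).
    bounded_clinear A \<and> U \<in> schatten_class r \<and> bounded_clinear B \<and>
    (\<forall>\<mu>. convolution f \<mu> = apply_bcontfun (B (U (A \<mu>))))"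
  then obtain A :: "'g cmeasure \<Rightarrow> 'h" and U :: "'h \<Rightarrow> 'h" and B :: "'h \<Rightarrow> 'g \<Rightarrow>\<^sub>C 'x" where
    A: "bounded_clinear A" and U: "U \<in> schatten_class r" and B: "bounded_clinear B"
    and conv: "\<And>\<mu>. convolution f \<mu> = apply_bcontfun (B (U (A \<mu>)))" by blast
  interpret compact_haar m by unfold_locales (fact assms)+
  obtain K where K: "\<And>F \<phi>. finite F \<Longrightarrow> F \<subseteq> dual_group \<Longrightarrow> \<phi> \<in> dual_ball \<Longrightarrow>
      (\<Sum>\<gamma>\<in>F. cmod (\<phi> (fourier_coeff m f \<gamma>)) powr s) \<le> K"
    using weak_powr_sum_bound[OF assms(3-5) U A B conv] by blast
  obtain C where C: "\<And>F K. finite F \<Longrightarrow>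
      \<forall>\<phi>\<in>dual_ball. (\<Sum>\<gamma>\<in>F. cmod (\<phi> (fourier_coeff m f \<gamma>)) powr s) \<le> K \<Longrightarrow>
      (\<Sum>\<gamma>\<in>F. norm (T (fourier_coeff m f \<gamma>)) powr s) \<le> C powr s * K"
    using absolutely_summing_finite_sum_le[OF assms(6), of "fourier_coeff m f"] by blast
  show "(\<lambda>\<gamma>. norm (T (fourier_coeff m f \<gamma>)) powr s) summable_on dual_group"
  \<comment> \<open>The dual group may be uncountable; for nonnegative terms, bounded finite partial
    sums suffice.\<close>
  proof (rule nonneg_bdd_above_summable_on)
    show "bdd_above (sum (\<lambda>\<gamma>. norm (T (fourier_coeff m f \<gamma>)) powr s) ` {F. F \<subseteq> dual_group \<and> finite F})"
      by (rule bdd_aboveI2[where M = "C powr s * K"]) (use C K in blast)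
  qed simp
qed

end
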